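(* Let $(\alpha(N))_{N\ge 1}$ be any nondecreasing function of $N$ with positive values such that $\lim_{N\to\infty}\alpha(N)/N=0$. Then for any $n\ge 0$ and any functions $f_p\in\mathcal B(E_p)$, $p\geq 0$, $$\lim_{N\to\infty}\frac1{\alpha(N)}\log \mathbb E\Big(\exp\Big\{\sqrt{\alpha(N)}\sum_{p=0}^n V^N_p(f_p)\Big\}\Big)=\frac12\sum_{p=0}^n\mathbb E\big(V_p(f_p)^2\big)$$ and $$\lim_{N\to\infty}\frac1{\alpha(N)}\log \mathbb E\Big(\exp\Big\{\sqrt{\alpha(N)}\,W^N_n(f_n)\Big\}\Big)=\frac12\,\mathbb E\big(W_n(f_n)^2\big).$$
   Context: Notation. For a measurable space $(E,\mathcal E)$: $\mathcal P(E)$ is the set of probability measures, $\mathcal M(E)$ the set of finite signed measures, $\mathcal B(E)$ the bounded measurable real functions with the sup norm $\|\cdot\|$, $\mathrm{osc}(f)=\sup_{x,y}|f(x)-f(y)|$, $\mathrm{Osc}_1(E)=\{f\text{ measurable}:\mathrm{osc}(f)\le 1\}$, $\mu(f)=\int f\,d\mu$. A bounded integral operator $M$ from $E$ into $F$ is an operator $f\mapsto M(f)(x)=\int_F M(x,dy)f(y)$ from $\mathcal B(F)$ into $\mathcal B(E)$; $(\mu M)(f):=\mu(M(f))$; products of operators are compositions; $\beta(M):=\sup\{\mathrm{osc}(M(f)):f\in\mathrm{Osc}_1(F)\}$. Model. $(E_n,\mathcal E_n)_{n\ge0}$ are measurable spaces; for $n\ge1$ and $\eta\in\mathcal P(E_{n-1})$,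 $K_{n,\eta}$ is a Markov kernel from $E_{n-1}$ to $E_n$; $\Phi_n(\eta):=\eta K_{n,\eta}\in\mathcal P(E_n)$; $\eta_0\in\mathcal P(E_0)$ is given and $\eta_n=\Phi_n(\eta_{n-1})$. The maps $(x^i)_{1\le i\le N}\mapsto K_{n+1,\frac1N\sum_j\delta_{x^j}}(x^i,A)$ are measurable for every measurable $A\subset E_{n+1}$. For $N\ge1$, the particle system $\xi_n=(\xi_n^{1},\dots,\xi_n^{N})\in E_n^N$ is a Markov chain: $\xi_0$ consists of $N$ i.i.d. variables of law $\eta_0$, and given $\xi_0,\dots,\xi_{n-1}$ the $\xi_n^{i}$ are independent with respective laws $K_{n,\eta^N_{n-1}}(\xi_{n-1}^{i},\cdot)$, where $\eta^N_n:=\frac1N\sum_{j=1}^N\delta_{\xi_n^{j}}$. Set $V_n^N:=\sqrt N(\eta_n^N-\eta^N_{n-1}K_{n,\eta^N_{n-1}})$ for $n\ge1$, $V^N_0:=\sqrt N(\eta^N_0-\eta_0)$, and $W_n^N:=\sqrt N(\eta_n^N-\eta_n)$. Regularity class $\Upsilon(E_1,E_2)$: mappings $\Phi:\mathcal P(E_1)\to\mathcal P(E_2)$ with $\Phi(\mu)-\Phi(\eta)=(\mu-\eta)D_\eta\Phi+\mathcal R^\Phi(\mu,\eta)$ for all $\mu,\eta$, where (i) $D_\eta\Phi$ are bounded integral operators from $E_1$ into $E_2$ with $D_\eta\Phi(1)=0$ and $\sup_\eta\beta(D_\eta\Phi)<\infty$; (ii) $|\mathcal R^\Phi(\mu,\eta)(f)|\le\int|(\mu-\eta)^{\otimes2}(g)|\,R^\Phi_\eta(f,dg)$,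 where for each $f\in\mathcal B(E_2)$, $R^\Phi_\eta(f,\cdot)$ is a nonnegative measure on functions $g=g_1\otimes g_2$, $(g_1,g_2)\in\mathrm{Osc}_1(E_1)^2$, with $\sup_\eta\int\mathrm{osc}(g_1)\mathrm{osc}(g_2)R^\Phi_\eta(f,d(g_1\otimes g_2))\le\mathrm{osc}(f)\,\delta(R^\Phi)$ and $\delta(R^\Phi)<\infty$. Condition (K) for a family $K_\eta$, $\eta\in\mathcal P(E_1)$, of Markov kernels from $E_1$ to $E_2$: for all $f\in\mathrm{Osc}_1(E_2)$, $\|[K_\mu-K_\eta](f)\|\le\int|(\mu-\eta)(h)|\,T^K_\eta(f,dh)$ for some nonnegative measures $T^K_\eta(f,\cdot)$ on $\mathcal B(E_1)$ with $\sup_\eta\int\mathrm{osc}(h)T^K_\eta(f,dh)\le\mathrm{osc}(f)\,\delta(T^K)$, $\delta(T^K)<\infty$. Standing assumption (H1): for every $n\ge1$ the family $K_{n,\eta}$ satisfies (K) and $\Phi_n\in\Upsilon(E_{n-1},E_n)$. Set $\mathcal D_n:=D_{\eta_{n-1}}\Phi_n$, $\mathcal D_{p,n}:=\mathcal D_{p+1}\mathcal D_{p+2}\cdots\mathcal D_n$, $\mathcal D_{n,n}:=Id$. Limit fields. $(V_n)_{n\ge0}$ are independent centered Gaussian random fields on $\mathcal B(E_n)$ with $\mathbb E(V_n(f)V_n(g))=\eta_{n-1}K_{n,\eta_{n-1}}\big([f-K_{n,\eta_{n-1}}(f)][g-K_{n,\eta_{n-1}}(g)]\big)$, i.e. $\int\eta_{n-1}(dx)\int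 K_{n,\eta_{n-1}}(x,dy)[f(y)-K_{n,\eta_{n-1}}(f)(x)][g(y)-K_{n,\eta_{n-1}}(g)(x)]$, with the convention for $n=0$ that $K_{0,\eta_{-1}}(x,dy)=\eta_0(dy)$ (so $\mathbb E(V_0(f)V_0(g))$ is the covariance of $f,g$ under $\eta_0$). Finally $W_n(f):=\sum_{p=0}^nV_p(\mathcal D_{p,n}(f))$.
   Formalization: The measures T and R on functions, for which the text fixes no sigma-algebra, are required to make the evaluations (x,h) -> h(x), and likewise for g1 and g2, jointly measurable and osc measurable; without joint measurability the claim can fail. *)

theory Defs
  imports "HOL-Probability.Probability"
begin

section \<open>Function spaces, oscillations and integral operators\<close>

text \<open>
  A measurable space is represented by a measure whose \<^const>\<open>space\<close> and \<^const>\<open>sets\<close> are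
  used and whose values are irrelevant.  The set of probability measures on \<open>E\<close> is
  \<open>space (prob_algebra E)\<close>.
\<close>

abbreviation probs :: "'a measure \<Rightarrow> 'a measure set"
  where "probs E \<equiv> space (prob_algebra E)"

definition bfun :: "'a measure \<Rightarrow> ('a \<Rightarrow> real) set"
  where "bfun E = {f \<in> borel_measurable E. bounded (f ` space E)}"

definition osc :: "'a measure \<Rightarrow> ('a \<Rightarrow> real) \<Rightarrow> ennreal"
  where "osc E f = (SUP x\<in>space E. SUP y\<in>space E. ennreal \<bar>f x - f y\<bar>)"

definition Osc1 :: "'a measure \<Rightarrow> ('a \<Rightarrow> real) set"
  where "Osc1 E = {f \<in> borel_measurable E. osc E f \<le> 1}"

text \<open>
  The finite signed measure \<open>M(x, dy)\<close> is given as a difference of two finite measures.  No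
  measurability of these in \<open>x\<close> is required beyond that of \<open>M f\<close> for all bounded measurable \<open>f\<close>.
\<close>

definition bounded_integral_operator ::
    "'a measure \<Rightarrow> 'b measure \<Rightarrow> (('b \<Rightarrow> real) \<Rightarrow> 'a \<Rightarrow> real) \<Rightarrow> bool"
  where "bounded_integral_operator E F M \<longleftrightarrow>
    (\<forall>f\<in>bfun F. M f \<in> bfun E) \<and>
    (\<forall>x\<in>space E. \<exists>P Q. finite_measure P \<and> finite_measure Q \<and> sets P = sets F \<and> sets Q = sets F \<and>
       (\<forall>f\<in>bfun F. M f x = (\<integral>y. f y \<partial>P) - (\<integral>y. f y \<partial>Q)))"

definition dobrushin :: "'a measure \<Rightarrow> 'b measure \<Rightarrow> (('b \<Rightarrow> real) \<Rightarrow> 'a \<Rightarrow> real) \<Rightarrow> ennreal"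
  where "dobrushin E F M = (SUP f\<in>Osc1 F. osc E (M f))"

section \<open>Regularity conditions\<close>

text \<open>
  A measure on a set of functions is a measure \<open>T\<close> on some sigma-algebra for which evaluation
  \<open>(x, h) \<mapsto> h x\<close> is jointly measurable and the oscillation is measurable.  Joint (rather than
  separate) measurability is what makes \<open>h \<mapsto> \<mu>(h)\<close> measurable and Fubini's theorem available.
\<close>

definition fun_measure :: "'a measure \<Rightarrow> ('a \<Rightarrow> real) measure \<Rightarrow> bool"
  where "fun_measure E T \<longleftrightarrow>
    space T \<subseteq> bfun E \<and>
    (\<lambda>(x, h). h x) \<in> borel_measurable (E \<Otimes>\<^sub>M T) \<and>
    osc E \<in> borel_measurable T"

text \<open>The tensor product \<open>g\<^sub>1 \<otimes> g\<^sub>2\<close> is represented by the pair \<open>(g\<^sub>1, g\<^sub>2)\<close>.\<close>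

definition tensor_measure :: "'a measure \<Rightarrow> (('a \<Rightarrow> real) \<times> ('a \<Rightarrow> real)) measure \<Rightarrow> bool"
  where "tensor_measure E R \<longleftrightarrow>
    space R \<subseteq> Osc1 E \<times> Osc1 E \<and>
    (\<lambda>(x, g). fst g x) \<in> borel_measurable (E \<Otimes>\<^sub>M R) \<and>
    (\<lambda>(x, g). snd g x) \<in> borel_measurable (E \<Otimes>\<^sub>M R) \<and>
    (\<lambda>g. osc E (fst g)) \<in> borel_measurable R \<and>
    (\<lambda>g. osc E (snd g)) \<in> borel_measurable R"

definition condition_K ::
    "'a measure \<Rightarrow> 'b measure \<Rightarrow> ('a measure \<Rightarrow> 'a \<Rightarrow> 'b measure) \<Rightarrow> bool"
  where "condition_K E1 E2 K \<longleftrightarrow>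
    (\<exists>T :: 'a measure \<Rightarrow> ('b \<Rightarrow> real) \<Rightarrow> ('a \<Rightarrow> real) measure. \<exists>\<delta> :: ennreal. \<delta> < \<infinity> \<and>
      (\<forall>f\<in>Osc1 E2.
        (\<forall>\<eta>\<in>probs E1. fun_measure E1 (T \<eta> f)) \<and>
        (\<forall>\<mu>\<in>probs E1. \<forall>\<eta>\<in>probs E1.
          (SUP x\<in>space E1. ennreal \<bar>(\<integral>y. f y \<partial>K \<mu> x) - (\<integral>y. f y \<partial>K \<eta> x)\<bar>)
            \<le> (\<integral>\<^sup>+h. ennreal \<bar>(\<integral>x. h x \<partial>\<mu>) - (\<integral>x. h x \<partial>\<eta>)\<bar> \<partial>T \<eta> f)) \<and>
        (SUP \<eta>\<in>probs E1. \<integral>\<^sup>+h. osc E1 h \<partial>T \<eta> f) \<le> osc E2 f * \<delta>))"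

definition remainder ::
    "('a measure \<Rightarrow> 'b measure) \<Rightarrow> ('a measure \<Rightarrow> ('b \<Rightarrow> real) \<Rightarrow> 'a \<Rightarrow> real)
      \<Rightarrow> 'a measure \<Rightarrow> 'a measure \<Rightarrow> ('b \<Rightarrow> real) \<Rightarrow> real"
  where "remainder \<Phi> D \<mu> \<eta> f =
    (\<integral>y. f y \<partial>\<Phi> \<mu>) - (\<integral>y. f y \<partial>\<Phi> \<eta>) - ((\<integral>x. D \<eta> f x \<partial>\<mu>) - (\<integral>x. D \<eta> f x \<partial>\<eta>))"

text \<open>
  \<open>\<Phi>\<close> belongs to the class \<open>\<Upsilon>(E\<^sub>1, E\<^sub>2)\<close> with first-order operators \<open>D \<eta>\<close>.  These are not
  determined by \<open>\<Phi>\<close>, hence they are an argument.  Note that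
  \<open>(\<mu> - \<eta>)\<^sup>\<otimes>\<^sup>2(g\<^sub>1 \<otimes> g\<^sub>2) = (\<mu>(g\<^sub>1) - \<eta>(g\<^sub>1)) (\<mu>(g\<^sub>2) - \<eta>(g\<^sub>2))\<close>.
\<close>

definition class_Upsilon ::
    "'a measure \<Rightarrow> 'b measure \<Rightarrow> ('a measure \<Rightarrow> 'b measure)
      \<Rightarrow> ('a measure \<Rightarrow> ('b \<Rightarrow> real) \<Rightarrow> 'a \<Rightarrow> real) \<Rightarrow> bool"
  where "class_Upsilon E1 E2 \<Phi> D \<longleftrightarrow>
    (\<forall>\<eta>\<in>probs E1. \<Phi> \<eta> \<in> probs E2) \<and>
    (\<forall>\<eta>\<in>probs E1. bounded_integral_operator E1 E2 (D \<eta>) \<and> (\<forall>x\<in>space E1. D \<eta> (\<lambda>_. 1) x = 0)) \<and>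
    (SUP \<eta>\<in>probs E1. dobrushin E1 E2 (D \<eta>)) < \<infinity> \<and>
    (\<exists>R :: 'a measure \<Rightarrow> ('b \<Rightarrow> real) \<Rightarrow> (('a \<Rightarrow> real) \<times> ('a \<Rightarrow> real)) measure.
     \<exists>\<delta> :: ennreal. \<delta> < \<infinity> \<and>
      (\<forall>f\<in>bfun E2.
        (\<forall>\<eta>\<in>probs E1. tensor_measure E1 (R \<eta> f)) \<and>
        (\<forall>\<mu>\<in>probs E1. \<forall>\<eta>\<in>probs E1.
          ennreal \<bar>remainder \<Phi> D \<mu> \<eta> f\<bar>
            \<le> (\<integral>\<^sup>+(g\<^sub>1, g\<^sub>2). ennreal \<bar>((\<integral>x. g\<^sub>1 x \<partial>\<mu>) - (\<integral>x. g\<^sub>1 x \<partial>\<eta>)) *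
                                  ((\<integral>x. g\<^sub>2 x \<partial>\<mu>) - (\<integral>x. g\<^sub>2 x \<partial>\<eta>))\<bar> \<partial>R \<eta> f)) \<and>
        (SUP \<eta>\<in>probs E1. \<integral>\<^sup>+(g\<^sub>1, g\<^sub>2). osc E1 g\<^sub>1 * osc E1 g\<^sub>2 \<partial>R \<eta> f) \<le> osc E2 f * \<delta>))"

section \<open>The measure-valued process and its particle approximation\<close>

definition transport :: "('a measure \<Rightarrow> 'a \<Rightarrow> 'b measure) \<Rightarrow> 'a measure \<Rightarrow> 'b measure"
  where "transport K \<eta> = \<eta> \<bind> K \<eta>"

primrec flow :: "'a measure \<Rightarrow> (nat \<Rightarrow> 'a measure \<Rightarrow> 'a \<Rightarrow> 'a measure) \<Rightarrow> nat \<Rightarrow> 'a measure"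
  where
    "flow \<eta>0 K 0 = \<eta>0"
  | "flow \<eta>0 K (Suc n) = transport (K (Suc n)) (flow \<eta>0 K n)"

text \<open>The empirical measure \<open>1/N (\<delta>\<^bsub>x 1\<^esub> + \<dots> + \<delta>\<^bsub>x N\<^esub>)\<close> on \<open>E\<close>.\<close>

definition emp :: "'a measure \<Rightarrow> nat \<Rightarrow> (nat \<Rightarrow> 'a) \<Rightarrow> 'a measure"
  where "emp E N x = distr (uniform_count_measure {1..N}) E x"

lemma emp_in_probs:
  assumes "N \<ge> 1" "\<And>i. i \<in> {1..N} \<Longrightarrow> x i \<in> space E"
  shows "emp E N x \<in> probs E"
proof -
  have "prob_space (uniform_count_measure {1..N})"
    using assms(1) by (intro prob_space_uniform_count_measure) auto
  moreover have "x \<in> uniform_count_measure {1..N} \<rightarrow>\<^sub>M E"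
    using assms(2) by (auto simp: measurable_def sets_uniform_count_measure space_uniform_count_measure)
  ultimately show ?thesis
    unfolding emp_def by (auto simp: space_prob_algebra intro: prob_space.prob_space_distr)
qed

lemma integral_emp:
  assumes "N \<ge> 1" "\<And>i. i \<in> {1..N} \<Longrightarrow> x i \<in> space E" "f \<in> borel_measurable E"
  shows "(\<integral>y. f y \<partial>emp E N x) = (\<Sum>i=1..N. f (x i)) / real N"
proof -
  have "x \<in> uniform_count_measure {1..N} \<rightarrow>\<^sub>M E"
    using assms(2) by (auto simp: measurable_def sets_uniform_count_measure space_uniform_count_measure)
  then have "(\<integral>y. f y \<partial>emp E N x) = (\<integral>i. f (x i) \<partial>uniform_count_measure {1..N})"
    unfolding emp_def using assms(3) by (rule integral_distr)
  also have "\<dots> = (\<Sum>i=1..N. f (x i)) / real N"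
    unfolding uniform_count_measure_def
    by (simp add: lebesgue_integral_point_measure_finite sum_divide_distrib)
  finally show ?thesis .
qed

definition history ::
    "(nat \<Rightarrow> 'a measure) \<Rightarrow> nat \<Rightarrow> 'w measure \<Rightarrow> (nat \<Rightarrow> nat \<Rightarrow> 'w \<Rightarrow> 'a) \<Rightarrow> nat \<Rightarrow> 'w measure"
  where "history E N M \<xi> n = sigma (space M)
    (\<Union>m\<in>{..n}. \<Union>i\<in>{1..N}. {\<xi> m i -` A \<inter> space M | A. A \<in> sets (E m)})"

definition emp_process ::
    "(nat \<Rightarrow> 'a measure) \<Rightarrow> nat \<Rightarrow> (nat \<Rightarrow> nat \<Rightarrow> 'w \<Rightarrow> 'a) \<Rightarrow> nat \<Rightarrow> 'w \<Rightarrow> 'a measure"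
  where "emp_process E N \<xi> n \<omega> = emp (E n) N (\<lambda>i. \<xi> n i \<omega>)"

text \<open>
  \<open>\<xi> n i\<close> is the \<open>i\<close>-th particle at time \<open>n\<close>.  The last clause says that, given the particles up to
  time \<open>n\<close>, those at time \<open>n + 1\<close> are independent with the prescribed laws.
\<close>

definition particle_system ::
    "(nat \<Rightarrow> 'a measure) \<Rightarrow> (nat \<Rightarrow> 'a measure \<Rightarrow> 'a \<Rightarrow> 'a measure) \<Rightarrow> 'a measure
      \<Rightarrow> nat \<Rightarrow> 'w measure \<Rightarrow> (nat \<Rightarrow> nat \<Rightarrow> 'w \<Rightarrow> 'a) \<Rightarrow> bool"
  where "particle_system E K \<eta>0 N M \<xi> \<longleftrightarrow>
    prob_space M \<and>
    (\<forall>n. \<forall>i\<in>{1..N}. \<xi> n i \<in> M \<rightarrow>\<^sub>M E n) \<and>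
    prob_space.indep_vars M (\<lambda>_. E 0) (\<xi> 0) {1..N} \<and>
    (\<forall>i\<in>{1..N}. distr M (E 0) (\<xi> 0 i) = \<eta>0) \<and>
    (\<forall>n. \<forall>A. (\<forall>i\<in>{1..N}. A i \<in> sets (E (Suc n))) \<longrightarrow>
      (AE \<omega> in M.
        real_cond_exp M (history E N M \<xi> n)
          (\<lambda>\<omega>. \<Prod>i\<in>{1..N}. indicator (A i) (\<xi> (Suc n) i \<omega>)) \<omega>
        = (\<Prod>i\<in>{1..N}. measure (K (Suc n) (emp_process E N \<xi> n \<omega>) (\<xi> n i \<omega>)) (A i))))"

text \<open>The fluctuation fields \<open>V\<^sub>n\<^sup>N(f)\<close> and \<open>W\<^sub>n\<^sup>N(f)\<close>.\<close>

primrec VN ::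
    "(nat \<Rightarrow> 'a measure) \<Rightarrow> (nat \<Rightarrow> 'a measure \<Rightarrow> 'a \<Rightarrow> 'a measure) \<Rightarrow> 'a measure
      \<Rightarrow> nat \<Rightarrow> (nat \<Rightarrow> nat \<Rightarrow> 'w \<Rightarrow> 'a) \<Rightarrow> nat \<Rightarrow> ('a \<Rightarrow> real) \<Rightarrow> 'w \<Rightarrow> real"
  where
    "VN E K \<eta>0 N \<xi> 0 f = (\<lambda>\<omega>. sqrt (real N) *
       ((\<integral>x. f x \<partial>emp_process E N \<xi> 0 \<omega>) - (\<integral>x. f x \<partial>\<eta>0)))"
  | "VN E K \<eta>0 N \<xi> (Suc n) f = (\<lambda>\<omega>. sqrt (real N) *
       ((\<integral>x. f x \<partial>emp_process E N \<xi> (Suc n) \<omega>)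
        - (\<integral>x. f x \<partial>transport (K (Suc n)) (emp_process E N \<xi> n \<omega>))))"

definition WN ::
    "(nat \<Rightarrow> 'a measure) \<Rightarrow> (nat \<Rightarrow> 'a measure \<Rightarrow> 'a \<Rightarrow> 'a measure) \<Rightarrow> 'a measure
      \<Rightarrow> nat \<Rightarrow> (nat \<Rightarrow> nat \<Rightarrow> 'w \<Rightarrow> 'a) \<Rightarrow> nat \<Rightarrow> ('a \<Rightarrow> real) \<Rightarrow> 'w \<Rightarrow> real"
  where "WN E K \<eta>0 N \<xi> n f \<omega> = sqrt (real N) *
    ((\<integral>x. f x \<partial>emp_process E N \<xi> n \<omega>) - (\<integral>x. f x \<partial>flow \<eta>0 K n))"

section \<open>Limiting Gaussian fields\<close>

definition gaussian_rv :: "'w measure \<Rightarrow> ('w \<Rightarrow> real) \<Rightarrow> bool"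
  where "gaussian_rv M X \<longleftrightarrow> X \<in> borel_measurable M \<and>
    (\<exists>m \<sigma>. \<sigma> \<ge> 0 \<and> distr M borel X =
       (if \<sigma> = 0 then return borel m else density lborel (normal_density m \<sigma>)))"

definition centered_gaussian_field :: "'w measure \<Rightarrow> 'i set \<Rightarrow> ('i \<Rightarrow> 'w \<Rightarrow> real) \<Rightarrow> bool"
  where "centered_gaussian_field M I V \<longleftrightarrow>
    (\<forall>J a. finite J \<and> J \<subseteq> I \<longrightarrow> gaussian_rv M (\<lambda>\<omega>. \<Sum>f\<in>J. a f * V f \<omega>)) \<and>
    (\<forall>f\<in>I. (\<integral>\<omega>. V f \<omega> \<partial>M) = 0)"

definition field_cov ::
    "'a measure \<Rightarrow> (nat \<Rightarrow> 'a measure \<Rightarrow> 'a \<Rightarrow> 'a measure) \<Rightarrow> nat \<Rightarrow> ('a \<Rightarrow> real) \<Rightarrow> ('a \<Rightarrow> real) \<Rightarrow> real"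
  where "field_cov \<eta>0 K n f g = (case n of
      0 \<Rightarrow> \<integral>y. (f y - (\<integral>z. f z \<partial>\<eta>0)) * (g y - (\<integral>z. g z \<partial>\<eta>0)) \<partial>\<eta>0
    | Suc m \<Rightarrow> let k = K n (flow \<eta>0 K m) in
        \<integral>x. (\<integral>y. (f y - (\<integral>z. f z \<partial>k x)) * (g y - (\<integral>z. g z \<partial>k x)) \<partial>k x) \<partial>flow \<eta>0 K m)"

text \<open>
  Independence of the fields is independence of the random elements \<open>V n\<close> of the product space
  of real functions indexed by the bounded measurable functions on \<open>E n\<close>.
\<close>

definition limit_fields ::
    "(nat \<Rightarrow> 'a measure) \<Rightarrow> (nat \<Rightarrow> 'a measure \<Rightarrow> 'a \<Rightarrow> 'a measure) \<Rightarrow> 'a measure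
      \<Rightarrow> 'w measure \<Rightarrow> (nat \<Rightarrow> ('a \<Rightarrow> real) \<Rightarrow> 'w \<Rightarrow> real) \<Rightarrow> bool"
  where "limit_fields E K \<eta>0 M V \<longleftrightarrow>
    prob_space M \<and>
    (\<forall>n. centered_gaussian_field M (bfun (E n)) (V n)) \<and>
    (\<forall>n. \<forall>f\<in>bfun (E n). \<forall>g\<in>bfun (E n). (\<integral>\<omega>. V n f \<omega> * V n g \<omega> \<partial>M) = field_cov \<eta>0 K n f g) \<and>
    prob_space.indep_vars M (\<lambda>n. \<Pi>\<^sub>M f\<in>bfun (E n). (borel :: real measure))
      (\<lambda>n \<omega>. \<lambda>f\<in>bfun (E n). V n f \<omega>) UNIV"

text \<open>\<open>first_order \<eta>0 K D p n = D\<^bsub>p+1\<^esub> \<circ> \<dots> \<circ> D\<^bsub>n\<^esub>\<close> with \<open>D\<^bsub>k\<^esub>\<close> taken at the flow at time \<open>k - 1\<close>.\<close>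

definition first_order ::
    "'a measure \<Rightarrow> (nat \<Rightarrow> 'a measure \<Rightarrow> 'a \<Rightarrow> 'a measure)
      \<Rightarrow> (nat \<Rightarrow> 'a measure \<Rightarrow> ('a \<Rightarrow> real) \<Rightarrow> 'a \<Rightarrow> real)
      \<Rightarrow> nat \<Rightarrow> nat \<Rightarrow> ('a \<Rightarrow> real) \<Rightarrow> 'a \<Rightarrow> real"
  where "first_order \<eta>0 K D p n = foldr (\<lambda>k. D k (flow \<eta>0 K (k - 1))) [Suc p..<Suc n]"

definition W_limit ::
    "'a measure \<Rightarrow> (nat \<Rightarrow> 'a measure \<Rightarrow> 'a \<Rightarrow> 'a measure)
      \<Rightarrow> (nat \<Rightarrow> 'a measure \<Rightarrow> ('a \<Rightarrow> real) \<Rightarrow> 'a \<Rightarrow> real)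
      \<Rightarrow> (nat \<Rightarrow> ('a \<Rightarrow> real) \<Rightarrow> 'w \<Rightarrow> real) \<Rightarrow> nat \<Rightarrow> ('a \<Rightarrow> real) \<Rightarrow> 'w \<Rightarrow> real"
  where "W_limit \<eta>0 K D V n f \<omega> = (\<Sum>p=0..n. V p (first_order \<eta>0 K D p n f) \<omega>)"

end

theory Submission
  imports Defs
begin

text \<open>
  Let \<open>\<epsilon> N = sqrt (\<alpha> N / N)\<close>.  Given the particles up to time \<open>n\<close>, the Laplace transform of
  \<open>sqrt (\<alpha> N) V\<^sub>n\<^sub>+\<^sub>1\<^sup>N(f)\<close> is the exponential of a sum of \<open>N\<close> centered cumulants at \<open>\<epsilon> N\<close>, that is of
  \<open>\<alpha> N\<close> times half the mean conditional variance under the empirical measure, up to \<open>O(\<alpha> N \<epsilon> N)\<close>.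
  The mean conditional variance differs from its value at the limit measure by a Lipschitz
  functional of \<open>W\<^sub>n\<^sup>N / sqrt N\<close>, and \<open>W\<^sub>n\<^sup>N\<close> is subgaussian uniformly in \<open>N\<close> (Hoeffding's lemma for
  \<open>V\<^sup>N\<close>, and Jensen's inequality for the mixtures in the regularity conditions).  By Hoelder's
  inequality such a perturbation of the exponent is negligible on the scale \<open>\<alpha> N\<close>, which gives the
  first limit by induction on \<open>n\<close>.  For the second limit, iterating the first-order expansion of the
  semigroup shows that \<open>W\<^sub>n\<^sup>N(f)\<close> differs from the sum of the \<open>V\<^sub>p\<^sup>N(D\<^sub>p\<^sub>,\<^sub>n f)\<close> by \<open>1 / sqrt N\<close> times a
  quantity with uniformly bounded exponential moments, which is negligible as well.
\<close>


section \<open>Bounded measurable functions\<close>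

text \<open>For each fixed \<open>N\<close> all random variables in play are bounded, so
  integrability is never at stake; what matters is which constants are uniform in \<open>N\<close>.
  The obstacle is that the conditional variance at the empirical measure does not converge uniformly
  over the sample space and cannot simply be pulled out of the expectation. It stays in the exponent
  and is split off by convexity of the log Laplace transform with weights \<open>s\<close> and
  \<open>1 - s\<close>. The unperturbed limit is quadratic under scaling, hence known for the
  multiples \<open>Y / s\<close> and \<open>s * Y\<close>, and the loss vanishes as \<open>s\<close>
  tends to 1; in exchange the perturbation has to be negligible at every multiple. Exponential
  moments of squares, uniform in \<open>N\<close> and over functions of oscillation at most 1, are
  the property carried along time: it survives first-order operators, mixtures over families of test
  functions, and sums of dependent terms. In that induction the remainder enters through a bound
  linear in the fluctuations, one of its two factors being at most 1; the bound of order
  \<open>1 / N\<close> is kept for the linearisation.\<close>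

lemma bfunI:
  assumes "f \<in> borel_measurable E" "\<And>x. x \<in> space E \<Longrightarrow> \<bar>f x\<bar> \<le> B"
  shows "f \<in> bfun E"
  using assms unfolding bfun_def bounded_iff by auto

lemma bfun_measurable [measurable_dest]: "f \<in> bfun E \<Longrightarrow> f \<in> borel_measurable E"
  by (simp add: bfun_def)

lemma bfunE:
  assumes "f \<in> bfun E"
  obtains B where "B > 0" "\<And>x. x \<in> space E \<Longrightarrow> \<bar>f x\<bar> \<le> B"
proof -
  obtain B where B: "\<forall>y\<in>f ` space E. norm y \<le> B"
    using assms unfolding bfun_def bounded_iff by auto
  have "\<bar>f x\<bar> \<le> \<bar>B\<bar> + 1" if "x \<in> space E" for x
    using B that by fastforce
  then show ?thesis
    by (intro that[of "\<bar>B\<bar> + 1"]) auto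
qed

lemma bfun_const [simp]: "(\<lambda>_. c) \<in> bfun E"
  by (rule bfunI[of _ _ "\<bar>c\<bar>"]) auto

lemma bfun_compose:
  assumes "f \<in> bfun F" "g \<in> E \<rightarrow>\<^sub>M F"
  shows "(\<lambda>x. f (g x)) \<in> bfun E"
proof -
  obtain B where "\<And>x. x \<in> space F \<Longrightarrow> \<bar>f x\<bar> \<le> B"
    using bfunE[OF assms(1)] by metis
  then show ?thesis
    using assms measurable_compose[OF assms(2) bfun_measurable[OF assms(1)]]
    by (intro bfunI[of _ _ B]) (auto dest: measurable_space)
qed

lemma bfun_add [intro]:
  assumes "f \<in> bfun E" "g \<in> bfun E"
  shows "(\<lambda>x. f x + g x) \<in> bfun E"
proof -
  obtain B C where "\<And>x. x \<in> space E \<Longrightarrow> \<bar>f x\<bar> \<le> B" "\<And>x. x \<in> space E \<Longrightarrow> \<bar>g x\<bar> \<le> C"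
    using assms by (elim bfunE) blast
  then show ?thesis
    using assms by (intro bfunI[of _ _ "B + C"]) fastforce+
qed

lemma bfun_mult [intro]:
  assumes "f \<in> bfun E" "g \<in> bfun E"
  shows "(\<lambda>x. f x * g x) \<in> bfun E"
proof -
  obtain B C where "\<And>x. x \<in> space E \<Longrightarrow> \<bar>f x\<bar> \<le> B" "\<And>x. x \<in> space E \<Longrightarrow> \<bar>g x\<bar> \<le> C"
    using assms by (elim bfunE) blast
  then show ?thesis
    using assms
    by (intro bfunI[of _ _ "B * C"]) (auto simp: abs_mult intro!: mult_mono')
qed

lemma bfun_cmult [intro]: "f \<in> bfun E \<Longrightarrow> (\<lambda>x. c * f x) \<in> bfun E"
  by (intro bfun_mult) auto

lemma bfun_divide [intro]: "f \<in> bfun E \<Longrightarrow> (\<lambda>x. f x / c) \<in> bfun E"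
  using bfun_cmult[of f E "inverse c"] by (simp add: field_simps)

lemma bfun_uminus [intro]: "f \<in> bfun E \<Longrightarrow> (\<lambda>x. - f x) \<in> bfun E"
  using bfun_cmult[of f E "-1"] by simp

lemma bfun_diff [intro]:
  assumes "f \<in> bfun E" "g \<in> bfun E"
  shows "(\<lambda>x. f x - g x) \<in> bfun E"
  using bfun_add[OF assms(1) bfun_uminus[OF assms(2)]] by simp

lemma bfun_power [intro]: "f \<in> bfun E \<Longrightarrow> (\<lambda>x. f x ^ k) \<in> bfun E"
  by (induction k) auto

lemma bfun_abs [intro]:
  assumes "f \<in> bfun E"
  shows "(\<lambda>x. \<bar>f x\<bar>) \<in> bfun E"
  using assms unfolding bfun_def bounded_iff by auto

lemma bfun_exp [intro]:
  assumes "f \<in> bfun E"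
  shows "(\<lambda>x. exp (f x)) \<in> bfun E"
proof -
  obtain B where B: "\<And>x. x \<in> space E \<Longrightarrow> \<bar>f x\<bar> \<le> B"
    using bfunE[OF assms] by metis
  have "\<bar>exp (f x)\<bar> \<le> exp B" if "x \<in> space E" for x
    using B[OF that] by simp
  then show ?thesis
    using assms by (intro bfunI) auto
qed

lemma bfun_sum [intro]: "(\<And>i. i \<in> I \<Longrightarrow> f i \<in> bfun E) \<Longrightarrow> (\<lambda>x. \<Sum>i\<in>I. f i x) \<in> bfun E"
  by (induction I rule: infinite_finite_induct) (auto intro!: bfun_add bfun_mult)

lemma bfun_prod [intro]: "(\<And>i. i \<in> I \<Longrightarrow> f i \<in> bfun E) \<Longrightarrow> (\<lambda>x. \<Prod>i\<in>I. f i x) \<in> bfun E"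
  by (induction I rule: infinite_finite_induct) (auto intro!: bfun_add bfun_mult)

lemma bfun_cong: "(\<And>w. w \<in> space G \<Longrightarrow> X w = Y w) \<Longrightarrow> X \<in> bfun G \<longleftrightarrow> Y \<in> bfun G"
  unfolding bfun_def by (auto cong: measurable_cong image_cong)

lemmas bfun_intros = bfun_const bfun_cmult bfun_add bfun_diff bfun_uminus bfun_divide bfun_power
  bfun_abs bfun_exp bfun_sum bfun_prod bfun_mult

lemma bfun_cong_sets:
  assumes "sets E = sets F"
  shows "bfun E = bfun F"
  using sets_eq_imp_space_eq[OF assms] measurable_cong_sets[OF assms refl, of borel]
  unfolding bfun_def by auto

lemma (in finite_measure) integrable_bfun: "f \<in> bfun M \<Longrightarrow> integrable M f"
  using integrable_const_bound[of f] by (auto simp: bfun_def bounded_iff)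

lemma (in finite_measure) nn_integral_bfun:
  "f \<in> bfun M \<Longrightarrow> (\<And>x. x \<in> space M \<Longrightarrow> 0 \<le> f x) \<Longrightarrow> (\<integral>\<^sup>+x. ennreal (f x) \<partial>M) = ennreal (\<integral>x. f x \<partial>M)"
  by (intro nn_integral_eq_integral integrable_bfun AE_I2)

lemma (in prob_space) abs_integral_le:
  assumes "f \<in> bfun M" "\<And>x. x \<in> space M \<Longrightarrow> \<bar>f x\<bar> \<le> B"
  shows "\<bar>\<integral>x. f x \<partial>M\<bar> \<le> B"
proof -
  have "\<bar>\<integral>x. f x \<partial>M\<bar> \<le> (\<integral>x. \<bar>f x\<bar> \<partial>M)"
    by simp
  also have "\<dots> \<le> (\<integral>x. B \<partial>M)"
    using assms by (intro integral_mono integrable_bfun) auto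
  finally show ?thesis
    by (simp add: prob_space)
qed

section \<open>Oscillations\<close>

lemma osc_le:
  assumes "\<And>x y. x \<in> space E \<Longrightarrow> y \<in> space E \<Longrightarrow> \<bar>f x - f y\<bar> \<le> c"
  shows "osc E f \<le> ennreal c"
  unfolding osc_def using assms by (intro SUP_least ennreal_leI)

lemma le_osc: "x \<in> space E \<Longrightarrow> y \<in> space E \<Longrightarrow> ennreal \<bar>f x - f y\<bar> \<le> osc E f"
  unfolding osc_def by (intro SUP_upper2[of x] SUP_upper2[of y]) auto

lemma osc_finite:
  assumes "f \<in> bfun E"
  shows "osc E f < \<infinity>"
proof -
  obtain B where "\<And>x. x \<in> space E \<Longrightarrow> \<bar>f x\<bar> \<le> B"
    using bfunE[OF assms] by metis
  then have "\<bar>f x - f y\<bar> \<le> 2 * B" if "x \<in> space E" "y \<in> space E" for x y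
    using that by (smt (verit))
  then have "osc E f \<le> ennreal (2 * B)"
    by (rule osc_le)
  also have "\<dots> < \<infinity>"
    by simp
  finally show ?thesis .
qed

lemma abs_diff_le_osc:
  assumes "osc E f \<le> ennreal c" "0 \<le> c" "x \<in> space E" "y \<in> space E"
  shows "\<bar>f x - f y\<bar> \<le> c"
  using order_trans[OF le_osc[OF assms(3,4)] assms(1)] assms(2) by simp

lemma Osc1_iff:
  assumes "f \<in> borel_measurable E"
  shows "f \<in> Osc1 E \<longleftrightarrow> (\<forall>x\<in>space E. \<forall>y\<in>space E. \<bar>f x - f y\<bar> \<le> 1)"
  using assms osc_le[of E f 1] abs_diff_le_osc[of E f 1] unfolding Osc1_def by auto

text \<open>All values lie within 1 of the value at one point; an empty space is treated apart
  because it has no such point.\<close>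

lemma Osc1_bfun:
  assumes "f \<in> Osc1 E"
  shows "f \<in> bfun E"
proof (cases "space E = {}")
  case True
  with assms show ?thesis
    by (auto simp: bfun_def Osc1_def)
next
  case False
  then obtain y where y: "y \<in> space E"
    by auto
  have meas: "f \<in> borel_measurable E"
    using assms by (simp add: Osc1_def)
  then have "\<bar>f x\<bar> \<le> \<bar>f y\<bar> + 1" if "x \<in> space E" for x
    using assms y that unfolding Osc1_iff[OF meas] by (smt (verit))
  with meas show ?thesis
    by (rule bfunI)
qed

lemma divide_Osc1:
  assumes "f \<in> borel_measurable E" "osc E f \<le> ennreal s" "0 \<le> s"
  shows "(\<lambda>x. f x / s) \<in> Osc1 E"
proof -
  have "\<bar>f x / s - f y / s\<bar> \<le> 1" if "x \<in> space E" "y \<in> space E" for x y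
    using abs_diff_le_osc[OF assms(2,3) that] assms(3)
    by (cases "s = 0") (auto simp: diff_divide_distrib[symmetric] divide_le_eq_1)
  then show ?thesis
    using assms(1) by (subst Osc1_iff) auto
qed

abbreviation mean_diff :: "'a measure \<Rightarrow> 'a measure \<Rightarrow> ('a \<Rightarrow> real) \<Rightarrow> real"
  where "mean_diff \<mu> \<eta> f \<equiv> (\<integral>x. f x \<partial>\<mu>) - (\<integral>x. f x \<partial>\<eta>)"

text \<open>Averaging twice: each \<open>f x\<close> is within \<open>s\<close> of every
  \<open>f y\<close>, hence of the mean under \<eta>, and averaging over \<open>x\<close> under
  \<mu> keeps that distance.\<close>

lemma integral_diff_le_osc:
  assumes \<mu>: "\<mu> \<in> probs E" and \<eta>: "\<eta> \<in> probs E" and f: "f \<in> bfun E"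
    and s: "osc E f \<le> ennreal s" "0 \<le> s"
  shows "\<bar>mean_diff \<mu> \<eta> f\<bar> \<le> s"
proof -
  interpret \<mu>: prob_space \<mu> using \<mu> by (simp add: space_prob_algebra)
  interpret \<eta>: prob_space \<eta> using \<eta> by (simp add: space_prob_algebra)
  have sets: "sets \<mu> = sets E" "sets \<eta> = sets E"
    using \<mu> \<eta> by (auto simp: space_prob_algebra)
  note sp = sets[THEN sets_eq_imp_space_eq]
  have int: "integrable \<mu> f" "integrable \<eta> f"
    using f \<mu>.integrable_bfun \<eta>.integrable_bfun sets[THEN bfun_cong_sets] by auto
  have *: "f x - (\<integral>x. f x \<partial>\<eta>) \<le> s \<and> (\<integral>x. f x \<partial>\<eta>) - f x \<le> s" if x: "x \<in> space E" for x
  proof -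
    have "f x - s \<le> f y \<and> f y \<le> f x + s" if "y \<in> space \<eta>" for y
      using abs_diff_le_osc[OF s x, of y] that unfolding sp by linarith
    then have "f x - s \<le> (\<integral>y. f y \<partial>\<eta>)" "(\<integral>y. f y \<partial>\<eta>) \<le> f x + s"
      using int by (auto intro!: \<eta>.integral_ge_const \<eta>.integral_le_const)
    then show ?thesis
      by simp
  qed
  let ?c = "\<integral>x. f x \<partial>\<eta>"
  have "?c - s \<le> f y \<and> f y \<le> ?c + s" if "y \<in> space \<mu>" for y
    using *[of y] that by (simp add: sp)
  then have "?c - s \<le> (\<integral>y. f y \<partial>\<mu>)" "(\<integral>y. f y \<partial>\<mu>) \<le> ?c + s"
    using int by (auto intro!: \<mu>.integral_ge_const \<mu>.integral_le_const)
  then show ?thesis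
    by (simp add: abs_le_iff)
qed

section \<open>Logarithmic moment generating functions\<close>

text \<open>Meant for bounded \<open>X\<close> on a probability space, where the integral is
  positive and the logarithm genuine; in this form Hoelder's inequality is plain convexity.\<close>

definition log_mgf :: "'w measure \<Rightarrow> ('w \<Rightarrow> real) \<Rightarrow> real"
  where "log_mgf M X = ln (\<integral>w. exp (X w) \<partial>M)"

context prob_space
begin

lemma exp_log_mgf:
  assumes "X \<in> bfun M"
  shows "exp (log_mgf M X) = (\<integral>w. exp (X w) \<partial>M)"
proof -
  obtain B where B: "\<And>x. x \<in> space M \<Longrightarrow> \<bar>X x\<bar> \<le> B"
    using bfunE[OF assms] by metis
  have "exp (- B) = (\<integral>w. exp (- B) \<partial>M)"
    by (simp add: prob_space)
  also have "\<dots> \<le> (\<integral>w. exp (X w) \<partial>M)"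
    using assms B by (intro integral_mono integrable_bfun bfun_exp) (auto simp: abs_le_iff minus_le_iff)
  finally have "0 < (\<integral>w. exp (X w) \<partial>M)"
    by (meson exp_gt_zero less_le_trans)
  then show ?thesis
    by (simp add: log_mgf_def)
qed

lemma log_mgf_le_iff:
  assumes "X \<in> bfun M"
  shows "log_mgf M X \<le> c \<longleftrightarrow> (\<integral>w. exp (X w) \<partial>M) \<le> exp c"
  unfolding exp_log_mgf[OF assms, symmetric] by simp

lemma log_mgf_mono:
  assumes "X \<in> bfun M" "Y \<in> bfun M" "\<And>w. w \<in> space M \<Longrightarrow> X w \<le> Y w"
  shows "log_mgf M X \<le> log_mgf M Y"
  unfolding log_mgf_le_iff[OF assms(1)] exp_log_mgf[OF assms(2)]
  using assms by (intro integral_mono integrable_bfun bfun_exp) auto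

lemma log_mgf_const: "log_mgf M (\<lambda>_. c) = c"
  by (simp add: log_mgf_def prob_space)

lemma log_mgf_add_const:
  assumes "X \<in> bfun M"
  shows "log_mgf M (\<lambda>w. X w + c) = log_mgf M X + c"
proof -
  have "exp (log_mgf M (\<lambda>w. X w + c)) = exp (log_mgf M X + c)"
    using assms by (subst exp_log_mgf) (auto simp: exp_add exp_log_mgf)
  then show ?thesis
    by simp
qed

text \<open>Hoelder's inequality with exponents \<open>1 / s\<close> and \<open>1 / (1 - s)\<close>.
  Shifting by \<open>u\<close> and \<open>v\<close> gives both exponentials mean 1, so the pointwise
  convexity of \<open>exp\<close> integrates to the claim, endpoints included.\<close>

lemma log_mgf_convex:
  assumes X: "X \<in> bfun M" and Y: "Y \<in> bfun M" and s: "0 \<le> s" "s \<le> 1"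
  shows "log_mgf M (\<lambda>w. s * X w + (1 - s) * Y w) \<le> s * log_mgf M X + (1 - s) * log_mgf M Y"
proof -
  define u v where "u = log_mgf M X" and "v = log_mgf M Y"
  have XY: "(\<lambda>w. s * X w + (1 - s) * Y w) \<in> bfun M"
    using X Y by auto
  have le: "exp (s * X w + (1 - s) * Y w)
      \<le> exp (s * u + (1 - s) * v) * (s * (exp (X w) * exp (- u)) + (1 - s) * (exp (Y w) * exp (- v)))" for w
  proof -
    have "exp (s * (X w - u) + (1 - s) * (Y w - v)) \<le> s * exp (X w - u) + (1 - s) * exp (Y w - v)"
      using convex_onD[OF exp_convex, of s "Y w - v" "X w - u"] s by (simp add: add.commute)
    moreover have "exp (s * X w + (1 - s) * Y w)
        = exp (s * u + (1 - s) * v) * exp (s * (X w - u) + (1 - s) * (Y w - v))"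
      by (simp add: exp_add[symmetric] algebra_simps)
    ultimately show ?thesis
      by (simp add: exp_diff exp_minus divide_inverse)
  qed
  have "(\<integral>w. exp (s * X w + (1 - s) * Y w) \<partial>M)
      \<le> (\<integral>w. exp (s * u + (1 - s) * v) * (s * (exp (X w) * exp (- u)) + (1 - s) * (exp (Y w) * exp (- v))) \<partial>M)"
    using X Y by (intro integral_mono le integrable_bfun bfun_exp bfun_cmult bfun_add bfun_mult bfun_const)
  also have "\<dots> = exp (s * u + (1 - s) * v)"
  proof -
    have "integrable M (\<lambda>w. exp (X w))" "integrable M (\<lambda>w. exp (Y w))"
      using X Y by (auto intro: integrable_bfun)
    moreover have "(\<integral>w. exp (X w) \<partial>M) = exp u" "(\<integral>w. exp (Y w) \<partial>M) = exp v"
      using X Y by (simp_all add: u_def v_def exp_log_mgf)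
    ultimately show ?thesis
      by (simp add: exp_minus)
  qed
  finally show ?thesis
    unfolding log_mgf_le_iff[OF XY] u_def v_def .
qed

text \<open>Convexity against the zero variable, whose log Laplace transform is 0.\<close>

lemma log_mgf_scale:
  assumes "X \<in> bfun M" "0 \<le> s" "s \<le> 1"
  shows "log_mgf M (\<lambda>w. s * X w) \<le> s * log_mgf M X"
  using log_mgf_convex[OF assms(1) bfun_const[of 0] assms(2,3)] by (simp add: log_mgf_const)

end

text \<open>Exponential negligibility at speed \<alpha>. Every factor \<open>t\<close> is required
  because the weights \<open>1 / (1 - s)\<close> met in \<open>perturbation\<close> grow without
  bound as \<open>s\<close> tends to 1.\<close>

definition negligible_rv :: "(nat \<Rightarrow> real) \<Rightarrow> (nat \<Rightarrow> 'w measure) \<Rightarrow> (nat \<Rightarrow> 'w \<Rightarrow> real) \<Rightarrow> bool"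
  where "negligible_rv \<alpha> M X \<longleftrightarrow>
    (\<forall>t>0. (\<lambda>N. log_mgf (M N) (\<lambda>w. t * \<alpha> N * \<bar>X N w\<bar>) / \<alpha> N) \<longlonglongrightarrow> 0)"

text \<open>Both bounds come from \<open>log_mgf_convex\<close>: once \<open>Y + X\<close> is
  dominated by a combination of \<open>Y / s\<close> and \<open>\<bar>X\<bar> / (1 - s)\<close>,
  once \<open>s * Y\<close> by a combination of \<open>Y + X\<close> and a multiple of
  \<open>\<bar>X\<bar>\<close>. Quadratic scaling of the limit turns them into \<open>v / s\<close>
  and \<open>s * v\<close>, which meet as \<open>s\<close> tends to 1.\<close>

lemma perturbation:
  fixes \<alpha> :: "nat \<Rightarrow> real" and M :: "nat \<Rightarrow> 'w measure"
  assumes M: "\<And>N. N \<ge> 1 \<Longrightarrow> prob_space (M N)"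
    and \<alpha>: "\<And>N. N \<ge> 1 \<Longrightarrow> \<alpha> N > 0"
    and X: "\<And>N. N \<ge> 1 \<Longrightarrow> X N \<in> bfun (M N)"
    and Y: "\<And>N. N \<ge> 1 \<Longrightarrow> Y N \<in> bfun (M N)"
    and lim: "\<And>s. s > 0 \<Longrightarrow> (\<lambda>N. log_mgf (M N) (\<lambda>w. s * \<alpha> N * Y N w) / \<alpha> N) \<longlonglongrightarrow> s\<^sup>2 * v"
    and negl: "negligible_rv \<alpha> M X"
  shows "(\<lambda>N. log_mgf (M N) (\<lambda>w. \<alpha> N * (Y N w + X N w)) / \<alpha> N) \<longlonglongrightarrow> v"
proof -
  let ?L = "\<lambda>N. log_mgf (M N) (\<lambda>w. \<alpha> N * (Y N w + X N w)) / \<alpha> N"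
  have upper: "\<exists>b. b \<longlonglongrightarrow> v / s \<and> (\<forall>\<^sub>F N in sequentially. ?L N \<le> b N)" if s: "0 < s" "s < 1" for s
  proof (intro exI conjI)
    let ?b = "\<lambda>N. s * (log_mgf (M N) (\<lambda>w. (1/s) * \<alpha> N * Y N w) / \<alpha> N)
      + (1 - s) * (log_mgf (M N) (\<lambda>w. (1/(1-s)) * \<alpha> N * \<bar>X N w\<bar>) / \<alpha> N)"
    have "?b \<longlonglongrightarrow> s * ((1/s)\<^sup>2 * v) + (1 - s) * 0"
      using s by (intro tendsto_intros lim negl[unfolded negligible_rv_def, rule_format]) auto
    then show "?b \<longlonglongrightarrow> v / s"
      using s by (simp add: power2_eq_square)
    show "\<forall>\<^sub>F N in sequentially. ?L N \<le> ?b N"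
      using eventually_ge_at_top[of 1]
    proof eventually_elim
      case (elim N)
      interpret prob_space "M N" using M elim .
      have "log_mgf (M N) (\<lambda>w. \<alpha> N * (Y N w + X N w))
          \<le> log_mgf (M N) (\<lambda>w. s * ((1/s) * \<alpha> N * Y N w) + (1 - s) * ((1/(1-s)) * \<alpha> N * \<bar>X N w\<bar>))"
      proof (intro log_mgf_mono)
        show "\<alpha> N * (Y N w + X N w) \<le> s * ((1/s) * \<alpha> N * Y N w) + (1 - s) * ((1/(1-s)) * \<alpha> N * \<bar>X N w\<bar>)" for w
          using s \<alpha>[OF elim] by (simp add: distrib_left)
      qed (intro bfun_add bfun_cmult bfun_abs X[OF elim] Y[OF elim])+
      also have "\<dots> \<le> s * log_mgf (M N) (\<lambda>w. (1/s) * \<alpha> N * Y N w)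
          + (1 - s) * log_mgf (M N) (\<lambda>w. (1/(1-s)) * \<alpha> N * \<bar>X N w\<bar>)"
        using s by (intro log_mgf_convex bfun_add bfun_cmult bfun_abs X[OF elim] Y[OF elim]) auto
      finally show ?case
        using \<alpha>[OF elim] by (simp add: divide_le_cancel divide_right_mono flip: add_divide_distrib)
    qed
  qed
  have lower: "\<exists>b. b \<longlonglongrightarrow> s * v \<and> (\<forall>\<^sub>F N in sequentially. b N \<le> ?L N)" if s: "0 < s" "s < 1" for s
  proof (intro exI conjI)
    let ?b = "\<lambda>N. ((log_mgf (M N) (\<lambda>w. s * \<alpha> N * Y N w) / \<alpha> N)
      - (1 - s) * (log_mgf (M N) (\<lambda>w. (s/(1-s)) * \<alpha> N * \<bar>X N w\<bar>) / \<alpha> N)) / s"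
    have "?b \<longlonglongrightarrow> (s\<^sup>2 * v - (1 - s) * 0) / s"
      using s by (intro tendsto_intros lim negl[unfolded negligible_rv_def, rule_format]) auto
    then show "?b \<longlonglongrightarrow> s * v"
      using s by (simp add: power2_eq_square)
    show "\<forall>\<^sub>F N in sequentially. ?b N \<le> ?L N"
      using eventually_ge_at_top[of 1]
    proof eventually_elim
      case (elim N)
      interpret prob_space "M N" using M elim .
      have "log_mgf (M N) (\<lambda>w. s * \<alpha> N * Y N w)
          \<le> log_mgf (M N) (\<lambda>w. s * (\<alpha> N * (Y N w + X N w)) + (1 - s) * ((s/(1-s)) * \<alpha> N * \<bar>X N w\<bar>))"
      proof (intro log_mgf_mono)
        fix w
        have "s * \<alpha> N * Y N w = s * (\<alpha> N * (Y N w + X N w)) + s * \<alpha> N * (- X N w)"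
          by (simp add: algebra_simps)
        also have "\<dots> \<le> s * (\<alpha> N * (Y N w + X N w)) + s * \<alpha> N * \<bar>X N w\<bar>"
          using s \<alpha>[OF elim] by (intro add_left_mono mult_left_mono) auto
        finally show "s * \<alpha> N * Y N w
            \<le> s * (\<alpha> N * (Y N w + X N w)) + (1 - s) * ((s/(1-s)) * \<alpha> N * \<bar>X N w\<bar>)"
          using s by simp
      qed (intro bfun_add bfun_cmult bfun_abs X[OF elim] Y[OF elim])+
      also have "\<dots> \<le> s * log_mgf (M N) (\<lambda>w. \<alpha> N * (Y N w + X N w))
          + (1 - s) * log_mgf (M N) (\<lambda>w. (s/(1-s)) * \<alpha> N * \<bar>X N w\<bar>)"
        using s by (intro log_mgf_convex bfun_add bfun_cmult bfun_abs X[OF elim] Y[OF elim]) auto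
      finally have "(log_mgf (M N) (\<lambda>w. s * \<alpha> N * Y N w)
          - (1 - s) * log_mgf (M N) (\<lambda>w. (s/(1-s)) * \<alpha> N * \<bar>X N w\<bar>)) / s / \<alpha> N
          \<le> log_mgf (M N) (\<lambda>w. \<alpha> N * (Y N w + X N w)) / \<alpha> N"
        using \<alpha>[OF elim] s by (intro divide_right_mono) (auto simp: pos_divide_le_eq mult.commute)
      then show ?case
        by (simp add: diff_divide_distrib mult.commute)
    qed
  qed
  \<comment> \<open>For each target \<open>a\<close> a single \<open>s\<close> close enough to 1
    suffices; the left limit at 1 supplies it.\<close>
  have sv: "((\<lambda>s. v / s) \<longlongrightarrow> v / 1) (at_left (1::real))" "((\<lambda>s. s * v) \<longlongrightarrow> 1 * v) (at_left (1::real))"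
    by (intro tendsto_divide tendsto_mult tendsto_const tendsto_ident_at; simp)+
  have s01: "\<forall>\<^sub>F s in at_left (1::real). 0 < s \<and> s < 1"
    using eventually_at_left_real[of 0 1] by (simp add: eventually_mono)
  show ?thesis
  proof (rule order_tendstoI)
    fix a assume "v < a"
    then have "\<forall>\<^sub>F s in at_left (1::real). v / s < a"
      using order_tendstoD(2)[OF sv(1)] by simp
    from eventually_happens[OF eventually_conj[OF this s01]]
    obtain s where s: "v / s < a" "0 < s" "s < 1"
      by auto
    obtain b where "b \<longlonglongrightarrow> v / s" "\<forall>\<^sub>F N in sequentially. ?L N \<le> b N"
      using upper[OF s(2,3)] by auto
    with s(1) show "\<forall>\<^sub>F N in sequentially. ?L N < a"
      by (auto dest: order_tendstoD(2) elim: eventually_elim2)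
  next
    fix a assume "a < v"
    then have "\<forall>\<^sub>F s in at_left (1::real). a < s * v"
      using order_tendstoD(1)[OF sv(2)] by simp
    from eventually_happens[OF eventually_conj[OF this s01]]
    obtain s where s: "a < s * v" "0 < s" "s < 1"
      by auto
    obtain b where "b \<longlonglongrightarrow> s * v" "\<forall>\<^sub>F N in sequentially. b N \<le> ?L N"
      using lower[OF s(2,3)] by auto
    with s(1) show "\<forall>\<^sub>F N in sequentially. a < ?L N"
      by (auto dest: order_tendstoD(1) elim: eventually_elim2)
  qed
qed

section \<open>Cumulant expansion and Hoeffding bound for a bounded function\<close>

text \<open>The Lagrange remainder is \<open>exp t / 6\<close> times the cube, and
  \<open>exp t\<close> is at most 2 for \<open>t\<close> of absolute value at most 1/2, so the
  factor is below 1.\<close>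

lemma abs_exp_taylor2_le:
  fixes x :: real
  assumes "\<bar>x\<bar> \<le> d" "d \<le> 1/2"
  shows "\<bar>exp x - 1 - x - x\<^sup>2 / 2\<bar> \<le> d ^ 3"
proof -
  obtain t where t: "\<bar>t\<bar> \<le> \<bar>x\<bar>" "exp x = (\<Sum>m<3. x ^ m / fact m) + exp t / fact 3 * x ^ 3"
    using Maclaurin_exp_le[of x 3] by blast
  have "exp x - 1 - x - x\<^sup>2 / 2 = exp t / 6 * x ^ 3"
    unfolding t(2) by (simp add: eval_nat_numeral fact_numeral)
  then have "\<bar>exp x - 1 - x - x\<^sup>2 / 2\<bar> = exp t / 6 * \<bar>x\<bar> ^ 3"
    by (simp only: abs_mult power_abs abs_divide) simp
  also have "\<dots> \<le> 1 * d ^ 3"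
    using t(1) assms exp_bound_half[of t] by (intro mult_mono power_mono) auto
  finally show ?thesis
    by simp
qed

context prob_space
begin

text \<open>Centring removes the first-order term, so the mean of \<open>exp g\<close> is 1 plus
  half the variance of \<open>g\<close> up to \<open>d ^ 3\<close>. The logarithm costs a further
  \<open>2 * u\<^sup>2\<close> with \<open>u\<close> of order \<open>d\<^sup>2\<close>, again at
  most \<open>d ^ 3\<close>; hence the factor 2. The threshold 1/2 serves both the Taylor bound and
  the bound on the logarithm.\<close>

lemma log_mgf_centered_expansion:
  assumes f: "f \<in> bfun M" and B: "\<And>x. x \<in> space M \<Longrightarrow> \<bar>f x\<bar> \<le> B"
    and e: "0 \<le> e" "2 * B * e \<le> 1/2"
  shows "\<bar>log_mgf M (\<lambda>x. e * (f x - expectation f)) - e\<^sup>2 / 2 * variance f\<bar> \<le> 2 * (2 * B * e) ^ 3"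
proof -
  define d where "d = 2 * B * e"
  define g where "g x = e * (f x - expectation f)" for x
  have B0: "0 \<le> B"
    using abs_integral_le[OF f B] by linarith
  then have d: "0 \<le> d" "d \<le> 1/2"
    using e by (auto simp: d_def)
  have g: "g \<in> bfun M"
    unfolding g_def by (intro bfun_intros f)
  have gd: "\<bar>g x\<bar> \<le> d" if "x \<in> space M" for x
  proof -
    have "\<bar>f x - expectation f\<bar> \<le> 2 * B"
      using abs_integral_le[OF f B] B[OF that] by linarith
    then show ?thesis
      using e(1) by (simp add: g_def d_def abs_mult mult.commute mult_left_mono)
  qed
  have int: "integrable M g" "integrable M (\<lambda>x. (g x)\<^sup>2)" "integrable M (\<lambda>x. exp (g x))"
    using g by (auto intro: integrable_bfun)
  have Eg: "expectation g = 0"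
    using integrable_bfun[OF f] by (simp add: g_def[abs_def] prob_space)
  have Eg2: "expectation (\<lambda>x. (g x)\<^sup>2) = e\<^sup>2 * variance f"
    by (simp add: g_def power_mult_distrib)
  define u where "u = expectation (\<lambda>x. exp (g x)) - 1"
  have u1: "u - e\<^sup>2 / 2 * variance f = expectation (\<lambda>x. exp (g x) - 1 - g x - (g x)\<^sup>2 / 2)"
    using int Eg Eg2 by (simp add: u_def prob_space)
  have u2: "\<bar>u - e\<^sup>2 / 2 * variance f\<bar> \<le> d ^ 3"
    unfolding u1
    by (rule abs_integral_le)
      (use g gd d in \<open>auto intro!: bfun_diff bfun_exp bfun_power bfun_divide abs_exp_taylor2_le\<close>)
  have "\<bar>expectation (\<lambda>x. (g x)\<^sup>2)\<bar> \<le> d\<^sup>2"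
    by (rule abs_integral_le) (use g power_mono[OF gd, of _ 2] in \<open>auto\<close>)
  then have u3: "\<bar>e\<^sup>2 / 2 * variance f\<bar> \<le> d\<^sup>2 / 2"
    unfolding Eg2 by simp
  have d3: "d ^ 3 \<le> d\<^sup>2 / 2"
    using mult_right_mono[OF d(2), of "d\<^sup>2"] by (simp add: power3_eq_cube power2_eq_square)
  have d4: "2 * (d\<^sup>2)\<^sup>2 \<le> d ^ 3"
    using mult_right_mono[OF d(2), of "d ^ 3"] d(1) by (simp add: power3_eq_cube power2_eq_square)
  have "d\<^sup>2 \<le> 1/2"
    using mult_mono[OF d(2) d(2)] d(1) by (simp add: power2_eq_square)
  moreover have u: "\<bar>u\<bar> \<le> d\<^sup>2"
    using u2 u3 d3 by linarith
  ultimately have "\<bar>ln (1 + u) - u\<bar> \<le> 2 * u\<^sup>2"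
    by (intro abs_ln_one_plus_x_minus_x_bound) linarith
  also have "\<dots> \<le> 2 * (d\<^sup>2)\<^sup>2"
    using power_mono[OF u, of 2] by simp
  also note d4
  finally have "\<bar>ln (1 + u) - e\<^sup>2 / 2 * variance f\<bar> \<le> 2 * d ^ 3"
    using u2 by linarith
  then show ?thesis
    by (simp add: log_mgf_def u_def g_def d_def)
qed

text \<open>Hoeffding's lemma on the interval of length 2 around one value \<open>g y\<close>, where
  \<open>2\<^sup>2 / 8\<close> is one half; the sharper 1/8 would require the extreme values of the
  function. Negative \<open>l\<close> is reduced to positive \<open>l\<close> by passing to
  \<open>- f\<close>.\<close>

lemma log_mgf_centered_le:
  assumes f: "f \<in> Osc1 M"
  shows "log_mgf M (\<lambda>x. l * (f x - expectation f)) \<le> l\<^sup>2 / 2"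
proof -
  have pos: "log_mgf M (\<lambda>x. l * (g x - expectation g)) \<le> l\<^sup>2 / 2" if g: "g \<in> Osc1 M" and l: "l > 0" for g l
  proof -
    have gm: "g \<in> borel_measurable M"
      using g by (simp add: Osc1_def)
    obtain y where y: "y \<in> space M"
      using not_empty by auto
    interpret g: interval_bounded_random_variable M g "g y - 1" "g y + 1"
      using g y gm by unfold_locales (force simp: Osc1_iff[OF gm] abs_le_iff algebra_simps)+
    have b: "(\<lambda>x. l * (g x - expectation g)) \<in> bfun M"
      by (intro bfun_intros Osc1_bfun g)
    have "ennreal (expectation (\<lambda>x. exp (l * (g x - expectation g))))
        = (\<integral>\<^sup>+x. exp (l * (g x - expectation g)) \<partial>M)"
      by (intro nn_integral_eq_integral[symmetric] integrable_bfun bfun_exp b) auto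
    also have "\<dots> \<le> ennreal (exp (l\<^sup>2 * 2\<^sup>2 / 8))"
      using g.Hoeffdings_lemma_nn_integral[OF l] by simp
    finally show ?thesis
      unfolding log_mgf_le_iff[OF b] by simp
  qed
  have m: "(\<lambda>x. - f x) \<in> Osc1 M"
    using f unfolding Osc1_def by (auto simp: osc_def abs_minus_commute)
  consider "l > 0" | "l = 0" | "- l > 0"
    by linarith
  then show ?thesis
  proof cases
    case 1
    then show ?thesis using pos[OF f] by simp
  next
    case 2
    then show ?thesis by (simp add: log_mgf_const)
  next
    case 3
    then show ?thesis using pos[OF m 3] by (simp add: algebra_simps)
  qed
qed

end

section \<open>Exponential moments of squares from subgaussian Laplace transforms\<close>

text \<open>The \<open>k\<close>-th term bounds the share of the event that the absolute value lies
  between \<open>k\<close> and \<open>k + 1\<close>: the weight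
  \<open>exp (1/4 - 3/4 * k\<^sup>2)\<close> used in \<open>exp_square_le\<close> times two Laplace
  transforms, each at most \<open>exp (k\<^sup>2 / 2)\<close>.\<close>

definition gauss_square_const :: real
  where "gauss_square_const = (\<Sum>k::nat. 2 * exp (1/4 - (real k)\<^sup>2 / 4))"

lemma summable_gauss_square: "summable (\<lambda>k::nat. 2 * exp (1/4 - (real k)\<^sup>2 / 4))"
proof (rule summable_comparison_test')
  show "summable (\<lambda>k. 2 * exp (1/4) * exp (-1/4::real) ^ k)"
    by (intro summable_mult summable_geometric) auto
  fix k :: nat
  have "real k \<le> (real k)\<^sup>2"
    by (cases k) (auto simp: power2_eq_square)
  then have "1/4 - (real k)\<^sup>2 / 4 \<le> 1/4 + real k * (- 1/4)"
    by simp
  then have "exp (1/4 - (real k)\<^sup>2 / 4) \<le> exp (1/4 + real k * (- 1/4))"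
    by (rule exp_le_cancel_iff[THEN iffD2])
  then show "norm (2 * exp (1/4 - (real k)\<^sup>2 / 4)) \<le> 2 * exp (1/4) * exp (-1/4) ^ k"
    by (simp only: exp_add exp_of_nat_mult) simp
qed

text \<open>
  On \<open>{k \<le> \<bar>X\<bar> < k + 1}\<close> the function \<open>exp (X\<^sup>2 / 8)\<close> is dominated by a multiple of
  \<open>exp (k * X) + exp (- k * X)\<close>.
\<close>

lemma (in prob_space) exp_square_le:
  assumes X: "X \<in> bfun M" and le: "\<And>l. log_mgf M (\<lambda>w. l * X w) \<le> l\<^sup>2 / 2"
  shows "(\<integral>\<^sup>+w. ennreal (exp (1/8 * (X w)\<^sup>2)) \<partial>M) \<le> ennreal gauss_square_const"
proof -
  obtain B where B: "\<And>w. w \<in> space M \<Longrightarrow> \<bar>X w\<bar> \<le> B"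
    using bfunE[OF X] by metis
  \<comment> \<open>\<open>X\<close> is bounded, so finitely many slices cover the space and a
    finite sum is integrated; the final bound does not depend on \<open>n\<close>.\<close>
  define n where "n = Suc (nat \<lfloor>B\<rfloor>)"
  define h where "h w = (\<Sum>k<n. exp (1/4 - 3/4 * (real k)\<^sup>2) * (exp (real k * X w) + exp (- real k * X w)))" for w
  have h: "h \<in> bfun M"
    unfolding h_def by (intro bfun_sum bfun_cmult bfun_add bfun_exp X)
  have "exp (1/8 * (X w)\<^sup>2) \<le> h w" if w: "w \<in> space M" for w
  proof -
    define k where "k = nat \<lfloor>\<bar>X w\<bar>\<rfloor>"
    have k: "real k \<le> \<bar>X w\<bar>" "\<bar>X w\<bar> \<le> real k + 1" "k < n"
      unfolding k_def n_def using B[OF w] by (linarith, linarith, simp add: floor_mono nat_mono less_Suc_eq_le)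
    \<comment> \<open>With \<open>(k + 1)\<^sup>2\<close> at most \<open>2 * k\<^sup>2 + 2\<close>,
      an eighth of the square is at most \<open>1/4 + k\<^sup>2 / 4\<close>. Splitting off one full
      \<open>k\<^sup>2\<close>, to be absorbed by \<open>k * \<bar>X w\<bar>\<close>, leaves the
      coefficient \<open>- 3/4\<close>.\<close>
    have "(X w)\<^sup>2 \<le> (real k + 1)\<^sup>2"
      using power_mono[OF k(2), of 2] by simp
    also have "\<dots> \<le> 2 * (real k)\<^sup>2 + 2"
      using sum_squares_bound[of "real k" 1] by (simp add: power2_sum)
    finally have "1/8 * (X w)\<^sup>2 \<le> 1/4 - 3/4 * (real k)\<^sup>2 + (real k)\<^sup>2"
      by simp
    also have "\<dots> \<le> 1/4 - 3/4 * (real k)\<^sup>2 + real k * \<bar>X w\<bar>"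
      using k(1) by (simp add: power2_eq_square mult_left_mono)
    finally have "exp (1/8 * (X w)\<^sup>2) \<le> exp (1/4 - 3/4 * (real k)\<^sup>2) * exp (real k * \<bar>X w\<bar>)"
      by (simp add: exp_add[symmetric])
    also have "\<dots> \<le> exp (1/4 - 3/4 * (real k)\<^sup>2) * (exp (real k * X w) + exp (- real k * X w))"
      by (intro mult_left_mono) (auto simp: abs_if)
    also have "\<dots> \<le> h w"
      unfolding h_def using k(3) by (intro member_le_sum) (auto intro!: mult_nonneg_nonneg add_nonneg_nonneg)
    finally show ?thesis .
  qed
  then have "(\<integral>\<^sup>+w. ennreal (exp (1/8 * (X w)\<^sup>2)) \<partial>M) \<le> (\<integral>\<^sup>+w. ennreal (h w) \<partial>M)"
    by (intro nn_integral_mono ennreal_leI) auto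
  also have "\<dots> = ennreal (\<integral>w. h w \<partial>M)"
    by (intro nn_integral_eq_integral integrable_bfun h)
      (auto simp: h_def intro!: sum_nonneg mult_nonneg_nonneg add_nonneg_nonneg)
  also have "(\<integral>w. h w \<partial>M) \<le> gauss_square_const"
  proof -
    have int: "integrable M (\<lambda>w. exp (l * X w))" for l
      using X by (intro integrable_bfun bfun_exp bfun_cmult)
    have "(\<integral>w. h w \<partial>M) = (\<Sum>k<n. exp (1/4 - 3/4 * (real k)\<^sup>2) *
        ((\<integral>w. exp (real k * X w) \<partial>M) + (\<integral>w. exp (- real k * X w) \<partial>M)))"
      unfolding h_def using int[of "real _"] int[of "- real _"] by simp
    also have "\<dots> \<le> (\<Sum>k<n. exp (1/4 - 3/4 * (real k)\<^sup>2) * (exp ((real k)\<^sup>2 / 2) + exp ((real k)\<^sup>2 / 2)))"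
    proof (intro sum_mono mult_left_mono add_mono)
      have "(\<integral>w. exp (l * X w) \<partial>M) \<le> exp (l\<^sup>2 / 2)" for l
        using le[of l] X by (subst (asm) log_mgf_le_iff) auto
      from this[of "real _"] this[of "- real _"]
      show "(\<integral>w. exp (real k * X w) \<partial>M) \<le> exp ((real k)\<^sup>2 / 2)"
        "(\<integral>w. exp (- real k * X w) \<partial>M) \<le> exp ((real k)\<^sup>2 / 2)" for k
        by simp_all
    qed auto
    also have "\<dots> = (\<Sum>k<n. 2 * exp (1/4 - (real k)\<^sup>2 / 4))"
    proof (intro sum.cong refl)
      fix k
      have "exp (1/4 - 3/4 * (real k)\<^sup>2) * exp ((real k)\<^sup>2 / 2) = exp (1/4 - (real k)\<^sup>2 / 4)"
        by (simp add: exp_add[symmetric])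
      then show "exp (1/4 - 3/4 * (real k)\<^sup>2) * (exp ((real k)\<^sup>2 / 2) + exp ((real k)\<^sup>2 / 2))
          = 2 * exp (1/4 - (real k)\<^sup>2 / 4)"
        by (simp add: distrib_left)
    qed
    also have "\<dots> \<le> gauss_square_const"
      unfolding gauss_square_const_def by (intro sum_le_suminf summable_gauss_square) auto
    finally show ?thesis .
  qed
  finally show ?thesis
    by (simp add: ennreal_leI)
qed

section \<open>Uniform exponential moments\<close>

text \<open>The rate \<open>c\<close> and the bound \<open>C\<close> serve all indices and all
  \<open>N\<close> at once. The extended integral spares integrability conditions; in the
  applications \<open>X\<close> is nonnegative, a square or a combination or mixture of
  squares.\<close>

definition subexponential ::
    "(nat \<Rightarrow> 'w measure) \<Rightarrow> 'i set \<Rightarrow> ('i \<Rightarrow> nat \<Rightarrow> 'w \<Rightarrow> real) \<Rightarrow> bool"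
  where "subexponential M I X \<longleftrightarrow>
    (\<exists>c>0. \<exists>C. \<forall>i\<in>I. \<forall>N\<ge>1. (\<integral>\<^sup>+w. ennreal (exp (c * X i N w)) \<partial>M N) \<le> ennreal C)"

text \<open>The map \<open>g\<close> sends an index to a normalised one, typically a function to a
  rescaling of it in \<open>Osc1\<close>, and the factor \<open>k\<close> is absorbed by the
  rate.\<close>

lemma subexponential_mono:
  assumes "subexponential M J X" "\<And>i. i \<in> I \<Longrightarrow> g i \<in> J" "k > 0"
    and "\<And>i N w. i \<in> I \<Longrightarrow> N \<ge> 1 \<Longrightarrow> w \<in> space (M N) \<Longrightarrow> Y i N w \<le> k * X (g i) N w"
  shows "subexponential M I Y"
proof -
  obtain c C where c: "c > 0"
    and C: "\<And>i N. i \<in> J \<Longrightarrow> N \<ge> 1 \<Longrightarrow> (\<integral>\<^sup>+w. ennreal (exp (c * X i N w)) \<partial>M N) \<le> ennreal C"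
    using assms(1) unfolding subexponential_def by blast
  have "(\<integral>\<^sup>+w. ennreal (exp (c / k * Y i N w)) \<partial>M N) \<le> ennreal C" if i: "i \<in> I" "N \<ge> 1" for i N
  proof -
    have "c / k * Y i N w \<le> c * X (g i) N w" if "w \<in> space (M N)" for w
      using mult_left_mono[OF assms(4)[OF i that], of "c / k"] c assms(3) by simp
    then have "(\<integral>\<^sup>+w. ennreal (exp (c / k * Y i N w)) \<partial>M N)
        \<le> (\<integral>\<^sup>+w. ennreal (exp (c * X (g i) N w)) \<partial>M N)"
      by (intro nn_integral_mono ennreal_leI) simp
    also have "\<dots> \<le> ennreal C"
      using assms(2) i by (intro C) auto
    finally show ?thesis .
  qed
  then show ?thesis
    unfolding subexponential_def using c assms(3) by (intro exI[of _ "c / k"]) auto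
qed

text \<open>Half of the smaller rate times the sum is at most the larger of the two exponents, and
  the exponential of a maximum is at most the sum of the exponentials. No independence is involved;
  nonnegativity allows each rate to be lowered.\<close>

lemma subexponential_add:
  assumes "subexponential M I X" "subexponential M I Y"
    and X: "\<And>i N. i \<in> I \<Longrightarrow> N \<ge> 1 \<Longrightarrow> X i N \<in> borel_measurable (M N)"
      "\<And>i N w. i \<in> I \<Longrightarrow> N \<ge> 1 \<Longrightarrow> w \<in> space (M N) \<Longrightarrow> 0 \<le> X i N w"
    and Y: "\<And>i N. i \<in> I \<Longrightarrow> N \<ge> 1 \<Longrightarrow> Y i N \<in> borel_measurable (M N)"
      "\<And>i N w. i \<in> I \<Longrightarrow> N \<ge> 1 \<Longrightarrow> w \<in> space (M N) \<Longrightarrow> 0 \<le> Y i N w"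
  shows "subexponential M I (\<lambda>i N w. X i N w + Y i N w)"
proof -
  obtain c C where c: "c > 0"
    and C: "\<And>i N. i \<in> I \<Longrightarrow> N \<ge> 1 \<Longrightarrow> (\<integral>\<^sup>+w. ennreal (exp (c * X i N w)) \<partial>M N) \<le> ennreal C"
    using assms(1) unfolding subexponential_def by blast
  obtain d D where d: "d > 0"
    and D: "\<And>i N. i \<in> I \<Longrightarrow> N \<ge> 1 \<Longrightarrow> (\<integral>\<^sup>+w. ennreal (exp (d * Y i N w)) \<partial>M N) \<le> ennreal D"
    using assms(2) unfolding subexponential_def by blast
  define e where "e = min c d"
  have e: "e > 0" "e \<le> c" "e \<le> d"
    using c d by (auto simp: e_def)
  have "(\<integral>\<^sup>+w. ennreal (exp (e / 2 * (X i N w + Y i N w))) \<partial>M N) \<le> ennreal (\<bar>C\<bar> + \<bar>D\<bar>)"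
    if i: "i \<in> I" "N \<ge> 1" for i N
  proof -
    note [measurable] = X(1)[OF i] Y(1)[OF i]
    have *: "exp (e / 2 * (X i N w + Y i N w)) \<le> exp (c * X i N w) + exp (d * Y i N w)"
      if w: "w \<in> space (M N)" for w
    proof -
      have "e * X i N w \<le> c * X i N w" "e * Y i N w \<le> d * Y i N w"
        using e X(2)[OF i w] Y(2)[OF i w] by (auto intro: mult_right_mono)
      then have "e / 2 * (X i N w + Y i N w) \<le> max (c * X i N w) (d * Y i N w)"
        by (simp add: distrib_left max_def)
      then have "exp (e / 2 * (X i N w + Y i N w)) \<le> exp (max (c * X i N w) (d * Y i N w))"
        by simp
      also have "\<dots> \<le> exp (c * X i N w) + exp (d * Y i N w)"
        by (simp add: max_def)
      finally show ?thesis .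
    qed
    have "(\<integral>\<^sup>+w. ennreal (exp (e / 2 * (X i N w + Y i N w))) \<partial>M N)
        \<le> (\<integral>\<^sup>+w. ennreal (exp (c * X i N w)) + ennreal (exp (d * Y i N w)) \<partial>M N)"
      using * by (intro nn_integral_mono) (auto simp flip: ennreal_plus intro!: ennreal_leI)
    also have "\<dots> = (\<integral>\<^sup>+w. ennreal (exp (c * X i N w)) \<partial>M N) + (\<integral>\<^sup>+w. ennreal (exp (d * Y i N w)) \<partial>M N)"
      by (intro nn_integral_add) auto
    also have "\<dots> \<le> ennreal \<bar>C\<bar> + ennreal \<bar>D\<bar>"
      using C[OF i] D[OF i] by (intro add_mono) (auto intro: order_trans ennreal_leI)
    finally show ?thesis
      by simp
  qed
  then show ?thesis
    unfolding subexponential_def using e(1)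
    by (intro exI[of _ "e / 2"] conjI exI[of _ "\<bar>C\<bar> + \<bar>D\<bar>"]) auto
qed

text \<open>Jensen's inequality for \<open>m / \<delta>\<close>, a measure of total mass at most 1:
  the missing mass is placed at the value 0, where \<open>exp\<close> is 1. The tangent line at
  \<open>a\<close> makes it unnecessary to construct the completed probability measure.\<close>

lemma exp_mixture_le:
  assumes m: "finite_measure m" and \<delta>: "measure m (space m) \<le> \<delta>" "0 < \<delta>" and Z: "Z \<in> bfun m"
  shows "ennreal \<delta> * ennreal (exp ((\<integral>c. Z c \<partial>m) / \<delta>))
    \<le> (\<integral>\<^sup>+c. ennreal (exp (Z c)) \<partial>m) + ennreal (\<delta> - measure m (space m))"
proof -
  interpret finite_measure m by fact
  define a where "a = (\<integral>c. Z c \<partial>m) / \<delta>"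
  define p where "p = measure m (space m)"
  have int: "integrable m Z" "integrable m (\<lambda>c. exp (Z c))"
    using Z by (auto intro: integrable_bfun)
  have tangent: "exp a * (1 - a) + exp a * z \<le> exp z" for z
  proof -
    have "exp a * (1 + (z - a)) \<le> exp a * exp (z - a)"
      using exp_ge_add_one_self[of "z - a"] by (intro mult_left_mono) auto
    then show ?thesis
      by (simp add: exp_add[symmetric] algebra_simps)
  qed
  have "(\<integral>c. exp a * (1 - a) + exp a * Z c \<partial>m) \<le> (\<integral>c. exp (Z c) \<partial>m)"
    using int by (intro integral_mono tangent) auto
  moreover have "(\<integral>c. exp a * (1 - a) + exp a * Z c \<partial>m) = p * (exp a * (1 - a)) + exp a * (\<delta> * a)"
    using int \<delta>(2) by (simp add: p_def a_def)
  \<comment> \<open>The tangent line at the value 0 stays below \<open>exp 0\<close>; this pays for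
    the missing mass \<open>\<delta> - p\<close>.\<close>
  moreover have "(\<delta> - p) * (exp a * (1 - a)) \<le> (\<delta> - p) * 1"
    using tangent[of 0] \<delta>(1) unfolding p_def by (intro mult_left_mono) auto
  ultimately have "\<delta> * exp a \<le> (\<integral>c. exp (Z c) \<partial>m) + (\<delta> - p)"
    by (simp add: algebra_simps)
  then have "ennreal (\<delta> * exp a) \<le> ennreal ((\<integral>c. exp (Z c) \<partial>m) + (\<delta> - p))"
    by (rule ennreal_leI)
  also have "\<dots> = (\<integral>\<^sup>+c. ennreal (exp (Z c)) \<partial>m) + ennreal (\<delta> - p)"
    using \<delta>(1) int(2) by (subst ennreal_plus) (auto simp: p_def nn_integral_eq_integral)
  finally show ?thesis
    using \<delta>(2) by (simp add: a_def p_def ennreal_mult)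
qed

text \<open>\<open>exp_mixture_le\<close> moves the exponential inside the mixture, and after Fubini
  every member \<open>g i c\<close> is covered by the same uniform bound. Finiteness of
  \<open>m i\<close> makes Fubini available.\<close>

lemma subexponential_mixture:
  assumes M: "\<And>N. N \<ge> 1 \<Longrightarrow> prob_space (M N)"
    and X: "subexponential M J X"
    and m: "\<And>i. i \<in> I \<Longrightarrow> finite_measure (m i)" "\<And>i. i \<in> I \<Longrightarrow> measure (m i) (space (m i)) \<le> \<delta>"
    and g: "\<And>i c. i \<in> I \<Longrightarrow> c \<in> space (m i) \<Longrightarrow> g i c \<in> J"
    and bfun: "\<And>i N. i \<in> I \<Longrightarrow> N \<ge> 1 \<Longrightarrow> (\<lambda>(w, c). X (g i c) N w) \<in> bfun (M N \<Otimes>\<^sub>M m i)"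
  shows "subexponential M I (\<lambda>i N w. \<integral>c. X (g i c) N w \<partial>m i)"
proof -
  obtain c C where c: "c > 0"
    and C: "\<And>i N. i \<in> J \<Longrightarrow> N \<ge> 1 \<Longrightarrow> (\<integral>\<^sup>+w. ennreal (exp (c * X i N w)) \<partial>M N) \<le> ennreal C"
    using X unfolding subexponential_def by blast
  \<comment> \<open>\<open>e\<close> is positive whatever \<open>\<delta>\<close> is, so it may be
    divided by.\<close>
  define e where "e = \<bar>\<delta>\<bar> + 1"
  have e: "e > 0" "\<delta> \<le> e"
    by (auto simp: e_def)
  \<comment> \<open>Since \<open>A\<close> is at least 1, the missing mass is charged at the same
    price as the rest, for a total of \<open>e * A\<close>.\<close>
  define A where "A = max C 1"
  have "(\<integral>\<^sup>+w. ennreal (exp (c / e * (\<integral>y. X (g i y) N w \<partial>m i))) \<partial>M N) \<le> ennreal A"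
    if i: "i \<in> I" "N \<ge> 1" for i N
  proof -
    interpret m: finite_measure "m i" using m(1)[OF i(1)] .
    interpret M: prob_space "M N" using M[OF i(2)] .
    interpret pair_sigma_finite "M N" "m i" ..
    let ?p = "measure (m i) (space (m i))"
    note [measurable] = bfun_measurable[OF bfun[OF i]]
    have p: "?p \<le> e"
      using m(2)[OF i(1)] e(2) by linarith
    have Z: "(\<lambda>y. c * X (g i y) N w) \<in> bfun (m i)" if "w \<in> space (M N)" for w
    proof -
      have "(\<lambda>y. X (g i y) N w) \<in> bfun (m i)"
        using bfun_compose[OF bfun[OF i], of "Pair w" "m i"] that by simp
      then show ?thesis
        by auto
    qed
    have "ennreal e * (\<integral>\<^sup>+w. ennreal (exp (c / e * (\<integral>y. X (g i y) N w \<partial>m i))) \<partial>M N)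
        = (\<integral>\<^sup>+w. ennreal e * ennreal (exp ((\<integral>y. c * X (g i y) N w \<partial>m i) / e)) \<partial>M N)"
      by (subst nn_integral_cmult[symmetric]) (auto intro!: nn_integral_cong)
    also have "\<dots> \<le> (\<integral>\<^sup>+w. (\<integral>\<^sup>+y. ennreal (exp (c * X (g i y) N w)) \<partial>m i) + ennreal (e - ?p) \<partial>M N)"
      using Z e p by (intro nn_integral_mono exp_mixture_le m.finite_measure_axioms)
    also have "\<dots> = (\<integral>\<^sup>+w. (\<integral>\<^sup>+y. ennreal (exp (c * X (g i y) N w)) \<partial>m i) \<partial>M N) + ennreal (e - ?p)"
      by (subst nn_integral_add) (auto simp: M.emeasure_space_1)
    also have "(\<integral>\<^sup>+w. (\<integral>\<^sup>+y. ennreal (exp (c * X (g i y) N w)) \<partial>m i) \<partial>M N)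
        = (\<integral>\<^sup>+y. (\<integral>\<^sup>+w. ennreal (exp (c * X (g i y) N w)) \<partial>M N) \<partial>m i)"
      by (rule Fubini'[symmetric]) simp
    also have "(\<integral>\<^sup>+y. (\<integral>\<^sup>+w. ennreal (exp (c * X (g i y) N w)) \<partial>M N) \<partial>m i) + ennreal (e - ?p)
        \<le> (\<integral>\<^sup>+y. ennreal A \<partial>m i) + ennreal (e - ?p)"
      using order_trans[OF C[OF g[OF i(1)] i(2)] ennreal_leI[of C A]]
      by (intro add_right_mono nn_integral_mono) (auto simp: A_def)
    also have "\<dots> \<le> ennreal (A * ?p) + ennreal (A * (e - ?p))"
    proof (intro add_mono)
      have "1 * (e - ?p) \<le> A * (e - ?p)"
        using p by (intro mult_right_mono) (auto simp: A_def)
      then show "ennreal (e - ?p) \<le> ennreal (A * (e - ?p))"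
        by (intro ennreal_leI) simp
    qed (auto simp: m.emeasure_eq_measure A_def ennreal_mult')
    also have "\<dots> = ennreal (A * ?p + A * (e - ?p))"
      using p by (intro ennreal_plus[symmetric] mult_nonneg_nonneg) (auto simp: A_def)
    also have "A * ?p + A * (e - ?p) = e * A"
      by (simp add: algebra_simps)
    also have "ennreal (e * A) = ennreal e * ennreal A"
      using e by (intro ennreal_mult) (auto simp: A_def)
    finally show ?thesis
      using e(1) by (subst (asm) ennreal_mult_le_mult_iff) auto
  qed
  then show ?thesis
    unfolding subexponential_def using c e by (intro exI[of _ "c / e"]) auto
qed

text \<open>Once \<open>\<theta> t N\<close> is below the rate \<open>c\<close> of \<open>S\<close>,
  convexity bounds the log Laplace transform of \<open>\<theta> t N * S N\<close> by
  \<open>\<theta> t N / c\<close> times a constant, which vanishes after division by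
  \<open>\<alpha> N\<close>, as that is at least \<open>a\<close>. The lower bound is 0 because the
  exponent is nonnegative.\<close>

lemma negligibleI:
  fixes \<alpha> :: "nat \<Rightarrow> real"
  assumes M: "\<And>N. N \<ge> 1 \<Longrightarrow> prob_space (M N)"
    and \<alpha>: "a > 0" "\<And>N. N \<ge> 1 \<Longrightarrow> a \<le> \<alpha> N"
    and X: "\<And>N. N \<ge> 1 \<Longrightarrow> X N \<in> bfun (M N)"
    and S: "\<And>N. N \<ge> 1 \<Longrightarrow> S N \<in> bfun (M N)"
    and subexp: "subexponential M {()} (\<lambda>_. S)"
    and \<theta>: "\<And>t. t > 0 \<Longrightarrow> \<theta> t \<longlonglongrightarrow> 0" "\<And>t N. t > 0 \<Longrightarrow> N \<ge> 1 \<Longrightarrow> 0 \<le> \<theta> t N"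
    and b: "\<And>t. t > 0 \<Longrightarrow> b t \<longlonglongrightarrow> 0"
    and le: "\<And>t. t > 0 \<Longrightarrow> \<forall>\<^sub>F N in sequentially.
      \<forall>w\<in>space (M N). t * \<alpha> N * \<bar>X N w\<bar> \<le> \<theta> t N * S N w + \<alpha> N * b t N"
  shows "negligible_rv \<alpha> M X"
  unfolding negligible_rv_def
proof (intro allI impI)
  fix t :: real assume t: "t > 0"
  let ?L = "\<lambda>N. log_mgf (M N) (\<lambda>w. t * \<alpha> N * \<bar>X N w\<bar>) / \<alpha> N"
  obtain c C where c: "c > 0"
    and C: "\<And>N. N \<ge> 1 \<Longrightarrow> (\<integral>\<^sup>+w. ennreal (exp (c * S N w)) \<partial>M N) \<le> ennreal C"
    using subexp unfolding subexponential_def by auto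
  \<comment> \<open>The maximum with 1 makes \<open>A\<close> nonnegative, so that
    \<open>\<alpha> N\<close> may be replaced by its lower bound \<open>a\<close> in the
    denominator.\<close>
  define A where "A = ln (max C 1)"
  have A: "0 \<le> A" "exp A = max C 1"
    by (auto simp: A_def)
  have ev1: "\<forall>\<^sub>F N in sequentially. \<theta> t N \<le> c"
    using order_tendstoD(2)[OF \<theta>(1)[OF t] c] by (rule eventually_mono) simp
  have upper: "\<forall>\<^sub>F N in sequentially. ?L N \<le> \<theta> t N / c * A / a + b t N"
    using le[OF t] ev1 eventually_ge_at_top[of 1]
  proof eventually_elim
    case (elim N)
    interpret prob_space "M N" using M elim(3) .
    note bf = X[OF elim(3)] S[OF elim(3)]
    have \<theta>1: "0 \<le> \<theta> t N / c" "\<theta> t N / c \<le> 1"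
      using \<theta>(2)[OF t elim(3)] elim(2) c by auto
    have "log_mgf (M N) (\<lambda>w. c * S N w) \<le> A"
    proof (subst log_mgf_le_iff)
      show "expectation (\<lambda>w. exp (c * S N w)) \<le> exp A"
      proof -
        have "ennreal (expectation (\<lambda>w. exp (c * S N w))) = (\<integral>\<^sup>+w. ennreal (exp (c * S N w)) \<partial>M N)"
          using bf by (intro nn_integral_eq_integral[symmetric] integrable_bfun) auto
        also have "\<dots> \<le> ennreal (exp A)"
          using C[OF elim(3)] by (rule order_trans) (auto simp: A intro!: ennreal_leI)
        finally show ?thesis
          by simp
      qed
    qed (use bf in auto)
    moreover have "log_mgf (M N) (\<lambda>w. \<theta> t N / c * (c * S N w)) \<le> \<theta> t N / c * log_mgf (M N) (\<lambda>w. c * S N w)"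
      using bf \<theta>1 by (intro log_mgf_scale) auto
    ultimately have "log_mgf (M N) (\<lambda>w. \<theta> t N * S N w) \<le> \<theta> t N / c * A"
      using mult_left_mono[OF _ \<theta>1(1)] c by fastforce
    moreover have "log_mgf (M N) (\<lambda>w. t * \<alpha> N * \<bar>X N w\<bar>) \<le> log_mgf (M N) (\<lambda>w. \<theta> t N * S N w + \<alpha> N * b t N)"
      using elim(1) by (intro log_mgf_mono bfun_add bfun_cmult bfun_abs bfun_const bf) auto
    moreover have "log_mgf (M N) (\<lambda>w. \<theta> t N * S N w + \<alpha> N * b t N) = log_mgf (M N) (\<lambda>w. \<theta> t N * S N w) + \<alpha> N * b t N"
      using bf by (intro log_mgf_add_const) auto
    ultimately have "log_mgf (M N) (\<lambda>w. t * \<alpha> N * \<bar>X N w\<bar>) \<le> \<theta> t N / c * A + \<alpha> N * b t N"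
      by linarith
    then have "?L N \<le> (\<theta> t N / c * A + \<alpha> N * b t N) / \<alpha> N"
      using \<alpha>(1) \<alpha>(2)[OF elim(3)] by (intro divide_right_mono) auto
    also have "\<dots> = \<theta> t N / c * A / \<alpha> N + b t N"
      using \<alpha>(1) \<alpha>(2)[OF elim(3)] by (simp add: add_divide_distrib)
    also have "\<theta> t N / c * A / \<alpha> N \<le> \<theta> t N / c * A / a"
      using \<alpha>(1) \<alpha>(2)[OF elim(3)] A(1) \<theta>1(1) by (intro divide_left_mono mult_nonneg_nonneg mult_pos_pos) auto
    finally show ?case
      by simp
  qed
  have lower: "\<forall>\<^sub>F N in sequentially. 0 \<le> ?L N"
    using eventually_ge_at_top[of 1]
  proof eventually_elim
    case (elim N)
    interpret prob_space "M N" using M elim .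
    have \<alpha>N: "0 < \<alpha> N"
      using \<alpha>(1) \<alpha>(2)[OF elim] by linarith
    have "log_mgf (M N) (\<lambda>_. 0) \<le> log_mgf (M N) (\<lambda>w. t * \<alpha> N * \<bar>X N w\<bar>)"
      using \<alpha>N t by (intro log_mgf_mono bfun_cmult bfun_abs bfun_const X elim) auto
    then show ?case
      using \<alpha>N by (simp add: log_mgf_const)
  qed
  have "(\<lambda>N. \<theta> t N / c * A / a + b t N) \<longlonglongrightarrow> 0 / c * A / a + 0"
    using c \<alpha>(1) by (intro tendsto_intros \<theta>(1) b t) auto
  then have "(\<lambda>N. \<theta> t N / c * A / a + b t N) \<longlonglongrightarrow> 0"
    by simp
  from tendsto_sandwich[OF lower upper tendsto_const this]
  show "?L \<longlonglongrightarrow> 0" .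
qed

section \<open>Oscillation-weighted families of functions\<close>

text \<open>A common form for the families in both regularity conditions: each function is divided
  by its oscillation, and the weight goes into the measure \<open>m\<close>, which thereby becomes
  finite. The parameter type \<open>'c\<close> is free because the parameters are functions in one
  condition and pairs of functions in the other.\<close>

definition osc_family :: "'a measure \<Rightarrow> real \<Rightarrow> 'c measure \<Rightarrow> ('c \<Rightarrow> 'a \<Rightarrow> real) \<Rightarrow> bool"
  where "osc_family E \<delta> m h \<longleftrightarrow>
    finite_measure m \<and> measure m (space m) \<le> \<delta> \<and>
    (\<lambda>(x, c). h c x) \<in> borel_measurable (E \<Otimes>\<^sub>M m) \<and> (\<forall>c\<in>space m. h c \<in> Osc1 E)"

lemma probs_sets: "\<eta> \<in> probs E \<Longrightarrow> sets \<eta> = sets E"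
  by (simp add: space_prob_algebra)

lemma probs_prob_space: "\<eta> \<in> probs E \<Longrightarrow> prob_space \<eta>"
  by (simp add: space_prob_algebra)

lemma probs_bfun: "\<mu> \<in> probs E \<Longrightarrow> bfun \<mu> = bfun E"
  by (rule bfun_cong_sets[OF probs_sets])

lemma probs_space: "\<mu> \<in> probs E \<Longrightarrow> space \<mu> = space E"
  by (rule sets_eq_imp_space_eq[OF probs_sets])

lemma probs_abs_integral_le:
  assumes "\<mu> \<in> probs E" "f \<in> bfun E" "\<And>x. x \<in> space E \<Longrightarrow> \<bar>f x\<bar> \<le> B"
  shows "\<bar>\<integral>x. f x \<partial>\<mu>\<bar> \<le> B"
  using assms probs_bfun[OF assms(1)] probs_space[OF assms(1)]
  by (intro prob_space.abs_integral_le probs_prob_space[OF assms(1)]) auto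

lemma kernel_integral_bfun:
  assumes \<kappa>: "\<kappa> \<in> G \<rightarrow>\<^sub>M prob_algebra F" and f: "f \<in> bfun F"
  shows "(\<lambda>w. \<integral>y. f y \<partial>\<kappa> w) \<in> bfun G"
proof -
  obtain B where "\<And>y. y \<in> space F \<Longrightarrow> \<bar>f y\<bar> \<le> B"
    using bfunE[OF f] by metis
  then have "\<bar>\<integral>y. f y \<partial>\<kappa> w\<bar> \<le> B" if "w \<in> space G" for w
    by (rule probs_abs_integral_le[OF measurable_space[OF \<kappa> that] f])
  moreover have "(\<lambda>w. \<integral>y. f y \<partial>\<kappa> w) \<in> borel_measurable G"
    using measurable_compose[OF measurable_prob_algebraD[OF \<kappa>]
        integral_measurable_subprob_algebra[OF bfun_measurable[OF f]]] .
  ultimately show ?thesis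
    by (intro bfunI)
qed

lemma integral_parametric_measurable:
  fixes h :: "'c \<Rightarrow> 'a \<Rightarrow> real"
  assumes h: "(\<lambda>(x, c). h c x) \<in> borel_measurable (E \<Otimes>\<^sub>M T)" and \<mu>: "\<mu> \<in> probs E"
  shows "(\<lambda>c. \<integral>x. h c x \<partial>\<mu>) \<in> borel_measurable T"
proof -
  interpret prob_space \<mu>
    using \<mu> by (rule probs_prob_space)
  have "(\<lambda>(c, x). h c x) \<in> borel_measurable (T \<Otimes>\<^sub>M E)"
    using measurable_pair_swap[OF h] by (simp add: case_prod_beta')
  then have "(\<lambda>(c, x). h c x) \<in> borel_measurable (T \<Otimes>\<^sub>M \<mu>)"
    using measurable_cong_sets[OF sets_pair_measure_cong[OF refl probs_sets[OF \<mu>]] refl] by blast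
  from borel_measurable_lebesgue_integral[OF this] show ?thesis
    by simp
qed

lemma osc_family_diff_bfun:
  assumes "osc_family E \<delta> m h" and \<mu>: "\<mu> \<in> probs E" and \<eta>: "\<eta> \<in> probs E"
  shows "(\<lambda>c. mean_diff \<mu> \<eta> (h c)) \<in> bfun m"
proof -
  have h: "(\<lambda>(x, c). h c x) \<in> borel_measurable (E \<Otimes>\<^sub>M m)" "\<And>c. c \<in> space m \<Longrightarrow> h c \<in> Osc1 E"
    using assms(1) by (auto simp: osc_family_def)
  show ?thesis
  proof (rule bfunI[where B = 1])
    show "\<bar>mean_diff \<mu> \<eta> (h c)\<bar> \<le> 1" if "c \<in> space m" for c
      using h(2)[OF that] \<mu> \<eta> by (intro integral_diff_le_osc Osc1_bfun) (auto simp: Osc1_def)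
  qed (intro borel_measurable_diff integral_parametric_measurable[OF h(1)] \<mu> \<eta>)
qed

text \<open>When the oscillation is 0 both sides vanish, the left one because a difference of means
  is bounded by the oscillation; otherwise this is homogeneity.\<close>

lemma integral_diff_osc_normalize:
  assumes \<mu>: "\<mu> \<in> probs E" and \<eta>: "\<eta> \<in> probs E" and h: "h \<in> bfun E"
  shows "\<bar>mean_diff \<mu> \<eta> h\<bar>
    = enn2real (osc E h) * \<bar>(\<integral>x. h x / enn2real (osc E h) \<partial>\<mu>) - (\<integral>x. h x / enn2real (osc E h) \<partial>\<eta>)\<bar>"
proof -
  have "\<bar>mean_diff \<mu> \<eta> h\<bar> \<le> enn2real (osc E h)"
    using osc_finite[OF h] by (intro integral_diff_le_osc[OF \<mu> \<eta> h]) auto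
  then show ?thesis
    by (cases "enn2real (osc E h) = 0")
      (auto simp: diff_divide_distrib[symmetric] abs_divide zero_less_iff_neq_zero)
qed

lemma osc_family_density:
  assumes u: "u \<in> borel_measurable T" "(\<integral>\<^sup>+c. u c \<partial>T) \<le> ennreal \<delta>" and \<delta>: "0 \<le> \<delta>"
    and h: "(\<lambda>(x, c). h c x) \<in> borel_measurable (E \<Otimes>\<^sub>M T)" "\<And>c. c \<in> space T \<Longrightarrow> h c \<in> Osc1 E"
  shows "osc_family E \<delta> (density T u) h"
proof -
  have sets: "sets (density T u) = sets T"
    by simp
  have em: "emeasure (density T u) (space (density T u)) \<le> ennreal \<delta>"
    using u by (simp add: emeasure_density cong: nn_integral_cong)
  then have fin: "finite_measure (density T u)"
    by (intro finite_measureI) (auto simp: top_unique)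
  then have "measure (density T u) (space (density T u)) \<le> \<delta>"
    using em \<delta> by (simp add: finite_measure.emeasure_eq_measure)
  moreover have "(\<lambda>(x, c). h c x) \<in> borel_measurable (E \<Otimes>\<^sub>M density T u)"
    using h(1) measurable_cong_sets[OF sets_pair_measure_cong[OF refl sets] refl] by blast
  ultimately show ?thesis
    unfolding osc_family_def using fin h(2) by simp
qed

text \<open>The measure \<open>T\<close> need be neither finite nor sigma-finite; weighted with the
  oscillation it has mass at most \<open>\<delta>\<close>, uniformly in \<open>f\<close> because
  \<open>f\<close> has oscillation at most 1. The weight discards functions of zero oscillation, but
  these cannot tell two probability measures apart.\<close>

lemma condition_K_osc_family:
  fixes E1 :: "'a measure" and E2 :: "'b measure"
  assumes "condition_K E1 E2 K"
  shows "\<exists>\<delta>\<ge>0. \<forall>f\<in>Osc1 E2. \<forall>\<eta>\<in>probs E1. \<exists>(m :: ('a \<Rightarrow> real) measure) h. osc_family E1 \<delta> m h \<and>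
    (\<forall>\<mu>\<in>probs E1. \<forall>x\<in>space E1. \<bar>(\<integral>y. f y \<partial>K \<mu> x) - (\<integral>y. f y \<partial>K \<eta> x)\<bar>
      \<le> (\<integral>c. \<bar>mean_diff \<mu> \<eta> (h c)\<bar> \<partial>m))"
proof -
  obtain T :: "'a measure \<Rightarrow> ('b \<Rightarrow> real) \<Rightarrow> ('a \<Rightarrow> real) measure" and \<delta> :: ennreal where \<delta>: "\<delta> < \<infinity>"
    and T: "\<And>f \<eta>. f \<in> Osc1 E2 \<Longrightarrow> \<eta> \<in> probs E1 \<Longrightarrow> fun_measure E1 (T \<eta> f)"
    and le: "\<And>f \<mu> \<eta>. f \<in> Osc1 E2 \<Longrightarrow> \<mu> \<in> probs E1 \<Longrightarrow> \<eta> \<in> probs E1 \<Longrightarrow>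
      (SUP x\<in>space E1. ennreal \<bar>(\<integral>y. f y \<partial>K \<mu> x) - (\<integral>y. f y \<partial>K \<eta> x)\<bar>)
        \<le> (\<integral>\<^sup>+h. ennreal \<bar>mean_diff \<mu> \<eta> h\<bar> \<partial>T \<eta> f)"
    and mass: "\<And>f. f \<in> Osc1 E2 \<Longrightarrow> (SUP \<eta>\<in>probs E1. \<integral>\<^sup>+h. osc E1 h \<partial>T \<eta> f) \<le> osc E2 f * \<delta>"
    using assms unfolding condition_K_def by blast
  show ?thesis
  proof (intro exI[of _ "enn2real \<delta>"] conjI ballI)
    fix f \<eta> assume f: "f \<in> Osc1 E2" and \<eta>: "\<eta> \<in> probs E1"
    let ?T = "T \<eta> f"
    define m where "m = density ?T (osc E1)"
    define h where "h c x = c x / enn2real (osc E1 c)" for c :: "'a \<Rightarrow> real" and x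
    have sp: "\<And>c. c \<in> space ?T \<Longrightarrow> c \<in> bfun E1"
      and ev: "(\<lambda>(x, c). c x) \<in> borel_measurable (E1 \<Otimes>\<^sub>M ?T)"
      and om [measurable]: "osc E1 \<in> borel_measurable ?T"
      using T[OF f \<eta>] by (auto simp: fun_measure_def)
    have ev': "(\<lambda>p. snd p (fst p)) \<in> borel_measurable (E1 \<Otimes>\<^sub>M ?T)"
      using ev by (simp add: case_prod_beta')
    have hm: "(\<lambda>(x, c). h c x) \<in> borel_measurable (E1 \<Otimes>\<^sub>M ?T)"
      unfolding h_def case_prod_beta' by (intro borel_measurable_divide ev') measurable
    have "(\<integral>\<^sup>+c. osc E1 c \<partial>?T) \<le> (SUP \<eta>\<in>probs E1. \<integral>\<^sup>+h. osc E1 h \<partial>T \<eta> f)"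
      using \<eta> by (intro SUP_upper)
    also have "\<dots> \<le> osc E2 f * \<delta>"
      using mass[OF f] .
    also have "\<dots> \<le> 1 * \<delta>"
    proof (rule mult_right_mono)
      show "osc E2 f \<le> 1"
        using f unfolding Osc1_def by blast
    qed simp
    finally have fam: "osc_family E1 (enn2real \<delta>) m h"
      unfolding m_def
    proof (intro osc_family_density[OF om _ enn2real_nonneg hm])
      show "h c \<in> Osc1 E1" if "c \<in> space ?T" for c
        unfolding h_def using sp[OF that] osc_finite[OF sp[OF that]]
        by (intro divide_Osc1) (auto dest: bfun_measurable)
    qed (use \<delta> in simp)
    then have fin: "finite_measure m"
      by (simp add: osc_family_def)
    note fam
    moreover have "\<bar>(\<integral>y. f y \<partial>K \<mu> x) - (\<integral>y. f y \<partial>K \<eta> x)\<bar>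
        \<le> (\<integral>c. \<bar>mean_diff \<mu> \<eta> (h c)\<bar> \<partial>m)"
      if \<mu>: "\<mu> \<in> probs E1" and x: "x \<in> space E1" for \<mu> x
    proof -
      have "ennreal \<bar>(\<integral>y. f y \<partial>K \<mu> x) - (\<integral>y. f y \<partial>K \<eta> x)\<bar>
          \<le> (SUP x\<in>space E1. ennreal \<bar>(\<integral>y. f y \<partial>K \<mu> x) - (\<integral>y. f y \<partial>K \<eta> x)\<bar>)"
        using x by (rule SUP_upper)
      also have "\<dots> \<le> (\<integral>\<^sup>+c. ennreal \<bar>mean_diff \<mu> \<eta> c\<bar> \<partial>?T)"
        using le[OF f \<mu> \<eta>] .
      also have "\<dots> = (\<integral>\<^sup>+c. osc E1 c * ennreal \<bar>mean_diff \<mu> \<eta> (h c)\<bar> \<partial>?T)"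
      proof (intro nn_integral_cong)
        fix c assume "c \<in> space ?T"
        then have c: "c \<in> bfun E1"
          by (rule sp)
        have "osc E1 c = ennreal (enn2real (osc E1 c))"
          using osc_finite[OF c] by simp
        then show "ennreal \<bar>mean_diff \<mu> \<eta> c\<bar>
            = osc E1 c * ennreal \<bar>mean_diff \<mu> \<eta> (h c)\<bar>"
          unfolding integral_diff_osc_normalize[OF \<mu> \<eta> c] h_def by (metis abs_ge_zero ennreal_mult enn2real_nonneg)
      qed
      also have "\<dots> = (\<integral>\<^sup>+c. ennreal \<bar>mean_diff \<mu> \<eta> (h c)\<bar> \<partial>m)"
        unfolding m_def using integral_parametric_measurable[OF hm \<mu>] integral_parametric_measurable[OF hm \<eta>]
        by (intro nn_integral_density[symmetric]) auto
      also have "\<dots> = ennreal (\<integral>c. \<bar>mean_diff \<mu> \<eta> (h c)\<bar> \<partial>m)"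
        using osc_family_diff_bfun[OF fam \<mu> \<eta>]
        by (intro finite_measure.nn_integral_bfun[OF fin] bfun_abs) auto
      finally show ?thesis
        by (subst (asm) ennreal_le_iff) (auto intro: integral_nonneg_AE)
    qed
    ultimately show "\<exists>(m :: ('a \<Rightarrow> real) measure) h. osc_family E1 (enn2real \<delta>) m h \<and>
      (\<forall>\<mu>\<in>probs E1. \<forall>x\<in>space E1. \<bar>(\<integral>y. f y \<partial>K \<mu> x) - (\<integral>y. f y \<partial>K \<eta> x)\<bar>
        \<le> (\<integral>c. \<bar>mean_diff \<mu> \<eta> (h c)\<bar> \<partial>m))"
      by blast
  qed simp
qed

definition remainder_family ::
    "'a measure \<Rightarrow> ('a measure \<Rightarrow> 'b measure) \<Rightarrow> ('a measure \<Rightarrow> ('b \<Rightarrow> real) \<Rightarrow> 'a \<Rightarrow> real) \<Rightarrow> 'a measure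
      \<Rightarrow> real \<Rightarrow> ('b \<Rightarrow> real) \<Rightarrow> 'c measure \<Rightarrow> ('c \<Rightarrow> 'a \<Rightarrow> real) \<Rightarrow> ('c \<Rightarrow> 'a \<Rightarrow> real) \<Rightarrow> bool"
  where "remainder_family E \<Phi> D \<eta> \<delta> f m h\<^sub>1 h\<^sub>2 \<longleftrightarrow>
    osc_family E \<delta> m h\<^sub>1 \<and> osc_family E \<delta> m h\<^sub>2 \<and>
    (\<forall>\<mu>\<in>probs E. \<bar>remainder \<Phi> D \<mu> \<eta> f\<bar>
      \<le> (\<integral>c. \<bar>mean_diff \<mu> \<eta> (h\<^sub>1 c) * mean_diff \<mu> \<eta> (h\<^sub>2 c)\<bar> \<partial>m))"

text \<open>The same reweighting as for condition (K), now by the product of both oscillations, so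
  that one measure carries both families. The two summands 1 keep the mass bound positive when
  \<open>\<delta>\<close> or the oscillation of \<open>f\<close> is 0; the bound is divided by
  later.\<close>

lemma class_Upsilon_remainder_family:
  fixes E1 :: "'a measure" and E2 :: "'b measure"
  assumes "class_Upsilon E1 E2 \<Phi> D"
  shows "\<exists>\<delta>>0. \<forall>f\<in>bfun E2. \<forall>\<eta>\<in>probs E1. \<exists>(m :: (('a \<Rightarrow> real) \<times> ('a \<Rightarrow> real)) measure) h\<^sub>1 h\<^sub>2.
    remainder_family E1 \<Phi> D \<eta> (\<delta> * (enn2real (osc E2 f) + 1)) f m h\<^sub>1 h\<^sub>2"
proof -
  obtain R :: "'a measure \<Rightarrow> ('b \<Rightarrow> real) \<Rightarrow> (('a \<Rightarrow> real) \<times> ('a \<Rightarrow> real)) measure" and \<delta> :: ennreal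
    where \<delta>: "\<delta> < \<infinity>"
    and R: "\<And>f \<eta>. f \<in> bfun E2 \<Longrightarrow> \<eta> \<in> probs E1 \<Longrightarrow> tensor_measure E1 (R \<eta> f)"
    and le: "\<And>f \<mu> \<eta>. f \<in> bfun E2 \<Longrightarrow> \<mu> \<in> probs E1 \<Longrightarrow> \<eta> \<in> probs E1 \<Longrightarrow>
      ennreal \<bar>remainder \<Phi> D \<mu> \<eta> f\<bar>
        \<le> (\<integral>\<^sup>+(g\<^sub>1, g\<^sub>2). ennreal \<bar>mean_diff \<mu> \<eta> g\<^sub>1 *
                          mean_diff \<mu> \<eta> g\<^sub>2\<bar> \<partial>R \<eta> f)"
    and mass: "\<And>f. f \<in> bfun E2 \<Longrightarrow>
      (SUP \<eta>\<in>probs E1. \<integral>\<^sup>+(g\<^sub>1, g\<^sub>2). osc E1 g\<^sub>1 * osc E1 g\<^sub>2 \<partial>R \<eta> f) \<le> osc E2 f * \<delta>"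
    using assms unfolding class_Upsilon_def by blast
  show ?thesis
  proof (intro exI[of _ "enn2real \<delta> + 1"] conjI ballI)
    fix f \<eta> assume f: "f \<in> bfun E2" and \<eta>: "\<eta> \<in> probs E1"
    let ?R = "R \<eta> f"
    let ?\<delta> = "(enn2real \<delta> + 1) * (enn2real (osc E2 f) + 1)"
    define m where "m = density ?R (\<lambda>g. osc E1 (fst g) * osc E1 (snd g))"
    define h\<^sub>1 where "h\<^sub>1 g x = fst g x / enn2real (osc E1 (fst g))" for g :: "('a \<Rightarrow> real) \<times> ('a \<Rightarrow> real)" and x
    define h\<^sub>2 where "h\<^sub>2 g x = snd g x / enn2real (osc E1 (snd g))" for g :: "('a \<Rightarrow> real) \<times> ('a \<Rightarrow> real)" and x
    have sp: "\<And>g. g \<in> space ?R \<Longrightarrow> fst g \<in> bfun E1 \<and> snd g \<in> bfun E1"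
      and [measurable]: "(\<lambda>g. osc E1 (fst g)) \<in> borel_measurable ?R" "(\<lambda>g. osc E1 (snd g)) \<in> borel_measurable ?R"
      using R[OF f \<eta>] Osc1_bfun by (fastforce simp: tensor_measure_def)+
    have ev: "(\<lambda>p. fst (snd p) (fst p)) \<in> borel_measurable (E1 \<Otimes>\<^sub>M ?R)"
      "(\<lambda>p. snd (snd p) (fst p)) \<in> borel_measurable (E1 \<Otimes>\<^sub>M ?R)"
      using R[OF f \<eta>] by (auto simp: tensor_measure_def case_prod_beta')
    have hm: "(\<lambda>(x, c). h\<^sub>1 c x) \<in> borel_measurable (E1 \<Otimes>\<^sub>M ?R)"
      "(\<lambda>(x, c). h\<^sub>2 c x) \<in> borel_measurable (E1 \<Otimes>\<^sub>M ?R)"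
      unfolding h\<^sub>1_def h\<^sub>2_def case_prod_beta' by (intro borel_measurable_divide ev; measurable)+
    have "(\<integral>\<^sup>+(g\<^sub>1, g\<^sub>2). osc E1 g\<^sub>1 * osc E1 g\<^sub>2 \<partial>?R)
        \<le> (SUP \<eta>\<in>probs E1. \<integral>\<^sup>+(g\<^sub>1, g\<^sub>2). osc E1 g\<^sub>1 * osc E1 g\<^sub>2 \<partial>R \<eta> f)"
      using \<eta> by (intro SUP_upper)
    also have "\<dots> \<le> osc E2 f * \<delta>"
      using mass[OF f] .
    also have "\<dots> = ennreal (enn2real \<delta> * enn2real (osc E2 f))"
      using \<delta> osc_finite[OF f] by (simp add: ennreal_mult mult.commute)
    also have "\<dots> \<le> ennreal ?\<delta>"
      by (intro ennreal_leI mult_mono) auto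
    finally have mass': "(\<integral>\<^sup>+g. osc E1 (fst g) * osc E1 (snd g) \<partial>?R) \<le> ennreal ?\<delta>"
      by (simp add: case_prod_beta')
    have "h\<^sub>1 c \<in> Osc1 E1" "h\<^sub>2 c \<in> Osc1 E1" if "c \<in> space ?R" for c
      unfolding h\<^sub>1_def h\<^sub>2_def using sp[OF that] osc_finite[of "fst c" E1] osc_finite[of "snd c" E1]
      by (intro divide_Osc1; auto dest: bfun_measurable)+
    then have fam: "osc_family E1 ?\<delta> m h\<^sub>1" "osc_family E1 ?\<delta> m h\<^sub>2"
      unfolding m_def using mass' hm by (auto intro!: osc_family_density)
    then have fin: "finite_measure m"
      by (simp add: osc_family_def)
    have "\<bar>remainder \<Phi> D \<mu> \<eta> f\<bar>
      \<le> (\<integral>c. \<bar>mean_diff \<mu> \<eta> (h\<^sub>1 c) * mean_diff \<mu> \<eta> (h\<^sub>2 c)\<bar> \<partial>m)"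
      if \<mu>: "\<mu> \<in> probs E1" for \<mu>
    proof -
      let ?d = "\<lambda>h. mean_diff \<mu> \<eta> h"
      have "ennreal \<bar>remainder \<Phi> D \<mu> \<eta> f\<bar> \<le> (\<integral>\<^sup>+(g\<^sub>1, g\<^sub>2). ennreal \<bar>?d g\<^sub>1 * ?d g\<^sub>2\<bar> \<partial>?R)"
        using le[OF f \<mu> \<eta>] .
      also have "\<dots> = (\<integral>\<^sup>+c. (osc E1 (fst c) * osc E1 (snd c)) * ennreal \<bar>?d (h\<^sub>1 c) * ?d (h\<^sub>2 c)\<bar> \<partial>?R)"
      proof (intro nn_integral_cong)
        fix c assume "c \<in> space ?R"
        then have c: "fst c \<in> bfun E1" "snd c \<in> bfun E1"
          using sp by auto
        have "osc E1 (fst c) = ennreal (enn2real (osc E1 (fst c)))"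
          "osc E1 (snd c) = ennreal (enn2real (osc E1 (snd c)))"
          using osc_finite[OF c(1)] osc_finite[OF c(2)] by simp_all
        then have "osc E1 (fst c) * osc E1 (snd c)
            = ennreal (enn2real (osc E1 (fst c)) * enn2real (osc E1 (snd c)))"
          by (metis ennreal_mult enn2real_nonneg)
        moreover have "\<bar>?d (fst c) * ?d (snd c)\<bar>
            = (enn2real (osc E1 (fst c)) * enn2real (osc E1 (snd c))) * \<bar>?d (h\<^sub>1 c) * ?d (h\<^sub>2 c)\<bar>"
          unfolding abs_mult integral_diff_osc_normalize[OF \<mu> \<eta> c(1)]
            integral_diff_osc_normalize[OF \<mu> \<eta> c(2)] h\<^sub>1_def h\<^sub>2_def by (simp only: mult_ac)
        ultimately have "ennreal \<bar>?d (fst c) * ?d (snd c)\<bar>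
            = (osc E1 (fst c) * osc E1 (snd c)) * ennreal \<bar>?d (h\<^sub>1 c) * ?d (h\<^sub>2 c)\<bar>"
          by (metis ennreal_mult enn2real_nonneg abs_ge_zero mult_nonneg_nonneg)
        then show "(case c of (g\<^sub>1, g\<^sub>2) \<Rightarrow> ennreal \<bar>?d g\<^sub>1 * ?d g\<^sub>2\<bar>)
            = (osc E1 (fst c) * osc E1 (snd c)) * ennreal \<bar>?d (h\<^sub>1 c) * ?d (h\<^sub>2 c)\<bar>"
          by (simp add: case_prod_beta')
      qed
      also have "\<dots> = (\<integral>\<^sup>+c. ennreal \<bar>?d (h\<^sub>1 c) * ?d (h\<^sub>2 c)\<bar> \<partial>m)"
        unfolding m_def using hm[THEN integral_parametric_measurable, OF \<mu>] hm[THEN integral_parametric_measurable, OF \<eta>]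
        by (intro nn_integral_density[symmetric]) auto
      also have "\<dots> = ennreal (\<integral>c. \<bar>?d (h\<^sub>1 c) * ?d (h\<^sub>2 c)\<bar> \<partial>m)"
        using fam[THEN osc_family_diff_bfun, OF \<mu> \<eta>]
        by (intro finite_measure.nn_integral_bfun[OF fin] bfun_abs bfun_mult) auto
      finally show ?thesis
        by (subst (asm) ennreal_le_iff) (auto intro: integral_nonneg_AE)
    qed
    with fam show "\<exists>(m :: (('a \<Rightarrow> real) \<times> ('a \<Rightarrow> real)) measure) h\<^sub>1 h\<^sub>2.
        remainder_family E1 \<Phi> D \<eta> ?\<delta> f m h\<^sub>1 h\<^sub>2"
      unfolding remainder_family_def by blast
  qed (simp add: add_nonneg_pos)
qed

lemma class_Upsilon_dobrushin:
  assumes "class_Upsilon E1 E2 \<Phi> D"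
  shows "\<exists>\<beta>\<ge>0. \<forall>\<eta>\<in>probs E1. \<forall>f\<in>Osc1 E2. osc E1 (D \<eta> f) \<le> ennreal \<beta>"
proof -
  let ?S = "SUP \<eta>\<in>probs E1. dobrushin E1 E2 (D \<eta>)"
  have "osc E1 (D \<eta> f) \<le> ennreal (enn2real ?S)" if "\<eta> \<in> probs E1" "f \<in> Osc1 E2" for \<eta> f
  proof -
    have "osc E1 (D \<eta> f) \<le> dobrushin E1 E2 (D \<eta>)"
      unfolding dobrushin_def using that by (intro SUP_upper)
    also have "\<dots> \<le> ?S"
      using that by (intro SUP_upper)
    also have "\<dots> = ennreal (enn2real ?S)"
      using assms by (simp add: class_Upsilon_def)
    finally show ?thesis .
  qed
  then show ?thesis
    by (intro exI[of _ "enn2real ?S"]) auto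
qed

lemma class_Upsilon_bfun:
  assumes "class_Upsilon E1 E2 \<Phi> D" "\<eta> \<in> probs E1" "f \<in> bfun E2"
  shows "D \<eta> f \<in> bfun E1"
  using assms by (auto simp: class_Upsilon_def bounded_integral_operator_def)

section \<open>The particle system with a fixed number of particles\<close>

text \<open>The cumulant generating function of centred \<open>f\<close>; by centring, its expansion
  in \<open>e\<close> starts with the variance term.\<close>

definition cumulant :: "'a measure \<Rightarrow> real \<Rightarrow> ('a \<Rightarrow> real) \<Rightarrow> real"
  where "cumulant \<kappa> e f = log_mgf \<kappa> (\<lambda>y. e * (f y - (\<integral>z. f z \<partial>\<kappa>)))"

lemma (in prob_space) abs_cumulant_le:
  assumes f: "f \<in> bfun M" and B: "\<And>x. x \<in> space M \<Longrightarrow> \<bar>f x\<bar> \<le> B"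
  shows "\<bar>cumulant M e f\<bar> \<le> \<bar>e\<bar> * (2 * B)"
proof -
  let ?c = "\<bar>e\<bar> * (2 * B)"
  have b: "(\<lambda>y. e * (f y - expectation f)) \<in> bfun M"
    by (intro bfun_intros f)
  have "\<bar>e * (f y - expectation f)\<bar> \<le> ?c" if "y \<in> space M" for y
  proof -
    have "\<bar>f y - expectation f\<bar> \<le> 2 * B"
      using abs_integral_le[OF f B] B[OF that] by linarith
    then show ?thesis
      by (simp add: abs_mult mult_left_mono)
  qed
  then have "log_mgf M (\<lambda>_. - ?c) \<le> cumulant M e f" "cumulant M e f \<le> log_mgf M (\<lambda>_. ?c)"
    unfolding cumulant_def by (intro log_mgf_mono b bfun_const; force simp: abs_le_iff)+
  then show ?thesis
    by (simp add: log_mgf_const abs_le_iff)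
qed

lemma (in prob_space) exp_cumulant:
  assumes f: "f \<in> bfun M"
  shows "exp (cumulant M e f) = exp (- (e * expectation f)) * (\<integral>y. exp (e * f y) \<partial>M)"
proof -
  have "exp (cumulant M e f) = (\<integral>y. exp (- (e * expectation f)) * exp (e * f y) \<partial>M)"
    unfolding cumulant_def
    by (subst exp_log_mgf) (intro bfun_intros f, simp add: exp_add[symmetric] algebra_simps)
  then show ?thesis
    by simp
qed

text \<open>Both sides integrate \<open>g\<close> against a measure on \<open>F\<close>: the image
  under \<open>X\<close> of \<open>M\<close> with density \<open>H\<close>, and the mixture of
  \<open>\<kappa>\<close> over \<open>M\<close> with density \<open>H'\<close>. By hypothesis these
  agree on all measurable sets, so no approximation of \<open>g\<close> is needed.\<close>

lemma kernel_nn_integral_eqI: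
  assumes H: "H \<in> borel_measurable M" "H' \<in> borel_measurable M"
    and X: "X \<in> M \<rightarrow>\<^sub>M F" and \<kappa>: "\<kappa> \<in> M \<rightarrow>\<^sub>M subprob_algebra F" and ne: "space M \<noteq> {}"
    and eq: "\<And>A. A \<in> sets F \<Longrightarrow>
      (\<integral>\<^sup>+w. H w * indicator A (X w) \<partial>M) = (\<integral>\<^sup>+w. H' w * emeasure (\<kappa> w) A \<partial>M)"
    and g: "g \<in> borel_measurable F"
  shows "(\<integral>\<^sup>+w. H w * g (X w) \<partial>M) = (\<integral>\<^sup>+w. H' w * (\<integral>\<^sup>+y. g y \<partial>\<kappa> w) \<partial>M)"
proof -
  have X': "X \<in> density M H \<rightarrow>\<^sub>M F" and \<kappa>': "\<kappa> \<in> density M H' \<rightarrow>\<^sub>M subprob_algebra F"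
    using X \<kappa> by simp_all
  have meas: "(\<lambda>w. emeasure (\<kappa> w) A) \<in> borel_measurable M" if "A \<in> sets F" for A
    using measurable_compose[OF \<kappa> measurable_emeasure_subprob_algebra[OF that]] .
  have "distr (density M H) F X = density M H' \<bind> \<kappa>"
  proof (rule measure_eqI)
    show "sets (distr (density M H) F X) = sets (density M H' \<bind> \<kappa>)"
      using sets_bind[OF sets_kernel[OF \<kappa>'], of "density M H'"] ne by simp
    fix A assume "A \<in> sets (distr (density M H) F X)"
    then have A: "A \<in> sets F"
      by simp
    have "emeasure (distr (density M H) F X) A = (\<integral>\<^sup>+w. H w * indicator A (X w) \<partial>M)"
      using A X H measurable_sets[OF X A]
      by (subst emeasure_distr) (auto simp: emeasure_density indicator_def intro!: nn_integral_cong)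
    also have "\<dots> = emeasure (density M H' \<bind> \<kappa>) A"
      using A H ne meas[OF A] by (simp add: eq emeasure_bind[OF _ \<kappa>'] nn_integral_density)
    finally show "emeasure (distr (density M H) F X) A = emeasure (density M H' \<bind> \<kappa>) A" .
  qed
  then have "(\<integral>\<^sup>+y. g y \<partial>distr (density M H) F X) = (\<integral>\<^sup>+y. g y \<partial>(density M H' \<bind> \<kappa>))"
    by simp
  also have "(\<integral>\<^sup>+y. g y \<partial>distr (density M H) F X) = (\<integral>\<^sup>+w. H w * g (X w) \<partial>M)"
    using g H X X' by (subst nn_integral_distr) (auto simp: nn_integral_density)
  also have "(\<integral>\<^sup>+y. g y \<partial>(density M H' \<bind> \<kappa>)) = (\<integral>\<^sup>+w. H' w * (\<integral>\<^sup>+y. g y \<partial>\<kappa> w) \<partial>M)"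
    using H measurable_compose[OF \<kappa> nn_integral_measurable_subprob_algebra[OF g]]
    by (subst nn_integral_bind[OF g \<kappa>']) (auto simp: nn_integral_density)
  finally show ?thesis .
qed

lemma transport_integral:
  assumes \<kappa>: "K \<mu> \<in> E \<rightarrow>\<^sub>M prob_algebra F" and \<mu>: "\<mu> \<in> probs E" and f: "f \<in> bfun F"
  shows "(\<integral>y. f y \<partial>transport K \<mu>) = (\<integral>x. (\<integral>y. f y \<partial>K \<mu> x) \<partial>\<mu>)"
    and "transport K \<mu> \<in> probs F"
    and "(\<lambda>x. \<integral>y. f y \<partial>K \<mu> x) \<in> bfun E"
    and "x \<in> space E \<Longrightarrow> K \<mu> x \<in> probs F"
proof -
  interpret prob_space \<mu>
    using \<mu> by (rule probs_prob_space)
  have sets: "sets \<mu> = sets E"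
    using \<mu> by (rule probs_sets)
  have \<kappa>': "K \<mu> \<in> \<mu> \<rightarrow>\<^sub>M prob_algebra F"
    using \<kappa> measurable_cong_sets[OF sets refl] by blast
  have K: "K \<mu> x \<in> probs F" if "x \<in> space E" for x
    using measurable_space[OF \<kappa> that] .
  then show "x \<in> space E \<Longrightarrow> K \<mu> x \<in> probs F" .
  obtain B where B: "B > 0" "\<And>y. y \<in> space F \<Longrightarrow> \<bar>f y\<bar> \<le> B"
    using bfunE[OF f] by metis
  show "(\<lambda>x. \<integral>y. f y \<partial>K \<mu> x) \<in> bfun E"
    by (rule kernel_integral_bfun[OF \<kappa> f])
  show "(\<integral>y. f y \<partial>transport K \<mu>) = (\<integral>x. (\<integral>y. f y \<partial>K \<mu> x) \<partial>\<mu>)"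
    unfolding transport_def
  proof (rule integral_bind)
    show "K \<mu> \<in> \<mu> \<rightarrow>\<^sub>M subprob_algebra F"
      using \<kappa>' by (rule measurable_prob_algebraD)
    show "f \<in> borel_measurable F"
      using f by (rule bfun_measurable)
    show "AE x in \<mu>. emeasure (K \<mu> x) (space (K \<mu> x)) \<le> ennreal 1"
      using prob_space.emeasure_space_1[OF probs_prob_space[OF K]] sets_eq_imp_space_eq[OF sets]
      by (intro AE_I2) simp
  qed (use B in \<open>auto simp: finite_measure_axioms\<close>)
  \<comment> \<open>Read as a constant kernel on a one-point space, the bind inherits membership
    from the measurability of \<open>bind\<close> for probability kernels.\<close>
  have "(\<lambda>_::unit. \<mu> \<bind> K \<mu>) \<in> count_space UNIV \<rightarrow>\<^sub>M prob_algebra F"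
    using \<mu> \<kappa> by (intro measurable_bind_prob_space[where N = E] measurable_const)
  from measurable_space[OF this] show "transport K \<mu> \<in> probs F"
    by (simp add: transport_def)
qed

lemma Osc1_cong_sets:
  assumes "sets E = sets F"
  shows "Osc1 E = Osc1 F"
  using sets_eq_imp_space_eq[OF assms] measurable_cong_sets[OF assms refl, of borel]
  unfolding Osc1_def osc_def by auto

text \<open>One particle number and one sample space. The constants in the exponential bounds proved
  here depend on neither, so they can be used uniformly in \<open>N\<close> afterwards.\<close>

locale particle_approximation =
  fixes E :: "nat \<Rightarrow> 'a measure"
    and K :: "nat \<Rightarrow> 'a measure \<Rightarrow> 'a \<Rightarrow> 'a measure"
    and \<eta>0 :: "'a measure"
    and N :: nat
    and M :: "'w measure"
    and \<xi> :: "nat \<Rightarrow> nat \<Rightarrow> 'w \<Rightarrow> 'a"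
  assumes init: "\<eta>0 \<in> probs (E 0)"
    and kernels: "\<And>m \<eta>. \<eta> \<in> probs (E m) \<Longrightarrow> K (Suc m) \<eta> \<in> E m \<rightarrow>\<^sub>M prob_algebra (E (Suc m))"
    and meas: "\<And>m i A. i \<in> {1..N} \<Longrightarrow> A \<in> sets (E (Suc m)) \<Longrightarrow>
      (\<lambda>x. measure (K (Suc m) (emp (E m) N x) (x i)) A) \<in> borel_measurable (\<Pi>\<^sub>M j\<in>{1..N}. E m)"
    and N: "N \<ge> 1"
    and particles: "particle_system E K \<eta>0 N M \<xi>"
begin

sublocale prob_space M
  using particles by (simp add: particle_system_def)

abbreviation F :: "nat \<Rightarrow> 'w measure"
  where "F n \<equiv> history E N M \<xi> n"

abbreviation V :: "nat \<Rightarrow> ('a \<Rightarrow> real) \<Rightarrow> 'w \<Rightarrow> real"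
  where "V n f \<equiv> VN E K \<eta>0 N \<xi> n f"

abbreviation W :: "nat \<Rightarrow> ('a \<Rightarrow> real) \<Rightarrow> 'w \<Rightarrow> real"
  where "W n f \<equiv> WN E K \<eta>0 N \<xi> n f"

abbreviation \<eta>N :: "nat \<Rightarrow> 'w \<Rightarrow> 'a measure"
  where "\<eta>N n w \<equiv> emp_process E N \<xi> n w"

text \<open>The law of particle \<open>i\<close> at time \<open>n + 1\<close> given the history up
  to time \<open>n\<close>.\<close>

definition \<kappa> :: "nat \<Rightarrow> nat \<Rightarrow> 'w \<Rightarrow> 'a measure"
  where "\<kappa> n i w = K (Suc n) (\<eta>N n w) (\<xi> n i w)"

lemma \<xi>_measurable: "i \<in> {1..N} \<Longrightarrow> \<xi> n i \<in> M \<rightarrow>\<^sub>M E n"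
  using particles by (auto simp: particle_system_def)

lemma \<xi>_space: "i \<in> {1..N} \<Longrightarrow> w \<in> space M \<Longrightarrow> \<xi> n i w \<in> space (E n)"
  using \<xi>_measurable by (rule measurable_space)

lemma space_history [simp]: "space (F n) = space M"
  unfolding history_def by (intro space_measure_of) auto

lemma sets_history:
  "sets (F n) = sigma_sets (space M) (\<Union>m\<in>{..n}. \<Union>i\<in>{1..N}. {\<xi> m i -` A \<inter> space M | A. A \<in> sets (E m)})"
  unfolding history_def by (intro sets_measure_of) auto

lemma subalgebra_history: "subalgebra M (F n)"
proof -
  have "\<xi> m i -` A \<inter> space M \<in> sets M" if "i \<in> {1..N}" "A \<in> sets (E m)" for m i A
    using measurable_sets[OF \<xi>_measurable[OF that(1)] that(2)] .
  then have "sets (F n) \<subseteq> sets M"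
    unfolding sets_history by (intro sets.sigma_sets_subset) auto
  then show ?thesis
    by (simp add: subalgebra_def)
qed

lemma history_bfun: "X \<in> bfun (F n) \<Longrightarrow> X \<in> bfun M"
  using measurable_from_subalg[OF subalgebra_history] unfolding bfun_def by auto

lemma \<xi>_measurable_history:
  assumes "i \<in> {1..N}" "m \<le> n"
  shows "\<xi> m i \<in> F n \<rightarrow>\<^sub>M E m"
proof (rule measurableI)
  show "\<xi> m i -` A \<inter> space (F n) \<in> sets (F n)" if "A \<in> sets (E m)" for A
    unfolding space_history sets_history using assms that
    by (intro sigma_sets.Basic UN_I[of m] UN_I[of i] CollectI exI[of _ A]) auto
qed (use \<xi>_space[OF assms(1)] in simp)

lemma history_mono:
  assumes "m \<le> n" "X \<in> bfun (F m)"
  shows "X \<in> bfun (F n)"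
proof -
  have "subalgebra (F n) (F m)"
    unfolding subalgebra_def space_history sets_history using assms(1)
    by (intro conjI refl sigma_sets_mono') force
  from measurable_from_subalg[OF this] show ?thesis
    using assms(2) unfolding bfun_def by auto
qed

lemma \<eta>N_probs: "w \<in> space M \<Longrightarrow> \<eta>N n w \<in> probs (E n)"
  unfolding emp_process_def using N \<xi>_space by (intro emp_in_probs)

lemma integral_\<eta>N:
  "w \<in> space M \<Longrightarrow> f \<in> borel_measurable (E n) \<Longrightarrow> (\<integral>x. f x \<partial>\<eta>N n w) = (\<Sum>i=1..N. f (\<xi> n i w)) / real N"
  unfolding emp_process_def using N \<xi>_space by (intro integral_emp)

lemma \<kappa>_probs: "i \<in> {1..N} \<Longrightarrow> w \<in> space M \<Longrightarrow> \<kappa> n i w \<in> probs (E (Suc n))"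
  unfolding \<kappa>_def using measurable_space[OF kernels[OF \<eta>N_probs] \<xi>_space] by blast

text \<open>The product space contains only functions restricted to the index set, whereas the
  particle vector is defined at all indices; the empirical measure does not see the
  difference.\<close>

lemma emp_restrict: "emp F' N (restrict x {1..N}) = emp F' N x"
  unfolding emp_def by (intro distr_cong) (auto simp: space_uniform_count_measure)

text \<open>Measurability in the configuration is composed with the particle vector at time
  \<open>n\<close>. Measurability with respect to the history, not merely \<open>M\<close>, lets
  functions of these kernels serve as weights when conditioning.\<close>

lemma \<kappa>_measurable:
  assumes i: "i \<in> {1..N}"
  shows "\<kappa> n i \<in> F n \<rightarrow>\<^sub>M prob_algebra (E (Suc n))"
proof (rule measurable_prob_algebraI)
  show p: "prob_space (\<kappa> n i w)" if "w \<in> space (F n)" for w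
    using that probs_prob_space[OF \<kappa>_probs[OF i]] by simp
  show "\<kappa> n i \<in> F n \<rightarrow>\<^sub>M subprob_algebra (E (Suc n))"
  proof (rule measurable_subprob_algebra)
    fix A assume A: "A \<in> sets (E (Suc n))"
    have "(\<lambda>w. restrict (\<lambda>j. \<xi> n j w) {1..N}) \<in> F n \<rightarrow>\<^sub>M (\<Pi>\<^sub>M j\<in>{1..N}. E n)"
      by (intro measurable_restrict \<xi>_measurable_history) auto
    from measurable_compose[OF this meas[OF i A]]
    have "(\<lambda>w. measure (\<kappa> n i w) A) \<in> borel_measurable (F n)"
      using i by (simp only: emp_restrict) (simp add: \<kappa>_def emp_process_def)
    then have "(\<lambda>w. ennreal (measure (\<kappa> n i w) A)) \<in> borel_measurable (F n)"
      by simp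
    moreover have "ennreal (measure (\<kappa> n i w) A) = emeasure (\<kappa> n i w) A" if "w \<in> space (F n)" for w
      using prob_space.finite_measure[OF p[OF that]] by (simp add: finite_measure.emeasure_eq_measure)
    ultimately show "(\<lambda>w. emeasure (\<kappa> n i w) A) \<in> borel_measurable (F n)"
      by (rule measurable_cong[THEN iffD1, rotated])
  next
    fix w assume "w \<in> space (F n)"
    then show "subprob_space (\<kappa> n i w)" "sets (\<kappa> n i w) = sets (E (Suc n))"
      using p probs_sets[OF \<kappa>_probs[OF i]] by (auto intro: prob_space_imp_subprob_space)
  qed
qed

lemma \<kappa>_integral_bfun:
  "i \<in> {1..N} \<Longrightarrow> f \<in> bfun (E (Suc n)) \<Longrightarrow> (\<lambda>w. \<integral>y. f y \<partial>\<kappa> n i w) \<in> bfun (F n)"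
  by (rule kernel_integral_bfun[OF \<kappa>_measurable])

lemma \<kappa>_bfun: "i \<in> {1..N} \<Longrightarrow> w \<in> space M \<Longrightarrow> f \<in> bfun (E (Suc n)) \<Longrightarrow> f \<in> bfun (\<kappa> n i w)"
  using probs_bfun[OF \<kappa>_probs] by blast

text \<open>The integrand inside the cumulant depends on \<open>w\<close> through the mean.
  Measurability is therefore obtained after \<open>exp_cumulant\<close> has factored the mean out,
  which leaves integrals of fixed functions against \<open>\<kappa>\<close>.\<close>

lemma \<kappa>_cumulant_bfun:
  assumes i: "i \<in> {1..N}" and f: "f \<in> bfun (E (Suc n))"
  shows "(\<lambda>w. cumulant (\<kappa> n i w) e f) \<in> bfun (F n)"
proof -
  obtain B where B: "\<And>y. y \<in> space (E (Suc n)) \<Longrightarrow> \<bar>f y\<bar> \<le> B"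
    using bfunE[OF f] by metis
  have eq: "cumulant (\<kappa> n i w) e f = ln (exp (- (e * (\<integral>y. f y \<partial>\<kappa> n i w))) * (\<integral>y. exp (e * f y) \<partial>\<kappa> n i w))"
    if "w \<in> space (F n)" for w
    using prob_space.exp_cumulant[OF probs_prob_space[OF \<kappa>_probs[OF i]] \<kappa>_bfun[OF i _ f]] that
    by (metis ln_exp space_history)
  have "(\<lambda>w. ln (exp (- (e * (\<integral>y. f y \<partial>\<kappa> n i w))) * (\<integral>y. exp (e * f y) \<partial>\<kappa> n i w))) \<in> borel_measurable (F n)"
    using \<kappa>_integral_bfun[OF i f] \<kappa>_integral_bfun[OF i bfun_exp[OF bfun_cmult[OF f]], of e]
    by (auto dest!: bfun_measurable)
  then have "(\<lambda>w. cumulant (\<kappa> n i w) e f) \<in> borel_measurable (F n)"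
    by (subst measurable_cong[OF eq])
  moreover have "\<bar>cumulant (\<kappa> n i w) e f\<bar> \<le> \<bar>e\<bar> * (2 * B)" if "w \<in> space (F n)" for w
  proof -
    have p: "\<kappa> n i w \<in> probs (E (Suc n))"
      using \<kappa>_probs[OF i] that by simp
    show ?thesis
      using B \<kappa>_bfun[OF i _ f] that probs_space[OF p]
      by (intro prob_space.abs_cumulant_le probs_prob_space[OF p]) auto
  qed
  ultimately show ?thesis
    by (rule bfunI)
qed

section \<open>Fluctuation fields as normalised sums\<close>

lemma sqrt_mult_divide: "sqrt (real N) * (x / real N) = x / sqrt (real N)"
proof -
  have "sqrt (real N) * (x / real N) = sqrt (real N) * (x / (sqrt (real N) * sqrt (real N)))"
    by simp
  also have "\<dots> = x / sqrt (real N)"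
    using N by (simp del: real_sqrt_mult_self)
  finally show ?thesis .
qed

lemma V_0:
  assumes "f \<in> bfun (E 0)" "w \<in> space M"
  shows "V 0 f w = (\<Sum>i=1..N. f (\<xi> 0 i w) - (\<integral>x. f x \<partial>\<eta>0)) / sqrt (real N)"
proof -
  have "V 0 f w = sqrt (real N) * ((\<Sum>i=1..N. f (\<xi> 0 i w) - (\<integral>x. f x \<partial>\<eta>0)) / real N)"
    using assms N by (simp add: integral_\<eta>N bfun_measurable sum_subtractf diff_divide_distrib)
  then show ?thesis
    by (simp only: sqrt_mult_divide)
qed

text \<open>A normalised sum of increments that are centred given the history, the form in which the
  conditional Laplace transform factorises.\<close>

lemma V_Suc:
  assumes f: "f \<in> bfun (E (Suc n))" and w: "w \<in> space M"
  shows "V (Suc n) f w = (\<Sum>i=1..N. f (\<xi> (Suc n) i w) - (\<integral>y. f y \<partial>\<kappa> n i w)) / sqrt (real N)"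
proof -
  note t = transport_integral[of "K (Suc n)", OF kernels[OF \<eta>N_probs[OF w]] \<eta>N_probs[OF w] f]
  have "(\<integral>x. f x \<partial>transport (K (Suc n)) (\<eta>N n w)) = (\<Sum>i=1..N. (\<integral>y. f y \<partial>\<kappa> n i w)) / real N"
    unfolding t(1) \<kappa>_def by (rule integral_\<eta>N[OF w bfun_measurable[OF t(3)]])
  then have "V (Suc n) f w = sqrt (real N) * ((\<Sum>i=1..N. f (\<xi> (Suc n) i w) - (\<integral>y. f y \<partial>\<kappa> n i w)) / real N)"
    using f w by (simp add: integral_\<eta>N bfun_measurable sum_subtractf diff_divide_distrib)
  then show ?thesis
    by (simp only: sqrt_mult_divide)
qed

lemma \<xi>_bfun:
  assumes "f \<in> bfun (E n)" "i \<in> {1..N}"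
  shows "(\<lambda>w. f (\<xi> n i w)) \<in> bfun (F n)"
  using bfun_compose[OF assms(1) \<xi>_measurable_history[OF assms(2) order_refl]] .

lemma V_bfun:
  assumes f: "f \<in> bfun (E n)"
  shows "V n f \<in> bfun (F n)"
proof (cases n)
  case 0
  have "(\<lambda>w. (\<Sum>i=1..N. f (\<xi> 0 i w) - (\<integral>x. f x \<partial>\<eta>0)) / sqrt (real N)) \<in> bfun (F 0)"
    using f by (intro bfun_divide bfun_sum bfun_diff bfun_const \<xi>_bfun) (auto simp: 0)
  then show ?thesis
    using f unfolding 0 by (subst bfun_cong[OF V_0]) auto
next
  case (Suc m)
  have "(\<lambda>w. (\<Sum>i=1..N. f (\<xi> (Suc m) i w) - (\<integral>y. f y \<partial>\<kappa> m i w)) / sqrt (real N)) \<in> bfun (F (Suc m))"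
    using f history_mono[OF _ \<kappa>_integral_bfun, of m "Suc m"]
    by (intro bfun_divide bfun_sum bfun_diff \<xi>_bfun) (auto simp: Suc)
  then show ?thesis
    using f unfolding Suc by (subst bfun_cong[OF V_Suc]) auto
qed

section \<open>One-step conditional Laplace transforms\<close>

text \<open>The defining property of conditional expectation tested against \<open>Y\<close>, then
  transferred to extended integrals so that the induction that follows may work with arbitrary
  nonnegative functions.\<close>

lemma real_cond_exp_step:
  assumes Y: "Y \<in> bfun (F n)" "\<And>w. w \<in> space M \<Longrightarrow> 0 \<le> Y w"
    and A: "\<And>i. i \<in> {1..N} \<Longrightarrow> A i \<in> sets (E (Suc n))"
  shows "(\<integral>\<^sup>+w. ennreal (Y w) * (\<Prod>i\<in>{1..N}. indicator (A i) (\<xi> (Suc n) i w)) \<partial>M)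
    = (\<integral>\<^sup>+w. ennreal (Y w) * (\<Prod>i\<in>{1..N}. emeasure (\<kappa> n i w) (A i)) \<partial>M)"
proof -
  interpret S: sigma_finite_subalgebra M "F n"
    by (intro finite_measure_subalgebra_is_sigma_finite finite_measure_subalgebra.intro
        finite_measure_subalgebra_axioms.intro subalgebra_history) unfold_locales
  let ?P = "\<lambda>w. \<Prod>i\<in>{1..N}. indicator (A i) (\<xi> (Suc n) i w) :: real"
  let ?Q = "\<lambda>w. \<Prod>i\<in>{1..N}. measure (\<kappa> n i w) (A i)"
  have YM: "Y \<in> bfun M"
    using Y(1) by (rule history_bfun)
  have P: "?P \<in> bfun M"
  proof (intro bfun_prod)
    fix i assume i: "i \<in> {1..N}"
    have "(indicator (A i) :: 'a \<Rightarrow> real) \<in> bfun (E (Suc n))"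
      using A[OF i] by (intro bfunI[where B = 1]) (auto simp: indicator_def)
    from bfun_compose[OF this \<xi>_measurable[OF i]]
    show "(\<lambda>w. indicator (A i) (\<xi> (Suc n) i w) :: real) \<in> bfun M" .
  qed
  have Q: "?Q \<in> bfun M"
  proof (intro bfun_prod bfunI[where B = 1])
    fix i assume i: "i \<in> {1..N}"
    from measurable_compose[OF \<kappa>_measurable[OF i] measurable_measure_prob_algebra[OF A[OF i]]]
    show "(\<lambda>w. measure (\<kappa> n i w) (A i)) \<in> borel_measurable M"
      by (rule measurable_from_subalg[OF subalgebra_history])
    show "\<bar>measure (\<kappa> n i w) (A i)\<bar> \<le> 1" if "w \<in> space M" for w
      using prob_space.prob_le_1[OF probs_prob_space[OF \<kappa>_probs[OF i that]]] by simp
  qed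
  have AE: "AE w in M. real_cond_exp M (F n) ?P w = ?Q w"
    using particles A unfolding particle_system_def \<kappa>_def by blast
  have "(\<integral>w. Y w * ?P w \<partial>M) = (\<integral>w. Y w * real_cond_exp M (F n) ?P w \<partial>M)"
    by (intro S.real_cond_exp_intg(2)[symmetric] integrable_bfun bfun_mult YM P bfun_measurable[OF Y(1)] bfun_measurable[OF P])
  also have "\<dots> = (\<integral>w. Y w * ?Q w \<partial>M)"
    using AE bfun_measurable[OF YM] bfun_measurable[OF Q] by (intro integral_cong_AE) auto
  finally have eq: "(\<integral>w. Y w * ?P w \<partial>M) = (\<integral>w. Y w * ?Q w \<partial>M)" .
  have "(\<integral>\<^sup>+w. ennreal (Y w) * (\<Prod>i\<in>{1..N}. indicator (A i) (\<xi> (Suc n) i w)) \<partial>M)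
      = (\<integral>\<^sup>+w. ennreal (Y w * ?P w) \<partial>M)"
  proof (intro nn_integral_cong)
    fix w assume "w \<in> space M"
    then show "ennreal (Y w) * (\<Prod>i\<in>{1..N}. indicator (A i) (\<xi> (Suc n) i w)) = ennreal (Y w * ?P w)"
      using Y(2) by (simp add: ennreal_mult prod_nonneg prod_ennreal[symmetric] ennreal_indicator)
  qed
  also have "\<dots> = ennreal (\<integral>w. Y w * ?P w \<partial>M)"
    using Y(2) by (intro nn_integral_bfun bfun_mult YM P) (auto intro!: mult_nonneg_nonneg prod_nonneg)
  also have "\<dots> = (\<integral>\<^sup>+w. ennreal (Y w * ?Q w) \<partial>M)"
    unfolding eq using Y(2)
    by (intro nn_integral_bfun[symmetric] bfun_mult YM Q) (auto intro!: mult_nonneg_nonneg prod_nonneg)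
  also have "\<dots> = (\<integral>\<^sup>+w. ennreal (Y w) * (\<Prod>i\<in>{1..N}. emeasure (\<kappa> n i w) (A i)) \<partial>M)"
  proof (intro nn_integral_cong)
    fix w assume w: "w \<in> space M"
    have "(\<Prod>i\<in>{1..N}. emeasure (\<kappa> n i w) (A i)) = (\<Prod>i\<in>{1..N}. ennreal (measure (\<kappa> n i w) (A i)))"
      using prob_space.finite_measure[OF probs_prob_space[OF \<kappa>_probs[OF _ w]]]
      by (intro prod.cong refl) (simp add: finite_measure.emeasure_eq_measure)
    then show "ennreal (Y w * ?Q w) = ennreal (Y w) * (\<Prod>i\<in>{1..N}. emeasure (\<kappa> n i w) (A i))"
      using Y(2)[OF w] by (simp add: ennreal_mult prod_nonneg prod_ennreal)
  qed
  finally show ?thesis .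
qed

text \<open>The indicators are replaced by general functions one particle at a time.\<close>

lemma nn_integral_step_aux:
  assumes Y: "Y \<in> bfun (F n)" "\<And>w. w \<in> space M \<Longrightarrow> 0 \<le> Y w"
    and J: "finite J" "J \<subseteq> {1..N}"
    and g: "\<And>i. i \<in> {1..N} \<Longrightarrow> g i \<in> borel_measurable (E (Suc n))"
      "\<And>i. i \<in> {1..N} - J \<Longrightarrow> \<exists>A\<in>sets (E (Suc n)). g i = indicator A"
  shows "(\<integral>\<^sup>+w. ennreal (Y w) * (\<Prod>i\<in>{1..N}. g i (\<xi> (Suc n) i w)) \<partial>M)
    = (\<integral>\<^sup>+w. ennreal (Y w) * (\<Prod>i\<in>{1..N}. \<integral>\<^sup>+y. g i y \<partial>\<kappa> n i w) \<partial>M)"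
  using J g
proof (induction J arbitrary: g rule: finite_induct)
  \<comment> \<open>\<open>J\<close> lists the indices that may carry general functions; with
    \<open>J\<close> empty all factors are indicators and the Markov property applies.\<close>
  case empty
  then obtain A where A: "\<And>i. i \<in> {1..N} \<Longrightarrow> A i \<in> sets (E (Suc n)) \<and> g i = indicator (A i)"
    by (metis Diff_empty)
  have "(\<integral>\<^sup>+y. g i y \<partial>\<kappa> n i w) = emeasure (\<kappa> n i w) (A i)" if "i \<in> {1..N}" "w \<in> space M" for i w
    using A[OF that(1)] probs_sets[OF \<kappa>_probs[OF that]] by simp
  then have "(\<integral>\<^sup>+w. ennreal (Y w) * (\<Prod>i\<in>{1..N}. \<integral>\<^sup>+y. g i y \<partial>\<kappa> n i w) \<partial>M)
      = (\<integral>\<^sup>+w. ennreal (Y w) * (\<Prod>i\<in>{1..N}. emeasure (\<kappa> n i w) (A i)) \<partial>M)"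
    by (intro nn_integral_cong arg_cong2[where f = "(*)"] prod.cong refl)
  also have "\<dots> = (\<integral>\<^sup>+w. ennreal (Y w) * (\<Prod>i\<in>{1..N}. indicator (A i) (\<xi> (Suc n) i w)) \<partial>M)"
    using A by (intro real_cond_exp_step[OF Y, symmetric]) (simp_all only:)
  also have "\<dots> = (\<integral>\<^sup>+w. ennreal (Y w) * (\<Prod>i\<in>{1..N}. g i (\<xi> (Suc n) i w)) \<partial>M)"
    using A by (intro nn_integral_cong arg_cong2[where f = "(*)"] prod.cong refl) metis
  finally show ?case
    by (rule sym)
next
  case (insert k J)
  let ?R = "{1..N} - {k}"
  have k: "k \<in> {1..N}"
    using insert.prems by auto
  have gm: "(\<lambda>w. g i (\<xi> (Suc n) i w)) \<in> borel_measurable M" if "i \<in> {1..N}" for i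
    using measurable_compose[OF \<xi>_measurable[OF that] insert.prems(2)[OF that]] .
  have km: "(\<lambda>w. \<integral>\<^sup>+y. g i y \<partial>\<kappa> n i w) \<in> borel_measurable M" if "i \<in> {1..N}" for i
    using measurable_from_subalg[OF subalgebra_history measurable_compose[OF measurable_prob_algebraD[OF \<kappa>_measurable[OF that]]
      nn_integral_measurable_subprob_algebra[OF insert.prems(2)[OF that]]]] .
  have Ym: "(\<lambda>w. ennreal (Y w)) \<in> borel_measurable M"
    using bfun_measurable[OF history_bfun[OF Y(1)]] by simp
  \<comment> \<open>\<open>H\<close> still contains the other particles at time \<open>n + 1\<close>
    and is in general not measurable with respect to the history; this is why
    \<open>kernel_nn_integral_eqI\<close> admits different weights on its two sides.\<close>
  define H where "H w = ennreal (Y w) * (\<Prod>i\<in>?R. g i (\<xi> (Suc n) i w))" for w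
  define H' where "H' w = ennreal (Y w) * (\<Prod>i\<in>?R. \<integral>\<^sup>+y. g i y \<partial>\<kappa> n i w)" for w
  have split: "(\<Prod>i\<in>{1..N}. a i) = (\<Prod>i\<in>?R. a i) * a k" for a :: "nat \<Rightarrow> ennreal"
    using prod.remove[OF _ k, of a] by (simp add: mult.commute)
  have "(\<integral>\<^sup>+w. H w * g k (\<xi> (Suc n) k w) \<partial>M) = (\<integral>\<^sup>+w. H' w * (\<integral>\<^sup>+y. g k y \<partial>\<kappa> n k w) \<partial>M)"
  proof (rule kernel_nn_integral_eqI)
    show "H \<in> borel_measurable M"
      unfolding H_def by (intro borel_measurable_times_ennreal Ym borel_measurable_prod_ennreal gm) auto
    show "H' \<in> borel_measurable M"
      unfolding H'_def by (intro borel_measurable_times_ennreal Ym borel_measurable_prod_ennreal km) auto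
    show "\<xi> (Suc n) k \<in> M \<rightarrow>\<^sub>M E (Suc n)" "g k \<in> borel_measurable (E (Suc n))"
      using k \<xi>_measurable insert.prems by auto
    show "\<kappa> n k \<in> M \<rightarrow>\<^sub>M subprob_algebra (E (Suc n))"
      using measurable_from_subalg[OF subalgebra_history measurable_prob_algebraD[OF \<kappa>_measurable[OF k]]] .
    show "space M \<noteq> {}"
      by (rule not_empty)
    fix A assume A: "A \<in> sets (E (Suc n))"
    \<comment> \<open>With an indicator at \<open>k\<close> the general functions sit in
      \<open>J\<close> alone, so the induction hypothesis supplies the agreement on sets.\<close>
    define g' where "g' = g(k := indicator A)"
    have "(\<integral>\<^sup>+w. ennreal (Y w) * (\<Prod>i\<in>{1..N}. g' i (\<xi> (Suc n) i w)) \<partial>M)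
        = (\<integral>\<^sup>+w. ennreal (Y w) * (\<Prod>i\<in>{1..N}. \<integral>\<^sup>+y. g' i y \<partial>\<kappa> n i w) \<partial>M)"
      using insert.prems A by (intro insert.IH) (auto simp: g'_def)
    moreover have "ennreal (Y w) * (\<Prod>i\<in>{1..N}. g' i (\<xi> (Suc n) i w)) = H w * indicator A (\<xi> (Suc n) k w)" for w
    proof -
      have "(\<Prod>i\<in>?R. g' i (\<xi> (Suc n) i w)) = (\<Prod>i\<in>?R. g i (\<xi> (Suc n) i w))"
        by (intro prod.cong) (auto simp: g'_def)
      then show ?thesis
        unfolding split H_def by (simp add: g'_def mult.assoc)
    qed
    moreover have "ennreal (Y w) * (\<Prod>i\<in>{1..N}. \<integral>\<^sup>+y. g' i y \<partial>\<kappa> n i w) = H' w * emeasure (\<kappa> n k w) A"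
      if "w \<in> space M" for w
    proof -
      have "(\<Prod>i\<in>?R. \<integral>\<^sup>+y. g' i y \<partial>\<kappa> n i w) = (\<Prod>i\<in>?R. \<integral>\<^sup>+y. g i y \<partial>\<kappa> n i w)"
        by (intro prod.cong) (auto simp: g'_def)
      then show ?thesis
        unfolding split H'_def using A probs_sets[OF \<kappa>_probs[OF k that]] by (simp add: g'_def mult.assoc)
    qed
    ultimately show "(\<integral>\<^sup>+w. H w * indicator A (\<xi> (Suc n) k w) \<partial>M) = (\<integral>\<^sup>+w. H' w * emeasure (\<kappa> n k w) A \<partial>M)"
      by (simp cong: nn_integral_cong)
  qed
  then show ?case
    unfolding split H_def H'_def by (simp add: mult.assoc)
qed

lemma integral_step:
  assumes Y: "Y \<in> bfun (F n)" "\<And>w. w \<in> space M \<Longrightarrow> 0 \<le> Y w"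
    and g: "g \<in> bfun (E (Suc n))" "\<And>y. 0 \<le> g y"
  shows "(\<integral>w. Y w * (\<Prod>i=1..N. g (\<xi> (Suc n) i w)) \<partial>M) = (\<integral>w. Y w * (\<Prod>i=1..N. \<integral>y. g y \<partial>\<kappa> n i w) \<partial>M)"
    (is "?L = ?R")
proof -
  have YM: "Y \<in> bfun M"
    using Y(1) by (rule history_bfun)
  have b: "(\<lambda>w. Y w * (\<Prod>i=1..N. g (\<xi> (Suc n) i w))) \<in> bfun M"
    by (intro bfun_mult YM bfun_prod history_bfun[OF \<xi>_bfun[OF g(1)]])
  have b': "(\<lambda>w. Y w * (\<Prod>i=1..N. \<integral>y. g y \<partial>\<kappa> n i w)) \<in> bfun M"
    by (intro bfun_mult YM bfun_prod history_bfun[OF \<kappa>_integral_bfun] g(1))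
  have nn: "0 \<le> (\<Prod>i=1..N. g (\<xi> (Suc n) i w))" "0 \<le> (\<Prod>i=1..N. \<integral>y. g y \<partial>\<kappa> n i w)" for w
    using g(2) by (auto intro!: prod_nonneg integral_nonneg_AE)
  have "ennreal ?L = (\<integral>\<^sup>+w. ennreal (Y w * (\<Prod>i=1..N. g (\<xi> (Suc n) i w))) \<partial>M)"
    using Y(2) nn by (intro nn_integral_bfun[symmetric] b) auto
  also have "\<dots> = (\<integral>\<^sup>+w. ennreal (Y w) * (\<Prod>i\<in>{1..N}. ennreal (g (\<xi> (Suc n) i w))) \<partial>M)"
    using Y(2) nn g(2) by (intro nn_integral_cong) (simp add: ennreal_mult prod_ennreal)
  also have "\<dots> = (\<integral>\<^sup>+w. ennreal (Y w) * (\<Prod>i\<in>{1..N}. \<integral>\<^sup>+y. ennreal (g y) \<partial>\<kappa> n i w) \<partial>M)"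
    using bfun_measurable[OF g(1)] by (intro nn_integral_step_aux[OF Y, of "{1..N}"]) auto
  also have "\<dots> = (\<integral>\<^sup>+w. ennreal (Y w * (\<Prod>i=1..N. \<integral>y. g y \<partial>\<kappa> n i w)) \<partial>M)"
  proof (intro nn_integral_cong)
    fix w assume w: "w \<in> space M"
    have "(\<integral>\<^sup>+y. ennreal (g y) \<partial>\<kappa> n i w) = ennreal (\<integral>y. g y \<partial>\<kappa> n i w)" if i: "i \<in> {1..N}" for i
      using g(2) by (intro finite_measure.nn_integral_bfun \<kappa>_bfun i w g(1)
          prob_space.finite_measure probs_prob_space[OF \<kappa>_probs[OF i w]])
    then show "ennreal (Y w) * (\<Prod>i\<in>{1..N}. \<integral>\<^sup>+y. ennreal (g y) \<partial>\<kappa> n i w)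
        = ennreal (Y w * (\<Prod>i=1..N. \<integral>y. g y \<partial>\<kappa> n i w))"
      using Y(2)[OF w] nn(2) g(2) by (simp add: ennreal_mult prod_ennreal integral_nonneg_AE)
  qed
  also have "\<dots> = ennreal ?R"
    using Y(2) nn by (intro nn_integral_bfun b') auto
  finally show ?thesis
    using Y(2) nn by (subst (asm) ennreal_inj) (auto intro!: integral_nonneg_AE)
qed

lemma log_mgf_V_Suc:
  assumes Z: "Z \<in> bfun (F n)" and f: "f \<in> bfun (E (Suc n))"
  shows "log_mgf M (\<lambda>w. Z w + l * V (Suc n) f w)
    = log_mgf M (\<lambda>w. Z w + (\<Sum>i=1..N. cumulant (\<kappa> n i w) (l / sqrt (real N)) f))"
proof -
  define e where "e = l / sqrt (real N)"
  \<comment> \<open>\<open>Y\<close> collects everything known at time \<open>n\<close>: the factor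
    \<open>exp (Z w)\<close> and the centring terms. What remains is a product of one positive
    function evaluated at all new particles.\<close>
  define Y where "Y w = exp (Z w) * (\<Prod>i=1..N. exp (- (e * (\<integral>y. f y \<partial>\<kappa> n i w))))" for w
  have Y: "Y \<in> bfun (F n)" "\<And>w. 0 \<le> Y w"
    unfolding Y_def by (intro bfun_mult bfun_exp Z bfun_prod bfun_uminus bfun_cmult \<kappa>_integral_bfun f, assumption)
      (auto intro!: mult_nonneg_nonneg prod_nonneg)
  have "(\<integral>w. exp (Z w + l * V (Suc n) f w) \<partial>M) = (\<integral>w. Y w * (\<Prod>i=1..N. exp (e * f (\<xi> (Suc n) i w))) \<partial>M)"
  proof (rule Bochner_Integration.integral_cong[OF refl])
    fix w assume w: "w \<in> space M"
    have "l * V (Suc n) f w = (\<Sum>i=1..N. - (e * (\<integral>y. f y \<partial>\<kappa> n i w))) + (\<Sum>i=1..N. e * f (\<xi> (Suc n) i w))"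
      unfolding V_Suc[OF f w] e_def sum.distrib[symmetric] by (simp add: sum_distrib_left sum_divide_distrib algebra_simps diff_divide_distrib)
    then show "exp (Z w + l * V (Suc n) f w) = Y w * (\<Prod>i=1..N. exp (e * f (\<xi> (Suc n) i w)))"
      unfolding Y_def by (simp add: exp_add exp_sum)
  qed
  also have "\<dots> = (\<integral>w. Y w * (\<Prod>i=1..N. \<integral>y. exp (e * f y) \<partial>\<kappa> n i w) \<partial>M)"
    by (intro integral_step Y bfun_exp bfun_cmult f) auto
  also have "\<dots> = (\<integral>w. exp (Z w + (\<Sum>i=1..N. cumulant (\<kappa> n i w) e f)) \<partial>M)"
  proof (rule Bochner_Integration.integral_cong[OF refl])
    fix w assume w: "w \<in> space M"
    have "exp (cumulant (\<kappa> n i w) e f) = exp (- (e * (\<integral>y. f y \<partial>\<kappa> n i w))) * (\<integral>y. exp (e * f y) \<partial>\<kappa> n i w)"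
      if i: "i \<in> {1..N}" for i
      using prob_space.exp_cumulant[OF probs_prob_space[OF \<kappa>_probs[OF i w]] \<kappa>_bfun[OF i w f]] .
    then show "Y w * (\<Prod>i=1..N. \<integral>y. exp (e * f y) \<partial>\<kappa> n i w) = exp (Z w + (\<Sum>i=1..N. cumulant (\<kappa> n i w) e f))"
      unfolding Y_def by (simp add: exp_add exp_sum prod.distrib mult.assoc)
  qed
  finally show ?thesis
    by (simp add: log_mgf_def e_def)
qed

lemma log_mgf_V_0:
  assumes f: "f \<in> bfun (E 0)"
  shows "log_mgf M (\<lambda>w. l * V 0 f w) = real N * cumulant \<eta>0 (l / sqrt (real N)) f"
proof -
  interpret \<eta>0: prob_space \<eta>0
    using init by (rule probs_prob_space)
  define e where "e = l / sqrt (real N)"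
  define g where "g x = exp (e * (f x - (\<integral>x. f x \<partial>\<eta>0)))" for x
  have g: "g \<in> bfun (E 0)"
    unfolding g_def by (intro bfun_exp bfun_cmult bfun_diff bfun_const f)
  have indep: "indep_vars (\<lambda>_. E 0) (\<xi> 0) {1..N}"
    using particles by (simp add: particle_system_def)
  have "(\<integral>w. exp (l * V 0 f w) \<partial>M) = (\<integral>w. (\<Prod>i\<in>{1..N}. g (\<xi> 0 i w)) \<partial>M)"
  proof (rule Bochner_Integration.integral_cong[OF refl])
    fix w assume w: "w \<in> space M"
    have "l * V 0 f w = (\<Sum>i=1..N. e * (f (\<xi> 0 i w) - (\<integral>x. f x \<partial>\<eta>0)))"
      unfolding V_0[OF f w] e_def by (simp add: sum_distrib_left sum_divide_distrib)
    then show "exp (l * V 0 f w) = (\<Prod>i\<in>{1..N}. g (\<xi> 0 i w))"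
      by (simp add: g_def exp_sum)
  qed
  also have "\<dots> = (\<Prod>i\<in>{1..N}. \<integral>w. g (\<xi> 0 i w) \<partial>M)"
    using bfun_measurable[OF g]
    by (intro indep_vars_lebesgue_integral indep_vars_compose2[OF indep] integrable_bfun history_bfun[OF \<xi>_bfun[OF g]]) auto
  also have "\<dots> = (\<Prod>i\<in>{1..N}. exp (cumulant \<eta>0 e f))"
  proof (intro prod.cong refl)
    fix i assume i: "i \<in> {1..N}"
    have "(\<integral>w. g (\<xi> 0 i w) \<partial>M) = (\<integral>x. g x \<partial>distr M (E 0) (\<xi> 0 i))"
      using \<xi>_measurable[OF i] bfun_measurable[OF g] by (intro integral_distr[symmetric])
    also have "distr M (E 0) (\<xi> 0 i) = \<eta>0"
      using particles i by (simp add: particle_system_def)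
    also have "(\<integral>x. g x \<partial>\<eta>0) = exp (cumulant \<eta>0 e f)"
      unfolding cumulant_def g_def using f probs_bfun[OF init]
      by (intro \<eta>0.exp_log_mgf[symmetric] bfun_cmult bfun_diff bfun_const) auto
    finally show "(\<integral>w. g (\<xi> 0 i w) \<partial>M) = exp (cumulant \<eta>0 e f)" .
  qed
  also have "\<dots> = exp (real N * cumulant \<eta>0 e f)"
    by (simp add: exp_of_nat_mult)
  finally show ?thesis
    by (simp add: log_mgf_def e_def)
qed

text \<open>Each of the \<open>N\<close> cumulants at \<open>l / sqrt N\<close> is at most
  \<open>l\<^sup>2 / 2\<close> divided by \<open>N\<close>, whatever the law it is taken under, so
  the sum is bounded independently of \<open>N\<close>, \<open>n\<close> and the history.\<close>

lemma log_mgf_V_le: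
  assumes f: "f \<in> Osc1 (E n)"
  shows "log_mgf M (\<lambda>w. l * V n f w) \<le> l\<^sup>2 / 2"
proof -
  have c: "cumulant \<kappa> (l / sqrt (real N)) f \<le> l\<^sup>2 / 2 / real N" if "\<kappa> \<in> probs (E n)" for \<kappa>
  proof -
    have "f \<in> Osc1 \<kappa>"
      using f Osc1_cong_sets[OF probs_sets[OF that]] by blast
    from prob_space.log_mgf_centered_le[OF probs_prob_space[OF that] this, of "l / sqrt (real N)"]
    show ?thesis
      by (simp add: cumulant_def power_divide)
  qed
  show ?thesis
  proof (cases n)
    case 0
    have "real N * cumulant \<eta>0 (l / sqrt (real N)) f \<le> l\<^sup>2 / 2"
      using c[of \<eta>0] init N by (simp add: 0 field_simps)
    then show ?thesis
      using log_mgf_V_0[of f l] Osc1_bfun[OF f] by (simp add: 0)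
  next
    case (Suc m)
    note f' = Osc1_bfun[OF f, unfolded Suc]
    have "log_mgf M (\<lambda>w. l * V n f w) = log_mgf M (\<lambda>w. \<Sum>i=1..N. cumulant (\<kappa> m i w) (l / sqrt (real N)) f)"
      using log_mgf_V_Suc[OF bfun_const[of 0] f'] by (simp add: Suc)
    also have "\<dots> \<le> log_mgf M (\<lambda>_. \<Sum>i=1..N. l\<^sup>2 / 2 / real N)"
      using c \<kappa>_probs unfolding Suc
      by (intro log_mgf_mono bfun_sum bfun_const sum_mono history_bfun[OF \<kappa>_cumulant_bfun] f') auto
    also have "\<dots> = l\<^sup>2 / 2"
      using N by (simp add: log_mgf_const)
    finally show ?thesis .
  qed
qed

lemma exp_V_square_le:
  assumes f: "f \<in> Osc1 (E n)"
  shows "(\<integral>\<^sup>+w. ennreal (exp (1/8 * (V n f w)\<^sup>2)) \<partial>M) \<le> ennreal gauss_square_const"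
  by (rule exp_square_le[OF history_bfun[OF V_bfun[OF Osc1_bfun[OF f]]] log_mgf_V_le[OF f]])

lemma flow_probs: "flow \<eta>0 K n \<in> probs (E n)"
  by (induction n) (use init kernels transport_integral(2)[OF kernels _ bfun_const] in auto)

lemma W_bfun:
  assumes f: "f \<in> bfun (E n)"
  shows "W n f \<in> bfun (F n)"
proof -
  have "(\<lambda>w. sqrt (real N) * ((\<Sum>i=1..N. f (\<xi> n i w)) / real N - (\<integral>x. f x \<partial>flow \<eta>0 K n))) \<in> bfun (F n)"
    by (intro bfun_cmult bfun_diff bfun_divide bfun_sum bfun_const \<xi>_bfun f)
  then show ?thesis
    using bfun_measurable[OF f] by (subst bfun_cong) (auto simp: WN_def integral_\<eta>N)
qed

text \<open>Joint measurability in the sample point and the parameter is what Fubini needs for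
  mixtures. The bound grows with \<open>N\<close>, which is harmless because it only serves
  integrability for fixed \<open>N\<close>.\<close>

lemma W_family_bfun:
  assumes "osc_family (E n) \<delta> m h"
  shows "(\<lambda>(w, c). W n (h c) w) \<in> bfun (M \<Otimes>\<^sub>M m)"
proof (rule bfunI[where B = "sqrt (real N)"])
  have h: "(\<lambda>(x, c). h c x) \<in> borel_measurable (E n \<Otimes>\<^sub>M m)" and Osc: "\<And>c. c \<in> space m \<Longrightarrow> h c \<in> Osc1 (E n)"
    using assms by (auto simp: osc_family_def)
  have 1: "(\<lambda>p. h (snd p) (\<xi> n i (fst p))) \<in> borel_measurable (M \<Otimes>\<^sub>M m)" if "i \<in> {1..N}" for i
    using measurable_compose[OF measurable_Pair[OF measurable_compose[OF measurable_fst \<xi>_measurable[OF that]] measurable_snd] h]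
    by simp
  have 2: "(\<lambda>p. \<integral>x. h (snd p) x \<partial>flow \<eta>0 K n) \<in> borel_measurable (M \<Otimes>\<^sub>M m)"
    using measurable_compose[OF measurable_snd integral_parametric_measurable[OF h flow_probs]] .
  have "(\<lambda>p. sqrt (real N) * ((\<Sum>i=1..N. h (snd p) (\<xi> n i (fst p))) / real N - (\<integral>x. h (snd p) x \<partial>flow \<eta>0 K n)))
      \<in> borel_measurable (M \<Otimes>\<^sub>M m)"
    by (intro borel_measurable_times borel_measurable_diff borel_measurable_divide borel_measurable_const
        borel_measurable_sum 1 2)
  moreover have "W n (h (snd p)) (fst p)
      = sqrt (real N) * ((\<Sum>i=1..N. h (snd p) (\<xi> n i (fst p))) / real N - (\<integral>x. h (snd p) x \<partial>flow \<eta>0 K n))"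
    if "p \<in> space (M \<Otimes>\<^sub>M m)" for p
    using that bfun_measurable[OF Osc1_bfun[OF Osc]] by (auto simp: WN_def integral_\<eta>N space_pair_measure)
  ultimately show "(\<lambda>(w, c). W n (h c) w) \<in> borel_measurable (M \<Otimes>\<^sub>M m)"
    by (simp add: case_prod_beta' cong: measurable_cong)
  show "\<bar>case p of (w, c) \<Rightarrow> W n (h c) w\<bar> \<le> sqrt (real N)" if p: "p \<in> space (M \<Otimes>\<^sub>M m)" for p
  proof -
    obtain w c where c: "p = (w, c)" "w \<in> space M" "c \<in> space m"
      using p by (auto simp: space_pair_measure)
    have "\<bar>mean_diff (\<eta>N n w) (flow \<eta>0 K n) (h c)\<bar> \<le> 1"
      using Osc[OF c(3)] \<eta>N_probs[OF c(2)] flow_probs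
      by (intro integral_diff_le_osc Osc1_bfun) (auto simp: Osc1_def)
    then show ?thesis
      using mult_left_mono[of _ 1 "sqrt (real N)"] by (simp add: c WN_def abs_mult)
  qed
qed

text \<open>An exact identity for any \<open>D\<close>: the sampling error at time
  \<open>n + 1\<close>, then the first-order expansion of the transport map. The expansion is taken
  at the deterministic flow, so that \<open>D\<close> yields a nonrandom test function.\<close>

lemma W_Suc:
  assumes f: "f \<in> bfun (E (Suc n))"
  shows "W (Suc n) f w = V (Suc n) f w + W n (D (flow \<eta>0 K n) f) w
    + sqrt (real N) * remainder (transport (K (Suc n))) D (\<eta>N n w) (flow \<eta>0 K n) f"
  by (simp add: WN_def remainder_def algebra_simps)

end

lemma bfun_integral_mixture:
  fixes Z :: "'w \<Rightarrow> 'c \<Rightarrow> real"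
  assumes m: "finite_measure m" and Z: "(\<lambda>(w, c). Z w c) \<in> bfun (M \<Otimes>\<^sub>M m)"
  shows "(\<lambda>w. \<integral>c. Z w c \<partial>m) \<in> bfun M"
    and "w \<in> space M \<Longrightarrow> Z w \<in> bfun m"
proof -
  interpret finite_measure m by fact
  obtain B where B: "B > 0" "\<And>p. p \<in> space (M \<Otimes>\<^sub>M m) \<Longrightarrow> \<bar>case p of (w, c) \<Rightarrow> Z w c\<bar> \<le> B"
    using bfunE[OF Z] by metis
  have sec: "Z w \<in> bfun m" if "w \<in> space M" for w
    using bfun_compose[OF Z, of "Pair w" m] that by simp
  then show "w \<in> space M \<Longrightarrow> Z w \<in> bfun m" .
  show "(\<lambda>w. \<integral>c. Z w c \<partial>m) \<in> bfun M"
  proof (rule bfunI)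
    show "(\<lambda>w. \<integral>c. Z w c \<partial>m) \<in> borel_measurable M"
      by (rule borel_measurable_lebesgue_integral[OF bfun_measurable[OF Z]])
    fix w assume w: "w \<in> space M"
    have "\<bar>\<integral>c. Z w c \<partial>m\<bar> \<le> (\<integral>c. \<bar>Z w c\<bar> \<partial>m)"
      by simp
    also have "\<dots> \<le> (\<integral>c. B \<partial>m)"
      using B(2)[of "(w, _)"] w sec[OF w]
      by (intro integral_mono integrable_bfun bfun_abs bfun_const) (auto simp: space_pair_measure)
    finally show "\<bar>\<integral>c. Z w c \<partial>m\<bar> \<le> measure m (space m) * B"
      by simp
  qed
qed

text \<open>Cauchy-Schwarz, read off from the nonnegativity of the integral of the square of
  \<open>\<bar>Z c\<bar> - t\<close> with \<open>t = s / \<delta>\<close>; the total mass enters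
  only through its bound \<open>\<delta>\<close>.\<close>

lemma square_integral_abs_le:
  assumes m: "finite_measure m" and \<delta>: "measure m (space m) \<le> \<delta>" "0 < \<delta>" and Z: "Z \<in> bfun m"
  shows "(\<integral>c. \<bar>Z c\<bar> \<partial>m)\<^sup>2 \<le> \<delta> * (\<integral>c. (Z c)\<^sup>2 \<partial>m)"
proof -
  interpret finite_measure m by fact
  define s where "s = (\<integral>c. \<bar>Z c\<bar> \<partial>m)"
  define t where "t = s / \<delta>"
  have int: "integrable m (\<lambda>c. \<bar>Z c\<bar>)" "integrable m (\<lambda>c. (Z c)\<^sup>2)"
    using Z by (auto intro: integrable_bfun)
  have "0 \<le> (\<integral>c. (\<bar>Z c\<bar> - t)\<^sup>2 \<partial>m)"
    by simp
  also have "\<dots> = (\<integral>c. (Z c)\<^sup>2 - 2 * t * \<bar>Z c\<bar> + t\<^sup>2 \<partial>m)"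
    by (simp add: power2_diff algebra_simps)
  also have "\<dots> = (\<integral>c. (Z c)\<^sup>2 \<partial>m) - 2 * t * s + measure m (space m) * t\<^sup>2"
    using int by (simp add: s_def)
  also have "measure m (space m) * t\<^sup>2 \<le> \<delta> * t\<^sup>2"
    using \<delta>(1) by (intro mult_right_mono) auto
  also have "\<delta> * t\<^sup>2 = t * s"
    using \<delta>(2) by (simp add: t_def power2_eq_square)
  finally have "t * s \<le> (\<integral>c. (Z c)\<^sup>2 \<partial>m)"
    by (simp add: mult.commute)
  then have "\<delta> * (t * s) \<le> \<delta> * (\<integral>c. (Z c)\<^sup>2 \<partial>m)"
    using \<delta>(2) by (intro mult_left_mono) auto
  then show ?thesis
    using \<delta>(2) by (simp add: t_def s_def power2_eq_square mult.commute)
qed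

lemma abs_mult_le_sum_squares: "\<bar>a * b\<bar> \<le> a\<^sup>2 + b\<^sup>2" for a b :: real
proof -
  have "2 * \<bar>a\<bar> * \<bar>b\<bar> \<le> \<bar>a\<bar>\<^sup>2 + \<bar>b\<bar>\<^sup>2" "0 \<le> \<bar>a\<bar> * \<bar>b\<bar>"
    by (rule sum_squares_bound) simp
  then show ?thesis
    unfolding abs_mult power2_abs by linarith
qed

lemma square_sum3_le: "(a + b + c)\<^sup>2 \<le> 3 * (a\<^sup>2 + b\<^sup>2 + c\<^sup>2)" for a b c :: real
proof -
  have "3 * (a\<^sup>2 + b\<^sup>2 + c\<^sup>2) - (a + b + c)\<^sup>2 = (a - b)\<^sup>2 + (b - c)\<^sup>2 + (a - c)\<^sup>2"
    by (simp add: power2_eq_square algebra_simps)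
  then show ?thesis
    by (smt (verit) zero_le_power2)
qed

lemma bfun_normalize:
  assumes "f \<in> bfun E"
  obtains s where "s > 0" "(\<lambda>x. f x / s) \<in> Osc1 E"
proof
  \<comment> \<open>The summand 1 makes the divisor positive also for constant
    \<open>f\<close>.\<close>
  have "osc E f \<le> ennreal (enn2real (osc E f) + 1)"
    using osc_finite[OF assms] by (simp add: ennreal_plus flip: ennreal_1)
  then show "(\<lambda>x. f x / (enn2real (osc E f) + 1)) \<in> Osc1 E"
    using assms by (intro divide_Osc1) (auto dest: bfun_measurable)
qed (simp add: add_nonneg_pos)

section \<open>Uniform estimates in the number of particles\<close>

locale particle_approximations =
  fixes E :: "nat \<Rightarrow> 'a measure"
    and K :: "nat \<Rightarrow> 'a measure \<Rightarrow> 'a \<Rightarrow> 'a measure"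
    and \<eta>0 :: "'a measure"
    and D :: "nat \<Rightarrow> 'a measure \<Rightarrow> ('a \<Rightarrow> real) \<Rightarrow> 'a \<Rightarrow> real"
    and \<Omega> :: "nat \<Rightarrow> 'w measure"
    and \<xi> :: "nat \<Rightarrow> nat \<Rightarrow> nat \<Rightarrow> 'w \<Rightarrow> 'a"
  assumes approx: "\<And>N. N \<ge> 1 \<Longrightarrow> particle_approximation E K \<eta>0 N (\<Omega> N) (\<xi> N)"
    and H1_K: "\<And>m. condition_K (E m) (E (Suc m)) (K (Suc m))"
    and H1_Upsilon: "\<And>m. class_Upsilon (E m) (E (Suc m)) (transport (K (Suc m))) (D (Suc m))"
begin

abbreviation \<eta> :: "nat \<Rightarrow> 'a measure"
  where "\<eta> n \<equiv> flow \<eta>0 K n"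

abbreviation \<eta>N :: "nat \<Rightarrow> nat \<Rightarrow> 'w \<Rightarrow> 'a measure"
  where "\<eta>N N n w \<equiv> emp_process E N (\<xi> N) n w"

abbreviation V :: "nat \<Rightarrow> nat \<Rightarrow> ('a \<Rightarrow> real) \<Rightarrow> 'w \<Rightarrow> real"
  where "V N n f \<equiv> VN E K \<eta>0 N (\<xi> N) n f"

abbreviation W :: "nat \<Rightarrow> nat \<Rightarrow> ('a \<Rightarrow> real) \<Rightarrow> 'w \<Rightarrow> real"
  where "W N n f \<equiv> WN E K \<eta>0 N (\<xi> N) n f"

abbreviation rem :: "nat \<Rightarrow> ('a \<Rightarrow> real) \<Rightarrow> nat \<Rightarrow> 'w \<Rightarrow> real"
  where "rem n f N w \<equiv> remainder (transport (K (Suc n))) (D (Suc n)) (\<eta>N N n w) (\<eta> n) f"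

lemma prob_space_\<Omega>: "N \<ge> 1 \<Longrightarrow> prob_space (\<Omega> N)"
  using particle_approximation.particles[OF approx] by (simp add: particle_system_def)

lemma \<eta>_probs: "\<eta> n \<in> probs (E n)"
  using particle_approximation.flow_probs[OF approx[OF order_refl]] .

lemma V_bfun_\<Omega>: "N \<ge> 1 \<Longrightarrow> f \<in> bfun (E n) \<Longrightarrow> V N n f \<in> bfun (\<Omega> N)"
  using particle_approximation.history_bfun[OF approx particle_approximation.V_bfun[OF approx]] .

lemma W_bfun_\<Omega>: "N \<ge> 1 \<Longrightarrow> f \<in> bfun (E n) \<Longrightarrow> W N n f \<in> bfun (\<Omega> N)"
  using particle_approximation.history_bfun[OF approx particle_approximation.W_bfun[OF approx]] .

lemma V_cmult: "V N n (\<lambda>x. s * f x) w = s * V N n f w"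
  by (cases n) (simp_all add: algebra_simps)

lemma W_divide: "W N n (\<lambda>x. f x / s) w = W N n f w / s"
  by (simp add: WN_def flip: diff_divide_distrib)

lemma D_bfun: "f \<in> bfun (E (Suc n)) \<Longrightarrow> D (Suc n) (\<eta> n) f \<in> bfun (E n)"
  by (rule class_Upsilon_bfun[OF H1_Upsilon \<eta>_probs])

lemma V_square_subexponential: "subexponential \<Omega> (Osc1 (E n)) (\<lambda>f N w. (V N n f w)\<^sup>2)"
  unfolding subexponential_def
  using particle_approximation.exp_V_square_le[OF approx]
  by (intro exI[of _ "1/8"] conjI exI[of _ gauss_square_const]) auto

lemma W_mixture_bfun:
  assumes "osc_family (E n) \<delta> m h" "N \<ge> 1"
  shows "(\<lambda>(w, c). (W N n (h c) w)\<^sup>2) \<in> bfun (\<Omega> N \<Otimes>\<^sub>M m)"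
  using bfun_power[OF particle_approximation.W_family_bfun[OF approx[OF assms(2)] assms(1)], of 2]
  by (simp add: case_prod_beta')

lemma W_mixture_subexponential:
  assumes "subexponential \<Omega> (Osc1 (E n)) (\<lambda>f N w. (W N n f w)\<^sup>2)"
    and "\<And>i. i \<in> I \<Longrightarrow> osc_family (E n) \<delta> (m i) (h i)"
  shows "subexponential \<Omega> I (\<lambda>i N w. \<integral>c. (W N n (h i c) w)\<^sup>2 \<partial>m i)"
proof (rule subexponential_mixture[OF prob_space_\<Omega> assms(1)])
  fix i assume i: "i \<in> I"
  show "finite_measure (m i)" "measure (m i) (space (m i)) \<le> \<delta>" "\<And>c. c \<in> space (m i) \<Longrightarrow> h i c \<in> Osc1 (E n)"
    using assms(2)[OF i] by (auto simp: osc_family_def)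
  show "(\<lambda>(w, c). (W N n (h i c) w)\<^sup>2) \<in> bfun (\<Omega> N \<Otimes>\<^sub>M m i)" if "N \<ge> 1" for N
    by (rule W_mixture_bfun[OF assms(2)[OF i] that])
qed

abbreviation rem_family ::
    "nat \<Rightarrow> real \<Rightarrow> ('a \<Rightarrow> real) \<Rightarrow> 'c measure \<Rightarrow> ('c \<Rightarrow> 'a \<Rightarrow> real) \<Rightarrow> ('c \<Rightarrow> 'a \<Rightarrow> real) \<Rightarrow> bool"
  where "rem_family n \<equiv> remainder_family (E n) (transport (K (Suc n))) (D (Suc n)) (\<eta> n)"

text \<open>\<open>\<delta>\<close> is chosen before \<open>f\<close>, as uniformity over
  \<open>Osc1\<close> in the induction on time requires.\<close>

lemma ex_rem_family:
  "\<exists>\<delta>>0. \<forall>f\<in>bfun (E (Suc n)). \<exists>(m :: (('a \<Rightarrow> real) \<times> ('a \<Rightarrow> real)) measure) h\<^sub>1 h\<^sub>2.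
    rem_family n (\<delta> * (enn2real (osc (E (Suc n)) f) + 1)) f m h\<^sub>1 h\<^sub>2"
  using class_Upsilon_remainder_family[OF H1_Upsilon, of n] \<eta>_probs[of n] by blast

text \<open>Scaling both mean differences by \<open>sqrt N\<close> gives the first bound. For the
  second, one factor is at most 1 and only the other is scaled: weaker in \<open>N\<close>, but
  linear in the fluctuations.\<close>

lemma rem_family_le:
  assumes fam: "rem_family n \<delta> f m h\<^sub>1 h\<^sub>2" and N: "N \<ge> 1" and w: "w \<in> space (\<Omega> N)"
  shows "real N * \<bar>rem n f N w\<bar> \<le> (\<integral>c. \<bar>W N n (h\<^sub>1 c) w * W N n (h\<^sub>2 c) w\<bar> \<partial>m)"
    and "sqrt (real N) * \<bar>rem n f N w\<bar> \<le> (\<integral>c. \<bar>W N n (h\<^sub>1 c) w\<bar> \<partial>m)"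
proof -
  let ?d = "mean_diff (\<eta>N N n w) (\<eta> n)"
  note p = particle_approximation.\<eta>N_probs[OF approx[OF N] w, of n]
  have fams: "osc_family (E n) \<delta> m h\<^sub>1" "osc_family (E n) \<delta> m h\<^sub>2"
    and le: "\<bar>rem n f N w\<bar> \<le> (\<integral>c. \<bar>?d (h\<^sub>1 c) * ?d (h\<^sub>2 c)\<bar> \<partial>m)"
    using fam p by (auto simp: remainder_family_def)
  have fin: "finite_measure m"
    using fams(1) by (simp add: osc_family_def)
  have "real N * \<bar>rem n f N w\<bar> \<le> real N * (\<integral>c. \<bar>?d (h\<^sub>1 c) * ?d (h\<^sub>2 c)\<bar> \<partial>m)"
    by (intro mult_left_mono le) auto
  also have "\<dots> = (\<integral>c. \<bar>W N n (h\<^sub>1 c) w * W N n (h\<^sub>2 c) w\<bar> \<partial>m)"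
    unfolding integral_mult_right_zero[symmetric]
    by (intro Bochner_Integration.integral_cong refl) (simp add: WN_def abs_mult)
  finally show "real N * \<bar>rem n f N w\<bar> \<le> (\<integral>c. \<bar>W N n (h\<^sub>1 c) w * W N n (h\<^sub>2 c) w\<bar> \<partial>m)" .
  note b = osc_family_diff_bfun[OF fams(1) p \<eta>_probs] osc_family_diff_bfun[OF fams(2) p \<eta>_probs]
  note le
  also have "(\<integral>c. \<bar>?d (h\<^sub>1 c) * ?d (h\<^sub>2 c)\<bar> \<partial>m) \<le> (\<integral>c. \<bar>?d (h\<^sub>1 c)\<bar> \<partial>m)"
  proof (intro integral_mono finite_measure.integrable_bfun[OF fin] bfun_abs bfun_mult b)
    fix c assume "c \<in> space m"
    then have "h\<^sub>2 c \<in> Osc1 (E n)"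
      using fams(2) by (simp add: osc_family_def)
    then have "\<bar>?d (h\<^sub>2 c)\<bar> \<le> 1"
      using p \<eta>_probs by (intro integral_diff_le_osc Osc1_bfun) (auto simp: Osc1_def)
    then show "\<bar>?d (h\<^sub>1 c) * ?d (h\<^sub>2 c)\<bar> \<le> \<bar>?d (h\<^sub>1 c)\<bar>"
      by (simp add: abs_mult mult_left_le)
  qed
  finally have "sqrt (real N) * \<bar>rem n f N w\<bar> \<le> sqrt (real N) * (\<integral>c. \<bar>?d (h\<^sub>1 c)\<bar> \<partial>m)"
    by (intro mult_left_mono) auto
  also have "\<dots> = (\<integral>c. \<bar>W N n (h\<^sub>1 c) w\<bar> \<partial>m)"
    unfolding integral_mult_right_zero[symmetric]
    by (intro Bochner_Integration.integral_cong refl) (simp add: WN_def abs_mult)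
  finally show "sqrt (real N) * \<bar>rem n f N w\<bar> \<le> (\<integral>c. \<bar>W N n (h\<^sub>1 c) w\<bar> \<partial>m)" .
qed

lemma W_mixture_square_le:
  assumes fam: "osc_family (E n) \<delta> m h" and \<delta>: "0 < \<delta>" and N: "N \<ge> 1" and w: "w \<in> space (\<Omega> N)"
  shows "(\<integral>c. \<bar>W N n (h c) w\<bar> \<partial>m)\<^sup>2 \<le> \<delta> * (\<integral>c. (W N n (h c) w)\<^sup>2 \<partial>m)"
proof (rule square_integral_abs_le)
  show fin: "finite_measure m" and "measure m (space m) \<le> \<delta>"
    using fam by (auto simp: osc_family_def)
  show "(\<lambda>c. W N n (h c) w) \<in> bfun m"
    using bfun_integral_mixture(2)[OF fin particle_approximation.W_family_bfun[OF approx[OF N] fam] w] .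
qed fact

text \<open>Induction on time through \<open>W_Suc\<close>. The linear bound of the remainder closes
  it: its square is dominated by a mixture of squares of the previous fluctuations, whereas the
  quadratic bound would produce fourth powers.\<close>

lemma W_square_subexponential: "subexponential \<Omega> (Osc1 (E n)) (\<lambda>f N w. (W N n f w)\<^sup>2)"
proof (induction n)
  case 0
  show ?case
    using V_square_subexponential[of 0] by (simp add: WN_def)
next
  case (Suc n)
  let ?O = "Osc1 (E (Suc n))"
  have O: "f \<in> bfun (E (Suc n))" if "f \<in> ?O" for f
    using that by (rule Osc1_bfun)
  have Df: "D (Suc n) (\<eta> n) f \<in> bfun (E n)" if "f \<in> ?O" for f
    by (intro D_bfun O that)
  obtain \<beta> where \<beta>: "\<beta> \<ge> 0" "\<And>f. f \<in> ?O \<Longrightarrow> osc (E n) (D (Suc n) (\<eta> n) f) \<le> ennreal \<beta>"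
    using class_Upsilon_dobrushin[OF H1_Upsilon, of n] \<eta>_probs[of n] by blast
  have D_subexp: "subexponential \<Omega> ?O (\<lambda>f N w. (W N n (D (Suc n) (\<eta> n) f) w)\<^sup>2)"
  \<comment> \<open>The first-order image of \<open>f\<close> has oscillation at most
    \<open>\<beta>\<close>. Dividing it by \<open>\<beta> + 1\<close>, positive also for
    \<open>\<beta> = 0\<close>, returns it to \<open>Osc1\<close>.\<close>
  proof (rule subexponential_mono[OF Suc, where k = "(\<beta> + 1)\<^sup>2"])
    show "(\<lambda>x. D (Suc n) (\<eta> n) f x / (\<beta> + 1)) \<in> Osc1 (E n)" if "f \<in> ?O" for f
      using \<beta>(1) order_trans[OF \<beta>(2)[OF that] ennreal_leI[of \<beta> "\<beta> + 1"]]
      by (intro divide_Osc1 bfun_measurable[OF Df[OF that]]) auto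
  qed (use \<beta>(1) in \<open>auto simp: W_divide power_divide\<close>)
  let ?\<delta> = "\<lambda>\<delta> f. \<delta> * (enn2real (osc (E (Suc n)) f) + 1)"
  obtain \<delta> where \<delta>: "\<delta> > 0" and ex: "\<forall>f\<in>bfun (E (Suc n)).
      \<exists>(m :: (('a \<Rightarrow> real) \<times> ('a \<Rightarrow> real)) measure) h\<^sub>1 h\<^sub>2. rem_family n (?\<delta> \<delta> f) f m h\<^sub>1 h\<^sub>2"
    using ex_rem_family[of n] by blast
  \<comment> \<open>One measure and one family per function are fixed by choice, because the mixture
    lemma expects them indexed by \<open>f\<close>.\<close>
  from bchoice[OF ex] obtain m :: "('a \<Rightarrow> real) \<Rightarrow> (('a \<Rightarrow> real) \<times> ('a \<Rightarrow> real)) measure"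
    where "\<forall>f\<in>bfun (E (Suc n)). \<exists>h\<^sub>1 h\<^sub>2. rem_family n (?\<delta> \<delta> f) f (m f) h\<^sub>1 h\<^sub>2" ..
  from bchoice[OF this] obtain h where h: "\<forall>f\<in>bfun (E (Suc n)). \<exists>h\<^sub>2. rem_family n (?\<delta> \<delta> f) f (m f) (h f) h\<^sub>2" ..
  then have mh: "osc_family (E n) (?\<delta> \<delta> f) (m f) (h f)" if "f \<in> bfun (E (Suc n))" for f
    using that unfolding remainder_family_def by blast
  have rem_le: "sqrt (real N) * \<bar>rem n f N w\<bar> \<le> (\<integral>c. \<bar>W N n (h f c) w\<bar> \<partial>m f)"
    if "f \<in> bfun (E (Suc n))" "N \<ge> 1" "w \<in> space (\<Omega> N)" for f N w
    using h that rem_family_le(2) by blast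
  have fam: "osc_family (E n) (\<delta> * 2) (m f) (h f)" if f: "f \<in> ?O" for f
  proof -
    have "enn2real (osc (E (Suc n)) f) \<le> 1"
      using f by (intro enn2real_leI) (auto simp: Osc1_def)
    then have "?\<delta> \<delta> f \<le> \<delta> * 2"
      using \<delta> by (intro mult_left_mono) auto
    with mh[OF O[OF f]] show ?thesis
      unfolding osc_family_def by auto
  qed
  have fin: "finite_measure (m f)" if "f \<in> ?O" for f
    using fam[OF that] by (simp add: osc_family_def)
  define X where "X f N w = (V N (Suc n) f w)\<^sup>2" for f N w
  define Y where "Y f N w = (W N n (D (Suc n) (\<eta> n) f) w)\<^sup>2" for f N w
  define Z where "Z f N w = (\<integral>c. (W N n (h f c) w)\<^sup>2 \<partial>m f)" for f N w
  have meas: "X f N \<in> borel_measurable (\<Omega> N)" "Y f N \<in> borel_measurable (\<Omega> N)" "Z f N \<in> borel_measurable (\<Omega> N)"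
    if "f \<in> ?O" "N \<ge> 1" for f N
    unfolding X_def Y_def Z_def
    by (intro bfun_measurable bfun_power V_bfun_\<Omega> W_bfun_\<Omega> O Df bfun_integral_mixture(1) fin
        W_mixture_bfun[OF fam] that)+
  have nonneg: "0 \<le> X f N w" "0 \<le> Y f N w" "0 \<le> Z f N w" for f N w
    by (auto simp: X_def Y_def Z_def)
  have "subexponential \<Omega> ?O (\<lambda>f N w. X f N w + Y f N w + Z f N w)"
    unfolding X_def Y_def Z_def
    by (intro subexponential_add V_square_subexponential D_subexp W_mixture_subexponential[OF Suc fam],
        unfold X_def[symmetric] Y_def[symmetric] Z_def[symmetric])
      (auto intro!: borel_measurable_add add_nonneg_nonneg meas nonneg)
  then show ?case
  proof (rule subexponential_mono[where g = "\<lambda>f. f" and k = "3 * (1 + \<delta> * 2)"])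
    fix f N w assume f: "f \<in> ?O" and N: "N \<ge> 1" and w: "w \<in> space (\<Omega> N)"
    have "(sqrt (real N) * \<bar>rem n f N w\<bar>)\<^sup>2 \<le> (\<integral>c. \<bar>W N n (h f c) w\<bar> \<partial>m f)\<^sup>2"
      by (intro power_mono rem_le O f N w) auto
    also have "\<dots> \<le> \<delta> * 2 * Z f N w"
      unfolding Z_def using \<delta> by (intro W_mixture_square_le fam f N w) auto
    finally have r: "(sqrt (real N) * rem n f N w)\<^sup>2 \<le> \<delta> * 2 * Z f N w"
      by (simp add: power_mult_distrib)
    have "(W N (Suc n) f w)\<^sup>2 \<le> 3 * (X f N w + Y f N w + (sqrt (real N) * rem n f N w)\<^sup>2)"
      unfolding particle_approximation.W_Suc[OF approx[OF N] O[OF f], of w "D (Suc n)"] X_def Y_def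
      by (rule square_sum3_le)
    also have "\<dots> \<le> 3 * ((1 + \<delta> * 2) * X f N w + (1 + \<delta> * 2) * Y f N w + (1 + \<delta> * 2) * Z f N w)"
      using r nonneg[of f N w] mult_nonneg_nonneg[OF less_imp_le[OF \<delta>] nonneg(1)[of f N w]]
        mult_nonneg_nonneg[OF less_imp_le[OF \<delta>] nonneg(2)[of f N w]]
      by (simp add: distrib_right)
    finally show "(W N (Suc n) f w)\<^sup>2 \<le> 3 * (1 + \<delta> * 2) * (X f N w + Y f N w + Z f N w)"
      by (simp add: algebra_simps)
  qed (use \<delta> in auto)
qed

end

section \<open>Conditional variances\<close>

text \<open>The mean conditional variance of one step from \<mu>; at the limit measure it is the
  variance of the Gaussian field of the next time.\<close>

definition kernel_var :: "('a measure \<Rightarrow> 'a \<Rightarrow> 'b measure) \<Rightarrow> ('b \<Rightarrow> real) \<Rightarrow> 'a measure \<Rightarrow> real"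
  where "kernel_var K f \<mu> = (\<integral>x. (\<integral>y. (f y - (\<integral>z. f z \<partial>K \<mu> x))\<^sup>2 \<partial>K \<mu> x) \<partial>\<mu>)"

lemma kernel_var_integrand:
  assumes \<kappa>: "K \<mu> \<in> E \<rightarrow>\<^sub>M prob_algebra F" and \<mu>: "\<mu> \<in> probs E" and f: "f \<in> bfun F" and x: "x \<in> space E"
  shows "(\<integral>y. (f y - (\<integral>z. f z \<partial>K \<mu> x))\<^sup>2 \<partial>K \<mu> x) = (\<integral>y. (f y)\<^sup>2 \<partial>K \<mu> x) - (\<integral>y. f y \<partial>K \<mu> x)\<^sup>2"
proof -
  have p: "K \<mu> x \<in> probs F"
    using transport_integral(4)[where K = K and \<mu> = \<mu>, OF assms] .
  interpret prob_space "K \<mu> x"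
    using p by (rule probs_prob_space)
  have fx: "f \<in> bfun (K \<mu> x)"
    using f probs_bfun[OF p] by blast
  show ?thesis
    by (rule variance_eq) (intro integrable_bfun bfun_power fx)+
qed

lemma kernel_var_integrand_bfun:
  assumes \<kappa>: "K \<mu> \<in> E \<rightarrow>\<^sub>M prob_algebra F" and \<mu>: "\<mu> \<in> probs E" and f: "f \<in> bfun F"
  shows "(\<lambda>x. \<integral>y. (f y - (\<integral>z. f z \<partial>K \<mu> x))\<^sup>2 \<partial>K \<mu> x) \<in> bfun E"
proof -
  have "(\<lambda>x. (\<integral>y. (f y)\<^sup>2 \<partial>K \<mu> x) - (\<integral>y. f y \<partial>K \<mu> x)\<^sup>2) \<in> bfun E"
    by (intro bfun_diff bfun_power transport_integral(3)[where K = K and \<mu> = \<mu>, OF \<kappa> \<mu>] f)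
  then show ?thesis
    unfolding bfun_def by (auto simp: kernel_var_integrand[where K = K and \<mu> = \<mu>, OF assms] cong: measurable_cong image_cong)
qed

text \<open>Separates two dependences on \<mu>: the first term is the transport map tested on
  \<open>f\<^sup>2\<close>, covered by the class Upsilon, while the second involves the kernel
  itself and calls for condition (K).\<close>

lemma kernel_var_eq:
  assumes \<kappa>: "K \<mu> \<in> E \<rightarrow>\<^sub>M prob_algebra F" and \<mu>: "\<mu> \<in> probs E" and f: "f \<in> bfun F"
  shows "kernel_var K f \<mu> = (\<integral>y. (f y)\<^sup>2 \<partial>transport K \<mu>) - (\<integral>x. (\<integral>y. f y \<partial>K \<mu> x)\<^sup>2 \<partial>\<mu>)"
proof -
  interpret prob_space \<mu>
    using \<mu> by (rule probs_prob_space)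
  note b = probs_bfun[OF \<mu>]
  have "kernel_var K f \<mu> = (\<integral>x. (\<integral>y. (f y)\<^sup>2 \<partial>K \<mu> x) - (\<integral>y. f y \<partial>K \<mu> x)\<^sup>2 \<partial>\<mu>)"
    unfolding kernel_var_def
    by (intro Bochner_Integration.integral_cong refl kernel_var_integrand[where K = K and \<mu> = \<mu>, OF assms])
      (simp add: probs_space[OF \<mu>])
  also have "\<dots> = (\<integral>x. (\<integral>y. (f y)\<^sup>2 \<partial>K \<mu> x) \<partial>\<mu>) - (\<integral>x. (\<integral>y. f y \<partial>K \<mu> x)\<^sup>2 \<partial>\<mu>)"
    by (intro Bochner_Integration.integral_diff integrable_bfun, unfold b)
      (intro bfun_power transport_integral(3)[where K = K and \<mu> = \<mu>, OF \<kappa> \<mu>] f)+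
  also have "(\<integral>x. (\<integral>y. (f y)\<^sup>2 \<partial>K \<mu> x) \<partial>\<mu>) = (\<integral>y. (f y)\<^sup>2 \<partial>transport K \<mu>)"
    by (rule transport_integral(1)[where K = K and \<mu> = \<mu>, OF \<kappa> \<mu> bfun_power[OF f], symmetric])
  finally show ?thesis .
qed

text \<open>The second-order expansion is applied to each conditional law; the variances average
  exactly to \<open>kernel_var\<close> at the empirical measure.\<close>

lemma (in particle_approximation) sum_cumulant_approx:
  assumes f: "f \<in> bfun (E (Suc n))" and B: "\<And>y. y \<in> space (E (Suc n)) \<Longrightarrow> \<bar>f y\<bar> \<le> B"
    and e: "0 \<le> e" "2 * B * e \<le> 1/2" and w: "w \<in> space M"
  shows "\<bar>(\<Sum>i=1..N. cumulant (\<kappa> n i w) e f) - real N * (e\<^sup>2 / 2 * kernel_var (K (Suc n)) f (\<eta>N n w))\<bar>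
    \<le> real N * (2 * (2 * B * e) ^ 3)"
proof -
  let ?var = "\<lambda>i. \<integral>y. (f y - (\<integral>z. f z \<partial>\<kappa> n i w))\<^sup>2 \<partial>\<kappa> n i w"
  have "kernel_var (K (Suc n)) f (\<eta>N n w) = (\<Sum>i=1..N. ?var i) / real N"
    unfolding kernel_var_def \<kappa>_def
    by (rule integral_\<eta>N[OF w bfun_measurable[OF kernel_var_integrand_bfun[where K = "K (Suc n)" and \<mu> = "\<eta>N n w", OF kernels \<eta>N_probs f]]])
      (use w \<eta>N_probs in auto)
  then have "real N * (e\<^sup>2 / 2 * kernel_var (K (Suc n)) f (\<eta>N n w)) = (\<Sum>i=1..N. e\<^sup>2 / 2 * ?var i)"
    using N by (simp only: sum_distrib_left[symmetric]) simp
  then have "\<bar>(\<Sum>i=1..N. cumulant (\<kappa> n i w) e f) - real N * (e\<^sup>2 / 2 * kernel_var (K (Suc n)) f (\<eta>N n w))\<bar>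
      = \<bar>\<Sum>i=1..N. cumulant (\<kappa> n i w) e f - e\<^sup>2 / 2 * ?var i\<bar>"
    by (simp add: sum_subtractf)
  also have "\<dots> \<le> (\<Sum>i=1..N. \<bar>cumulant (\<kappa> n i w) e f - e\<^sup>2 / 2 * ?var i\<bar>)"
    by (rule sum_abs)
  also have "\<dots> \<le> (\<Sum>i=1..N. 2 * (2 * B * e) ^ 3)"
  proof (rule sum_mono)
    fix i assume i: "i \<in> {1..N}"
    note p = \<kappa>_probs[OF i w]
    show "\<bar>cumulant (\<kappa> n i w) e f - e\<^sup>2 / 2 * ?var i\<bar> \<le> 2 * (2 * B * e) ^ 3"
      unfolding cumulant_def using B probs_space[OF p] e
      by (intro prob_space.log_mgf_centered_expansion probs_prob_space[OF p] \<kappa>_bfun i w f) auto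
  qed
  finally show ?thesis
    by simp
qed

section \<open>Dominating sequences with uniform exponential moments\<close>

context particle_approximations
begin

text \<open>Serves as a dominating sequence for one fixed test function. Uniformity over functions
  is no longer required, hence the one-point index set.\<close>

definition controlled :: "(nat \<Rightarrow> 'w \<Rightarrow> real) \<Rightarrow> bool"
  where "controlled S \<longleftrightarrow>
    (\<forall>N\<ge>1. S N \<in> bfun (\<Omega> N) \<and> (\<forall>w\<in>space (\<Omega> N). 0 \<le> S N w)) \<and> subexponential \<Omega> {()} (\<lambda>_. S)"

lemma controlled_add: "controlled S \<Longrightarrow> controlled T \<Longrightarrow> controlled (\<lambda>N w. S N w + T N w)"
  unfolding controlled_def by (auto intro!: subexponential_add bfun_measurable add_nonneg_nonneg)

lemma controlled_cmult:
  assumes S: "controlled S" and c: "0 \<le> c"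
  shows "controlled (\<lambda>N w. c * S N w)"
  unfolding controlled_def
proof (intro conjI allI impI ballI)
  show "subexponential \<Omega> {()} (\<lambda>_ N w. c * S N w)"
    \<comment> \<open>A positive factor is required, so \<open>c + 1\<close> is taken to cover
      \<open>c = 0\<close>.\<close>
    by (rule subexponential_mono[where X = "\<lambda>_. S" and g = "\<lambda>x. x" and k = "c + 1"])
      (use S c in \<open>auto simp: controlled_def intro!: mult_right_mono\<close>)
qed (use S c in \<open>auto simp: controlled_def\<close>)

lemma controlled_zero: "controlled (\<lambda>_ _. 0)"
  unfolding controlled_def subexponential_def
  by (auto intro!: exI[of _ "1::real"] simp: prob_space.emeasure_space_1[OF prob_space_\<Omega>])

lemma controlled_W_square:
  assumes f: "f \<in> bfun (E n)"
  shows "controlled (\<lambda>N w. (W N n f w)\<^sup>2)"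
  unfolding controlled_def
proof (intro conjI allI impI ballI)
  obtain s where s: "s > 0" "(\<lambda>x. f x / s) \<in> Osc1 (E n)"
    using bfun_normalize[OF f] .
  show "subexponential \<Omega> {()} (\<lambda>_ N w. (W N n f w)\<^sup>2)"
    by (rule subexponential_mono[OF W_square_subexponential, where g = "\<lambda>_ x. f x / s" and k = "s\<^sup>2"])
      (use s in \<open>auto simp: W_divide power_divide\<close>)
  show "(\<lambda>w. (W N n f w)\<^sup>2) \<in> bfun (\<Omega> N)" if "1 \<le> N" for N
    by (intro bfun_power W_bfun_\<Omega> that f)
qed simp

lemma controlled_W_mixture:
  assumes fam: "osc_family (E n) \<delta> m h"
  shows "controlled (\<lambda>N w. \<integral>c. (W N n (h c) w)\<^sup>2 \<partial>m)"
  unfolding controlled_def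
proof (intro conjI allI impI ballI)
  show "subexponential \<Omega> {()} (\<lambda>_ N w. \<integral>c. (W N n (h c) w)\<^sup>2 \<partial>m)"
    using W_mixture_subexponential[OF W_square_subexponential, of "{()}" n \<delta> "\<lambda>_. m" "\<lambda>_. h"] fam by blast
  show "(\<lambda>w. \<integral>c. (W N n (h c) w)\<^sup>2 \<partial>m) \<in> bfun (\<Omega> N)" if "1 \<le> N" for N
    using fam by (intro bfun_integral_mixture(1) W_mixture_bfun[OF fam that]) (simp add: osc_family_def)
qed simp

text \<open>A single \<open>S\<close> serves both estimates: a product of two fluctuations is at
  most the sum of their squares, which controls the remainder at scale \<open>1 / N\<close>, and
  Cauchy-Schwarz on the linear bound controls its square.\<close>

lemma remainder_controlled:
  assumes f: "f \<in> bfun (E (Suc n))"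
  shows "\<exists>S. controlled S \<and> (\<forall>N\<ge>1. \<forall>w\<in>space (\<Omega> N).
    real N * \<bar>rem n f N w\<bar> \<le> S N w \<and>
    (sqrt (real N) * rem n f N w)\<^sup>2 \<le> S N w)"
proof -
  obtain \<delta> and m :: "(('a \<Rightarrow> real) \<times> ('a \<Rightarrow> real)) measure" and h\<^sub>1 h\<^sub>2
    where \<delta>: "\<delta> > 0" and rf: "rem_family n (\<delta> * (enn2real (osc (E (Suc n)) f) + 1)) f m h\<^sub>1 h\<^sub>2"
    using ex_rem_family[of n] f by blast
  define d where "d = \<delta> * (enn2real (osc (E (Suc n)) f) + 1)"
  have d: "d > 0"
    using \<delta> by (auto simp: d_def intro!: mult_pos_pos add_nonneg_pos)
  have fam: "osc_family (E n) d m h\<^sub>1" "osc_family (E n) d m h\<^sub>2"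
    using rf by (auto simp: remainder_family_def d_def)
  have fin: "finite_measure m"
    using fam(1) by (simp add: osc_family_def)
  define S where "S N w = (1 + d) * ((\<integral>c. (W N n (h\<^sub>1 c) w)\<^sup>2 \<partial>m) + (\<integral>c. (W N n (h\<^sub>2 c) w)\<^sup>2 \<partial>m))" for N w
  have "controlled S"
    unfolding S_def[abs_def] using d by (intro controlled_cmult controlled_add controlled_W_mixture[OF fam(1)] controlled_W_mixture[OF fam(2)]) auto
  moreover have "real N * \<bar>rem n f N w\<bar> \<le> S N w \<and> (sqrt (real N) * rem n f N w)\<^sup>2 \<le> S N w"
    if N: "N \<ge> 1" and w: "w \<in> space (\<Omega> N)" for N w
  proof -
    let ?I = "\<integral>c. (W N n (h\<^sub>1 c) w)\<^sup>2 \<partial>m" and ?J = "\<integral>c. (W N n (h\<^sub>2 c) w)\<^sup>2 \<partial>m"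
    have nn: "0 \<le> ?I" "0 \<le> ?J" "0 \<le> d * ?I" "0 \<le> d * ?J"
      using d by auto
    have b: "(\<lambda>c. W N n (h\<^sub>1 c) w) \<in> bfun m" "(\<lambda>c. W N n (h\<^sub>2 c) w) \<in> bfun m"
      using bfun_integral_mixture(2)[OF fin particle_approximation.W_family_bfun[OF approx[OF N] fam(1)] w]
        bfun_integral_mixture(2)[OF fin particle_approximation.W_family_bfun[OF approx[OF N] fam(2)] w] .
    have int: "integrable m (\<lambda>c. (W N n (h\<^sub>1 c) w)\<^sup>2)" "integrable m (\<lambda>c. (W N n (h\<^sub>2 c) w)\<^sup>2)"
      "integrable m (\<lambda>c. \<bar>W N n (h\<^sub>1 c) w * W N n (h\<^sub>2 c) w\<bar>)"
      by (intro finite_measure.integrable_bfun[OF fin] bfun_power bfun_abs bfun_mult b)+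
    have "real N * \<bar>rem n f N w\<bar> \<le> (\<integral>c. \<bar>W N n (h\<^sub>1 c) w * W N n (h\<^sub>2 c) w\<bar> \<partial>m)"
      by (rule rem_family_le(1)[OF rf N w])
    also have "\<dots> \<le> (\<integral>c. (W N n (h\<^sub>1 c) w)\<^sup>2 + (W N n (h\<^sub>2 c) w)\<^sup>2 \<partial>m)"
    proof (intro integral_mono int Bochner_Integration.integrable_add)
      fix c
      show "\<bar>W N n (h\<^sub>1 c) w * W N n (h\<^sub>2 c) w\<bar> \<le> (W N n (h\<^sub>1 c) w)\<^sup>2 + (W N n (h\<^sub>2 c) w)\<^sup>2"
        by (rule abs_mult_le_sum_squares)
    qed
    also have "\<dots> = ?I + ?J"
      using int by simp
    also have "\<dots> \<le> S N w"
      using nn by (simp add: S_def algebra_simps)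
    finally have "real N * \<bar>rem n f N w\<bar> \<le> S N w" .
    moreover have "(sqrt (real N) * \<bar>rem n f N w\<bar>)\<^sup>2 \<le> (\<integral>c. \<bar>W N n (h\<^sub>1 c) w\<bar> \<partial>m)\<^sup>2"
      by (intro power_mono rem_family_le(2)[OF rf N w]) simp
    moreover have "\<dots> \<le> d * ?I"
      by (rule W_mixture_square_le[OF fam(1) d N w])
    moreover have "d * ?I \<le> S N w"
      using nn by (simp add: S_def algebra_simps)
    ultimately show ?thesis
      by (simp add: power_mult_distrib)
  qed
  ultimately show ?thesis
    by blast
qed

lemma kernels_\<eta>N:
  assumes "N \<ge> 1" "w \<in> space (\<Omega> N)"
  shows "\<eta>N N n w \<in> probs (E n)" "K (Suc n) (\<eta>N N n w) \<in> E n \<rightarrow>\<^sub>M prob_algebra (E (Suc n))"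
proof -
  show "\<eta>N N n w \<in> probs (E n)"
    by (rule particle_approximation.\<eta>N_probs[OF approx[OF assms(1)] assms(2)])
  then show "K (Suc n) (\<eta>N N n w) \<in> E n \<rightarrow>\<^sub>M prob_algebra (E (Suc n))"
    by (rule particle_approximation.kernels[OF approx[OF assms(1)]])
qed

lemma kernels_\<eta>: "K (Suc n) (\<eta> n) \<in> E n \<rightarrow>\<^sub>M prob_algebra (E (Suc n))"
  using particle_approximation.kernels[OF approx[OF order_refl] \<eta>_probs] .

text \<open>The bound in condition (K) is uniform in the starting point, so \<open>S\<close> does
  not depend on \<open>x\<close>; the factor \<open>s\<^sup>2\<close> undoes the normalisation of
  \<open>f\<close>.\<close>

lemma kernel_controlled:
  assumes f: "f \<in> bfun (E (Suc n))"
  shows "\<exists>S. controlled S \<and> (\<forall>N\<ge>1. \<forall>w\<in>space (\<Omega> N). \<forall>x\<in>space (E n).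
    real N * ((\<integral>y. f y \<partial>K (Suc n) (\<eta>N N n w) x) - (\<integral>y. f y \<partial>K (Suc n) (\<eta> n) x))\<^sup>2 \<le> S N w)"
proof -
  obtain s where s: "s > 0" "(\<lambda>x. f x / s) \<in> Osc1 (E (Suc n))"
    using bfun_normalize[OF f] .
  obtain \<delta> and m :: "('a \<Rightarrow> real) measure" and h where \<delta>: "\<delta> \<ge> 0" and fam0: "osc_family (E n) \<delta> m h"
    and le: "\<And>\<mu> x. \<mu> \<in> probs (E n) \<Longrightarrow> x \<in> space (E n) \<Longrightarrow>
      \<bar>(\<integral>y. f y / s \<partial>K (Suc n) \<mu> x) - (\<integral>y. f y / s \<partial>K (Suc n) (\<eta> n) x)\<bar>
      \<le> (\<integral>c. \<bar>mean_diff \<mu> (\<eta> n) (h c)\<bar> \<partial>m)"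
    using condition_K_osc_family[OF H1_K, of n] s(2) \<eta>_probs[of n] by blast
  have fam: "osc_family (E n) (\<delta> + 1) m h"
    using fam0 by (auto simp: osc_family_def)
  define S where "S N w = s\<^sup>2 * (\<delta> + 1) * (\<integral>c. (W N n (h c) w)\<^sup>2 \<partial>m)" for N w
  have "controlled S"
    unfolding S_def[abs_def] using \<delta> by (intro controlled_cmult controlled_W_mixture[OF fam]) auto
  moreover have "real N * ((\<integral>y. f y \<partial>K (Suc n) (\<eta>N N n w) x) - (\<integral>y. f y \<partial>K (Suc n) (\<eta> n) x))\<^sup>2 \<le> S N w"
    if N: "N \<ge> 1" and w: "w \<in> space (\<Omega> N)" and x: "x \<in> space (E n)" for N w x
  proof -
    let ?d = "(\<integral>y. f y \<partial>K (Suc n) (\<eta>N N n w) x) - (\<integral>y. f y \<partial>K (Suc n) (\<eta> n) x)"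
    have "sqrt (real N) * \<bar>?d / s\<bar> \<le> sqrt (real N) * (\<integral>c. \<bar>mean_diff (\<eta>N N n w) (\<eta> n) (h c)\<bar> \<partial>m)"
      using le[OF kernels_\<eta>N(1)[OF N w] x] by (intro mult_left_mono) (auto simp: diff_divide_distrib)
    also have "\<dots> = (\<integral>c. \<bar>W N n (h c) w\<bar> \<partial>m)"
      unfolding integral_mult_right_zero[symmetric]
      by (intro Bochner_Integration.integral_cong refl) (simp add: WN_def abs_mult)
    finally have "(sqrt (real N) * \<bar>?d / s\<bar>)\<^sup>2 \<le> (\<integral>c. \<bar>W N n (h c) w\<bar> \<partial>m)\<^sup>2"
      by (intro power_mono) auto
    also have "\<dots> \<le> (\<delta> + 1) * (\<integral>c. (W N n (h c) w)\<^sup>2 \<partial>m)"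
      using \<delta> by (intro W_mixture_square_le[OF fam _ N w]) auto
    finally have "s\<^sup>2 * (sqrt (real N) * \<bar>?d / s\<bar>)\<^sup>2 \<le> S N w"
      unfolding S_def mult.assoc by (intro mult_left_mono) auto
    then show ?thesis
      using s(1) by (simp add: power_mult_distrib power_divide)
  qed
  ultimately show ?thesis
    by blast
qed

text \<open>The difference has three sources: the transport map tested on \<open>f\<^sup>2\<close>,
  the change of kernel under the empirical measure, and the change of measure for the squared mean
  of the limiting kernel. In the last one the test function is deterministic, so the bound on
  \<open>W\<close> applies to it.\<close>

lemma kernel_var_controlled:
  assumes f: "f \<in> bfun (E (Suc n))"
  shows "\<exists>S. controlled S \<and> (\<forall>N\<ge>1. \<forall>w\<in>space (\<Omega> N).
    real N * (kernel_var (K (Suc n)) f (\<eta>N N n w) - kernel_var (K (Suc n)) f (\<eta> n))\<^sup>2 \<le> S N w)"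
proof -
  let ?f2 = "\<lambda>y. (f y)\<^sup>2"
  let ?k = "\<lambda>\<mu> x. \<integral>y. f y \<partial>K (Suc n) \<mu> x"
  obtain B where B: "B > 0" "\<And>y. y \<in> space (E (Suc n)) \<Longrightarrow> \<bar>f y\<bar> \<le> B"
    using bfunE[OF f] by metis
  have f2: "?f2 \<in> bfun (E (Suc n))"
    by (rule bfun_power[OF f])
  obtain S where S: "controlled S" and rem_le: "\<And>N w. N \<ge> 1 \<Longrightarrow> w \<in> space (\<Omega> N) \<Longrightarrow> (sqrt (real N) * rem n ?f2 N w)\<^sup>2 \<le> S N w"
    using remainder_controlled[OF f2] by blast
  obtain T where T: "controlled T" and ker: "\<And>N w x. N \<ge> 1 \<Longrightarrow> w \<in> space (\<Omega> N) \<Longrightarrow> x \<in> space (E n) \<Longrightarrow>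
      real N * (?k (\<eta>N N n w) x - ?k (\<eta> n) x)\<^sup>2 \<le> T N w"
    using kernel_controlled[OF f] by blast
  have k2: "(\<lambda>x. (?k (\<eta> n) x)\<^sup>2) \<in> bfun (E n)"
    by (intro bfun_power transport_integral(3)[where K = "K (Suc n)" and \<mu> = "\<eta> n", OF kernels_\<eta> \<eta>_probs f])
  define U where "U N w = 3 * ((W N n (D (Suc n) (\<eta> n) ?f2) w)\<^sup>2 + S N w
    + (2 * (4 * B\<^sup>2) * T N w + 2 * (W N n (\<lambda>x. (?k (\<eta> n) x)\<^sup>2) w)\<^sup>2))" for N w
  have "controlled U"
    unfolding U_def[abs_def]
    by (intro controlled_cmult controlled_add controlled_W_square S T k2 D_bfun f2) auto
  moreover have "real N * (kernel_var (K (Suc n)) f (\<eta>N N n w) - kernel_var (K (Suc n)) f (\<eta> n))\<^sup>2 \<le> U N w"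
    if N: "N \<ge> 1" and w: "w \<in> space (\<Omega> N)" for N w
  proof -
    note p = kernels_\<eta>N[OF N w, of n]
    let ?\<mu> = "\<eta>N N n w"
    interpret \<mu>: prob_space ?\<mu>
      using p(1) by (rule probs_prob_space)
    note bs = probs_bfun[OF p(1)] and sp = probs_space[OF p(1)]
    have bf: "(\<lambda>x. (?k ?\<mu> x)\<^sup>2) \<in> bfun ?\<mu>" "(\<lambda>x. (?k (\<eta> n) x)\<^sup>2) \<in> bfun ?\<mu>"
      unfolding bs by (intro bfun_power transport_integral(3)[where K = "K (Suc n)" and \<mu> = "\<eta>N N n w", OF p(2,1) f], rule k2)
    define a where "a = W N n (D (Suc n) (\<eta> n) ?f2) w"
    define b where "b = sqrt (real N) * (\<integral>x. (?k ?\<mu> x)\<^sup>2 - (?k (\<eta> n) x)\<^sup>2 \<partial>?\<mu>)"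
    define c where "c = W N n (\<lambda>x. (?k (\<eta> n) x)\<^sup>2) w"
    define r where "r = sqrt (real N) * rem n ?f2 N w"
    have "sqrt (real N) * (kernel_var (K (Suc n)) f ?\<mu> - kernel_var (K (Suc n)) f (\<eta> n)) = a + r + (- b - c)"
      unfolding kernel_var_eq[where K = "K (Suc n)" and \<mu> = "\<eta>N N n w", OF p(2,1) f] kernel_var_eq[where K = "K (Suc n)" and \<mu> = "\<eta> n", OF kernels_\<eta> \<eta>_probs f] a_def r_def b_def c_def
        Bochner_Integration.integral_diff[OF \<mu>.integrable_bfun[OF bf(1)] \<mu>.integrable_bfun[OF bf(2)]]
      by (simp add: WN_def remainder_def algebra_simps)
    then have "real N * (kernel_var (K (Suc n)) f ?\<mu> - kernel_var (K (Suc n)) f (\<eta> n))\<^sup>2 = (a + r + (- b - c))\<^sup>2"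
      by (metis of_nat_0_le_iff power_mult_distrib real_sqrt_pow2)
    also have "\<dots> \<le> 3 * (a\<^sup>2 + r\<^sup>2 + (- b - c)\<^sup>2)"
      by (rule square_sum3_le)
    also have "(- b - c)\<^sup>2 \<le> 2 * b\<^sup>2 + 2 * c\<^sup>2"
      using sum_squares_bound[of b c] by (simp add: power2_eq_square algebra_simps)
    \<comment> \<open>A difference of squares factors into a sum, at most \<open>2 * B\<close>, and
      a difference, which \<open>T\<close> controls uniformly in \<open>x\<close>.\<close>
    also have "b\<^sup>2 \<le> 4 * B\<^sup>2 * T N w"
    proof -
      define q where "q = sqrt (T N w)"
      have kB: "\<bar>?k \<mu> x\<bar> \<le> B" if "\<mu> \<in> probs (E n)" "K (Suc n) \<mu> \<in> E n \<rightarrow>\<^sub>M prob_algebra (E (Suc n))" "x \<in> space (E n)" for \<mu> x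
      proof -
        show ?thesis
          using transport_integral(4)[where K = "K (Suc n)" and \<mu> = \<mu>, OF that(2,1) f that(3)] f B(2)
          by (rule probs_abs_integral_le)
      qed
      have "\<bar>sqrt (real N) * ((?k ?\<mu> x)\<^sup>2 - (?k (\<eta> n) x)\<^sup>2)\<bar> \<le> 2 * B * q" if x: "x \<in> space ?\<mu>" for x
      proof -
        have x': "x \<in> space (E n)"
          using x sp by simp
        have "sqrt (real N * (?k ?\<mu> x - ?k (\<eta> n) x)\<^sup>2) \<le> q"
          unfolding q_def by (intro real_sqrt_le_mono ker N w x')
        then have 1: "sqrt (real N) * \<bar>?k ?\<mu> x - ?k (\<eta> n) x\<bar> \<le> q"
          by (simp add: real_sqrt_mult)
        have 2: "\<bar>?k ?\<mu> x + ?k (\<eta> n) x\<bar> \<le> 2 * B"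
          using kB[OF p x'] kB[OF \<eta>_probs kernels_\<eta> x'] by linarith
        have "\<bar>sqrt (real N) * ((?k ?\<mu> x)\<^sup>2 - (?k (\<eta> n) x)\<^sup>2)\<bar>
            = \<bar>?k ?\<mu> x + ?k (\<eta> n) x\<bar> * (sqrt (real N) * \<bar>?k ?\<mu> x - ?k (\<eta> n) x\<bar>)"
          by (simp add: power2_eq_square square_diff_square_factored abs_mult)
        also have "\<dots> \<le> 2 * B * q"
          using 1 2 B(1) by (intro mult_mono) auto
        finally show ?thesis .
      qed
      then have "\<bar>\<integral>x. sqrt (real N) * ((?k ?\<mu> x)\<^sup>2 - (?k (\<eta> n) x)\<^sup>2) \<partial>?\<mu>\<bar> \<le> 2 * B * q"
        by (intro \<mu>.abs_integral_le bfun_cmult bfun_diff bf) auto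
      then have "\<bar>b\<bar> \<le> 2 * B * q"
        by (simp add: b_def)
      then have "b\<^sup>2 \<le> (2 * B * q)\<^sup>2"
        using power_mono[of "\<bar>b\<bar>" "2 * B * q" 2] by simp
      moreover have "q\<^sup>2 = T N w"
        using T N w by (simp add: q_def controlled_def)
      ultimately show ?thesis
        by (simp add: power_mult_distrib)
    qed
    also have "r\<^sup>2 \<le> S N w"
      unfolding r_def by (rule rem_le[OF N w])
    finally show ?thesis
      by (simp add: U_def a_def c_def)
  qed
  ultimately show ?thesis
    by blast
qed

section \<open>Linearisation of the fluctuations along the flow\<close>

abbreviation fo :: "nat \<Rightarrow> nat \<Rightarrow> ('a \<Rightarrow> real) \<Rightarrow> 'a \<Rightarrow> real"
  where "fo \<equiv> first_order \<eta>0 K D"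

text \<open>By \<open>W_Suc\<close> the first-order term is the fluctuation, one step earlier, of
  another function, so the hypothesis is needed for general \<open>f\<close>. Each step adds a
  remainder already scaled by \<open>sqrt N\<close>; the second \<open>sqrt N\<close> brings it to
  the order controlled by \<open>remainder_controlled\<close>.\<close>

lemma W_expansion:
  assumes "f \<in> bfun (E n)"
  shows "\<exists>S. controlled S \<and> (\<forall>N\<ge>1. \<forall>w\<in>space (\<Omega> N).
    sqrt (real N) * \<bar>W N n f w - (\<Sum>p=0..n. V N p (fo p n f) w)\<bar> \<le> S N w)"
  using assms
proof (induction n arbitrary: f)
  case 0
  show ?case
    using controlled_zero by (intro exI[of _ "\<lambda>_ _. 0"]) (simp add: WN_def first_order_def)
next
  case (Suc n)
  let ?D = "D (Suc n) (\<eta> n) f"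
  obtain S where S: "controlled S" "\<And>N w. N \<ge> 1 \<Longrightarrow> w \<in> space (\<Omega> N) \<Longrightarrow>
      sqrt (real N) * \<bar>W N n ?D w - (\<Sum>p=0..n. V N p (fo p n ?D) w)\<bar> \<le> S N w"
    using Suc.IH[OF D_bfun[OF Suc.prems]] by blast
  obtain T where T: "controlled T" "\<And>N w. N \<ge> 1 \<Longrightarrow> w \<in> space (\<Omega> N) \<Longrightarrow> real N * \<bar>rem n f N w\<bar> \<le> T N w"
    using remainder_controlled[OF Suc.prems] by blast
  have fo_le: "fo p (Suc n) f = fo p n ?D" if "p \<le> n" for p
    using that by (simp add: first_order_def)
  have fo_eq: "fo (Suc n) (Suc n) f = f"
    by (simp add: first_order_def)
  have "sqrt (real N) * \<bar>W N (Suc n) f w - (\<Sum>p=0..Suc n. V N p (fo p (Suc n) f) w)\<bar> \<le> S N w + T N w"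
    if N: "N \<ge> 1" and w: "w \<in> space (\<Omega> N)" for N w
  proof -
    let ?x = "W N n ?D w - (\<Sum>p=0..n. V N p (fo p n ?D) w)"
    have eq: "W N (Suc n) f w - (\<Sum>p=0..Suc n. V N p (fo p (Suc n) f) w) = ?x + sqrt (real N) * rem n f N w"
      unfolding particle_approximation.W_Suc[OF approx[OF N] Suc.prems, of w "D (Suc n)"]
      by (simp only: sum.atLeast0_atMost_Suc fo_eq) (simp add: fo_le)
    have "sqrt (real N) * \<bar>?x + sqrt (real N) * rem n f N w\<bar> \<le> sqrt (real N) * (\<bar>?x\<bar> + \<bar>sqrt (real N) * rem n f N w\<bar>)"
      by (intro mult_left_mono abs_triangle_ineq) auto
    also have "\<dots> = sqrt (real N) * \<bar>?x\<bar> + real N * \<bar>rem n f N w\<bar>"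
      by (simp add: distrib_left abs_mult)
    also have "\<dots> \<le> S N w + T N w"
      by (intro add_mono S(2) T(2) N w)
    finally show ?thesis
      unfolding eq .
  qed
  with controlled_add[OF S(1) T(1)] show ?case
    by blast
qed

end

lemma field_cov_Suc: "field_cov \<eta>0 K (Suc m) f f = kernel_var (K (Suc m)) f (flow \<eta>0 K m)"
  by (simp add: field_cov_def kernel_var_def Let_def power2_eq_square)

lemma field_cov_scale:
  "field_cov \<eta>0 K n (\<lambda>x. s * f x) (\<lambda>x. s * f x) = s\<^sup>2 * field_cov \<eta>0 K n f f"
proof -
  have *: "(s * a - s * b) * (s * a - s * b) = s\<^sup>2 * ((a - b) * (a - b))" for a b :: real
    by (simp add: power2_eq_square algebra_simps)
  show ?thesis
    by (cases n) (simp_all add: field_cov_def Let_def *)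
qed

section \<open>Moderate deviations\<close>

locale moderate_deviations = particle_approximations E K \<eta>0 D \<Omega> \<xi>
  for E :: "nat \<Rightarrow> 'a measure"
    and K :: "nat \<Rightarrow> 'a measure \<Rightarrow> 'a \<Rightarrow> 'a measure"
    and \<eta>0 :: "'a measure"
    and D :: "nat \<Rightarrow> 'a measure \<Rightarrow> ('a \<Rightarrow> real) \<Rightarrow> 'a \<Rightarrow> real"
    and \<Omega> :: "nat \<Rightarrow> 'w measure"
    and \<xi> :: "nat \<Rightarrow> nat \<Rightarrow> nat \<Rightarrow> 'w \<Rightarrow> 'a" +
  fixes \<alpha> :: "nat \<Rightarrow> real"
  assumes alpha_pos: "\<And>N. N \<ge> 1 \<Longrightarrow> \<alpha> N > 0"
    and alpha_mono: "mono_on {1..} \<alpha>"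
    and alpha_lim: "(\<lambda>N. \<alpha> N / real N) \<longlonglongrightarrow> 0"
begin

abbreviation cov :: "nat \<Rightarrow> ('a \<Rightarrow> real) \<Rightarrow> real"
  where "cov p f \<equiv> field_cov \<eta>0 K p f f"

definition \<epsilon> :: "nat \<Rightarrow> real"
  where "\<epsilon> N = sqrt (\<alpha> N / real N)"

lemma \<epsilon>_lim: "\<epsilon> \<longlonglongrightarrow> 0"
  using tendsto_real_sqrt[OF alpha_lim] by (simp add: \<epsilon>_def[abs_def])

lemma \<epsilon>_nonneg: "N \<ge> 1 \<Longrightarrow> 0 \<le> \<epsilon> N"
  using alpha_pos[of N] by (simp add: \<epsilon>_def)

lemma \<epsilon>_eq: "sqrt (\<alpha> N) / sqrt (real N) = \<epsilon> N"
  by (simp add: \<epsilon>_def real_sqrt_divide)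

lemma \<epsilon>_square: "N \<ge> 1 \<Longrightarrow> real N * (\<epsilon> N)\<^sup>2 = \<alpha> N"
  using alpha_pos[of N] by (simp add: \<epsilon>_def)

text \<open>The splitting behind the later completion of the square:
  \<open>sqrt (\<alpha> N)\<close> stays with the constant, \<open>sqrt N\<close> turns a difference
  of conditional variances into a controlled quantity, and \<open>\<epsilon> N\<close> is the small
  factor.\<close>

lemma alpha_eq: "N \<ge> 1 \<Longrightarrow> \<alpha> N = sqrt (\<alpha> N) * (sqrt (real N) * \<epsilon> N)"
  using alpha_pos[of N] by (simp flip: \<epsilon>_eq)

text \<open>Monotonicity of the speed enters as a positive lower bound, so that a vanishing multiple
  of a bounded log moment stays negligible after division by the speed.\<close>

lemma alpha_ge: "N \<ge> 1 \<Longrightarrow> \<alpha> 1 \<le> \<alpha> N"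
  using mono_onD[OF alpha_mono, of 1 N] by simp

lemma eventually_\<epsilon>_small: "\<forall>\<^sub>F N in sequentially. 1 \<le> N \<and> c * \<epsilon> N \<le> 1/2"
proof -
  have "(\<lambda>N. c * \<epsilon> N) \<longlonglongrightarrow> c * 0"
    by (intro tendsto_intros \<epsilon>_lim)
  then have "\<forall>\<^sub>F N in sequentially. c * \<epsilon> N < 1/2"
    by (rule order_tendstoD) simp
  then show ?thesis
    using eventually_ge_at_top[of 1] by eventually_elim simp
qed

text \<open>The cubic errors of the \<open>N\<close> expansions add up to \<open>\<alpha> N\<close>
  times a multiple of \<open>\<epsilon> N\<close>, negligible at speed \<alpha>.\<close>

lemma N_\<epsilon>_cube: "N \<ge> 1 \<Longrightarrow> real N * (2 * (c * \<epsilon> N) ^ 3) = \<alpha> N * (2 * c ^ 3 * \<epsilon> N)"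
  by (subst \<epsilon>_square[symmetric]) (simp_all add: power_mult_distrib power3_eq_cube power2_eq_square)

text \<open>
  By the expansion of the conditional cumulants, up to a factor \<open>exp (\<alpha> N * X N)\<close> with \<open>X\<close> as below,
  integrating out the particles at time \<open>n + 1\<close> multiplies the Laplace transform by a constant.
\<close>

lemma negligible_cumulant_error:
  assumes f: "f \<in> bfun (E (Suc n))"
  defines "X \<equiv> \<lambda>N w. (\<Sum>i=1..N. cumulant (particle_approximation.\<kappa> E K N (\<xi> N) n i w) (\<epsilon> N) f) / \<alpha> N
    - 1/2 * kernel_var (K (Suc n)) f (\<eta> n)"
  shows "negligible_rv \<alpha> \<Omega> X" "N \<ge> 1 \<Longrightarrow> X N \<in> bfun (\<Omega> N)"
proof -
  let ?v = "\<lambda>\<mu>. kernel_var (K (Suc n)) f \<mu>"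
  obtain B where B: "B > 0" "\<And>y. y \<in> space (E (Suc n)) \<Longrightarrow> \<bar>f y\<bar> \<le> B"
    using bfunE[OF f] by metis
  show Xb: "X N \<in> bfun (\<Omega> N)" if "N \<ge> 1" for N
    unfolding X_def
    by (intro bfun_intros particle_approximation.history_bfun[where n = n, OF approx[OF that]]
        particle_approximation.\<kappa>_cumulant_bfun[OF approx[OF that]] f)
  obtain S where S: "controlled S" and var: "\<And>N w. N \<ge> 1 \<Longrightarrow> w \<in> space (\<Omega> N) \<Longrightarrow>
      real N * (?v (\<eta>N N n w) - ?v (\<eta> n))\<^sup>2 \<le> S N w"
    using kernel_var_controlled[OF f] by blast
  show "negligible_rv \<alpha> \<Omega> X"
  \<comment> \<open>The first summand of \<open>b\<close> comes from completing the square, the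
    second from the cubic error of the cumulant expansion.\<close>
  proof (rule negligibleI[OF prob_space_\<Omega> _ alpha_ge Xb, where S = S and \<theta> = "\<lambda>_. \<epsilon>"
        and b = "\<lambda>t N. t\<^sup>2 * \<epsilon> N / 16 + t * (2 * (2 * B) ^ 3 * \<epsilon> N)"])
    fix t :: real assume t: "t > 0"
    have "(\<lambda>N. t\<^sup>2 * \<epsilon> N / 16 + t * (2 * (2 * B) ^ 3 * \<epsilon> N)) \<longlonglongrightarrow> t\<^sup>2 * 0 / 16 + t * (2 * (2 * B) ^ 3 * 0)"
      by (intro tendsto_intros \<epsilon>_lim) simp
    then show "(\<lambda>N. t\<^sup>2 * \<epsilon> N / 16 + t * (2 * (2 * B) ^ 3 * \<epsilon> N)) \<longlonglongrightarrow> 0"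
      by simp
    show "\<forall>\<^sub>F N in sequentially. \<forall>w\<in>space (\<Omega> N). t * \<alpha> N * \<bar>X N w\<bar>
        \<le> \<epsilon> N * S N w + \<alpha> N * (t\<^sup>2 * \<epsilon> N / 16 + t * (2 * (2 * B) ^ 3 * \<epsilon> N))"
      using eventually_\<epsilon>_small[of "2 * B"]
    proof eventually_elim
      case (elim N)
      then have N: "N \<ge> 1" and small: "2 * B * \<epsilon> N \<le> 1/2"
        by auto
      note aN = alpha_pos[OF N]
      show ?case
      proof
        fix w assume w: "w \<in> space (\<Omega> N)"
        let ?c = "\<Sum>i=1..N. cumulant (particle_approximation.\<kappa> E K N (\<xi> N) n i w) (\<epsilon> N) f"
        define d where "d = \<bar>?v (\<eta>N N n w) - ?v (\<eta> n)\<bar>"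
        have "\<bar>?c - real N * ((\<epsilon> N)\<^sup>2 / 2 * ?v (\<eta>N N n w))\<bar> \<le> real N * (2 * (2 * B * \<epsilon> N) ^ 3)"
          by (rule particle_approximation.sum_cumulant_approx[OF approx[OF N] f B(2) \<epsilon>_nonneg[OF N] small w])
        then have 1: "\<bar>?c - \<alpha> N * (1/2 * ?v (\<eta>N N n w))\<bar> \<le> \<alpha> N * (2 * (2 * B) ^ 3 * \<epsilon> N)"
          unfolding N_\<epsilon>_cube[OF N] using \<epsilon>_square[OF N] by (simp add: mult.assoc[symmetric])
        have "\<alpha> N * X N w = (?c - \<alpha> N * (1/2 * ?v (\<eta>N N n w))) + \<alpha> N * (1/2 * (?v (\<eta>N N n w) - ?v (\<eta> n)))"
          using aN by (simp add: X_def algebra_simps)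
        then have "\<bar>\<alpha> N * X N w\<bar> \<le> \<bar>?c - \<alpha> N * (1/2 * ?v (\<eta>N N n w))\<bar>
            + \<bar>\<alpha> N * (1/2 * (?v (\<eta>N N n w) - ?v (\<eta> n)))\<bar>"
          by (metis abs_triangle_ineq)
        also have "\<bar>\<alpha> N * (1/2 * (?v (\<eta>N N n w) - ?v (\<eta> n)))\<bar> = \<alpha> N * d / 2"
          using aN by (simp add: abs_mult d_def)
        finally have "\<alpha> N * \<bar>X N w\<bar> \<le> \<alpha> N * (2 * (2 * B) ^ 3 * \<epsilon> N) + \<alpha> N * d / 2"
          using 1 aN by (simp add: abs_mult)
        then have 2: "t * (\<alpha> N * \<bar>X N w\<bar>) \<le> t * (\<alpha> N * (2 * (2 * B) ^ 3 * \<epsilon> N) + \<alpha> N * d / 2)"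
          using t by (intro mult_left_mono) auto
        define q where "q = sqrt (real N) * d"
        have q: "q\<^sup>2 \<le> S N w"
          using var[OF N w] by (simp add: q_def d_def power_mult_distrib)
        \<comment> \<open>Twice a product is at most the sum of the squares. This leaves
          \<open>\<alpha> N\<close> times a multiple of \<open>\<epsilon> N\<close>, and
          \<open>\<epsilon> N\<close> times the controlled sequence \<open>S\<close>; both are
          negligible at speed \<alpha>.\<close>
        have "t / 2 * (\<alpha> N * d) = t / 2 * (sqrt (\<alpha> N) * (sqrt (real N) * \<epsilon> N) * d)"
          using alpha_eq[OF N] by simp
        also have "\<dots> = \<epsilon> N * (2 * (t / 4 * sqrt (\<alpha> N)) * q)"
          by (simp add: q_def algebra_simps)
        also have "\<dots> \<le> \<epsilon> N * ((t / 4 * sqrt (\<alpha> N))\<^sup>2 + q\<^sup>2)"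
          by (intro mult_left_mono sum_squares_bound \<epsilon>_nonneg N)
        also have "\<dots> \<le> \<epsilon> N * (t\<^sup>2 / 16 * \<alpha> N + S N w)"
          using q aN by (intro mult_left_mono add_mono \<epsilon>_nonneg N) (auto simp: power_mult_distrib power_divide)
        finally have "t / 2 * (\<alpha> N * d) \<le> \<epsilon> N * (t\<^sup>2 / 16 * \<alpha> N + S N w)" .
        with 2 show "t * \<alpha> N * \<bar>X N w\<bar>
            \<le> \<epsilon> N * S N w + \<alpha> N * (t\<^sup>2 * \<epsilon> N / 16 + t * (2 * (2 * B) ^ 3 * \<epsilon> N))"
          by (simp add: algebra_simps)
      qed
    qed
  qed (use S alpha_pos \<epsilon>_lim \<epsilon>_nonneg in \<open>auto simp: controlled_def\<close>)
qed

text \<open>The limit is assumed for all families because \<open>perturbation\<close> needs it for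
  every multiple \<open>s * f\<close>; linearity of the fields and quadratic scaling of the
  covariance supply the factor \<open>s\<^sup>2\<close>.\<close>

lemma log_mgf_V_sum_perturbed_lim:
  assumes f: "\<And>p. f p \<in> bfun (E p)"
    and X: "negligible_rv \<alpha> \<Omega> X" "\<And>N. N \<ge> 1 \<Longrightarrow> X N \<in> bfun (\<Omega> N)"
    and lim: "\<And>f. (\<And>p. f p \<in> bfun (E p)) \<Longrightarrow>
      (\<lambda>N. log_mgf (\<Omega> N) (\<lambda>w. sqrt (\<alpha> N) * (\<Sum>p=0..n. V N p (f p) w)) / \<alpha> N)
        \<longlonglongrightarrow> 1/2 * (\<Sum>p=0..n. cov p (f p))"
  shows "(\<lambda>N. log_mgf (\<Omega> N) (\<lambda>w. sqrt (\<alpha> N) * (\<Sum>p=0..n. V N p (f p) w) + \<alpha> N * X N w) / \<alpha> N)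
    \<longlonglongrightarrow> 1/2 * (\<Sum>p=0..n. cov p (f p))"
proof -
  \<comment> \<open>Division by \<open>sqrt (\<alpha> N)\<close> puts the sum at the scale at which
    the exponent is \<open>\<alpha> N\<close> times \<open>Y N\<close>.\<close>
  define Y where "Y N w = (\<Sum>p=0..n. V N p (f p) w) / sqrt (\<alpha> N)" for N w
  have aY: "s * \<alpha> N * Y N w = sqrt (\<alpha> N) * (\<Sum>p=0..n. V N p (\<lambda>x. s * f p x) w)" if "N \<ge> 1" for s N w
  proof -
    have "s * \<alpha> N * Y N w = s * (\<alpha> N / sqrt (\<alpha> N)) * (\<Sum>p=0..n. V N p (f p) w)"
      by (simp add: Y_def)
    also have "\<alpha> N / sqrt (\<alpha> N) = sqrt (\<alpha> N)"
      using alpha_pos[OF that] by (simp add: real_div_sqrt)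
    finally show ?thesis
      unfolding V_cmult sum_distrib_left[symmetric] by simp
  qed
  have Yb: "Y N \<in> bfun (\<Omega> N)" if "N \<ge> 1" for N
    unfolding Y_def by (intro bfun_divide bfun_sum V_bfun_\<Omega> that f)
  let ?w = "\<Sum>p=0..n. cov p (f p)"
  have "(\<lambda>N. log_mgf (\<Omega> N) (\<lambda>w. \<alpha> N * (Y N w + X N w)) / \<alpha> N) \<longlonglongrightarrow> 1/2 * ?w"
  proof (rule perturbation[OF prob_space_\<Omega> alpha_pos X(2) Yb _ X(1)])
    fix s :: real
    have "\<forall>\<^sub>F N in sequentially. log_mgf (\<Omega> N) (\<lambda>w. sqrt (\<alpha> N) * (\<Sum>p=0..n. V N p (\<lambda>x. s * f p x) w)) / \<alpha> N
        = log_mgf (\<Omega> N) (\<lambda>w. s * \<alpha> N * Y N w) / \<alpha> N"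
      using aY by (intro eventually_mono[OF eventually_ge_at_top[of 1]]) simp
    from Lim_transform_eventually[OF lim[OF bfun_cmult[OF f]] this]
    show "(\<lambda>N. log_mgf (\<Omega> N) (\<lambda>w. s * \<alpha> N * Y N w) / \<alpha> N) \<longlonglongrightarrow> s\<^sup>2 * (1/2 * ?w)"
      by (simp add: field_cov_scale sum_distrib_left)
  qed
  then show ?thesis
    using aY[of _ 1]
    by (elim Lim_transform_eventually)
      (auto intro!: eventually_mono[OF eventually_ge_at_top[of 1]] simp: distrib_left)
qed

text \<open>Integrating out the last generation leaves its limiting half variance as a constant and
  a negligible perturbation of the earlier sum. The induction hypothesis is then used at all
  multiples of the earlier functions.\<close>

lemma log_mgf_V_sum_lim:
  assumes "\<And>p. f p \<in> bfun (E p)"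
  shows "(\<lambda>N. log_mgf (\<Omega> N) (\<lambda>w. sqrt (\<alpha> N) * (\<Sum>p=0..n. V N p (f p) w)) / \<alpha> N)
    \<longlonglongrightarrow> 1/2 * (\<Sum>p=0..n. cov p (f p))"
  using assms
proof (induction n arbitrary: f)
  case 0
  \<comment> \<open>At time 0 the particles have the nonrandom law \<eta>0, so there is no
    perturbation and only the cubic error of the expansion has to vanish.\<close>
  note f = 0[of 0]
  let ?v = "cov 0 (f 0)"
  obtain B where B: "B > 0" "\<And>y. y \<in> space (E 0) \<Longrightarrow> \<bar>f 0 y\<bar> \<le> B"
    using bfunE[OF f] by metis
  have init: "\<eta>0 \<in> probs (E 0)"
    using \<eta>_probs[of 0] by simp
  interpret \<eta>0: prob_space \<eta>0
    using init by (rule probs_prob_space)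
  have "\<forall>\<^sub>F N in sequentially. norm (log_mgf (\<Omega> N) (\<lambda>w. sqrt (\<alpha> N) * V N 0 (f 0) w) / \<alpha> N - 1/2 * ?v)
      \<le> 2 * (2 * B) ^ 3 * \<epsilon> N"
    using eventually_\<epsilon>_small[of "2 * B"]
  proof eventually_elim
    case (elim N)
    then have N: "N \<ge> 1" and small: "2 * B * \<epsilon> N \<le> 1/2"
      by auto
    note aN = alpha_pos[OF N]
    have L: "log_mgf (\<Omega> N) (\<lambda>w. sqrt (\<alpha> N) * V N 0 (f 0) w) = real N * cumulant \<eta>0 (\<epsilon> N) (f 0)"
      using particle_approximation.log_mgf_V_0[OF approx[OF N] f] by (simp add: \<epsilon>_eq)
    have v: "?v = (\<integral>y. (f 0 y - (\<integral>z. f 0 z \<partial>\<eta>0))\<^sup>2 \<partial>\<eta>0)"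
      by (simp add: field_cov_def power2_eq_square)
    have "\<bar>cumulant \<eta>0 (\<epsilon> N) (f 0) - (\<epsilon> N)\<^sup>2 / 2 * ?v\<bar> \<le> 2 * (2 * B * \<epsilon> N) ^ 3"
      unfolding v cumulant_def using f B(2) probs_bfun[OF init]
        probs_space[OF init] \<epsilon>_nonneg[OF N] small
      by (intro \<eta>0.log_mgf_centered_expansion) auto
    then have "real N * \<bar>cumulant \<eta>0 (\<epsilon> N) (f 0) - (\<epsilon> N)\<^sup>2 / 2 * ?v\<bar> \<le> \<alpha> N * (2 * (2 * B) ^ 3 * \<epsilon> N)"
      unfolding N_\<epsilon>_cube[OF N, symmetric] by (intro mult_left_mono) auto
    moreover have "real N * \<bar>cumulant \<eta>0 (\<epsilon> N) (f 0) - (\<epsilon> N)\<^sup>2 / 2 * ?v\<bar>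
        = \<bar>real N * cumulant \<eta>0 (\<epsilon> N) (f 0) - real N * (\<epsilon> N)\<^sup>2 * (1/2 * ?v)\<bar>"
      by (subst abs_of_nonneg[of "real N", symmetric], simp, subst abs_mult[symmetric]) (simp add: algebra_simps)
    ultimately have "\<bar>real N * cumulant \<eta>0 (\<epsilon> N) (f 0) - \<alpha> N * (1/2 * ?v)\<bar> \<le> \<alpha> N * (2 * (2 * B) ^ 3 * \<epsilon> N)"
      by (simp only: \<epsilon>_square[OF N])
    moreover have "real N * cumulant \<eta>0 (\<epsilon> N) (f 0) / \<alpha> N - 1/2 * ?v
        = (real N * cumulant \<eta>0 (\<epsilon> N) (f 0) - \<alpha> N * (1/2 * ?v)) / \<alpha> N"
      using aN by (simp add: diff_divide_distrib)
    ultimately show ?case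
      unfolding L using aN by (simp add: abs_divide pos_divide_le_eq mult.commute)
  qed
  moreover have "(\<lambda>N. 2 * (2 * B) ^ 3 * \<epsilon> N) \<longlonglongrightarrow> 0"
    by (intro tendsto_mult_right_zero \<epsilon>_lim)
  ultimately have "(\<lambda>N. log_mgf (\<Omega> N) (\<lambda>w. sqrt (\<alpha> N) * V N 0 (f 0) w) / \<alpha> N - 1/2 * ?v) \<longlonglongrightarrow> 0"
    by (rule Lim_null_comparison)
  from LIM_zero_cancel[OF this] show ?case
    by simp
next
  case (Suc n)
  note f = Suc.prems
  let ?v = "cov (Suc n) (f (Suc n))"
  let ?w = "\<Sum>p=0..n. cov p (f p)"
  define X where "X N w = (\<Sum>i=1..N. cumulant (particle_approximation.\<kappa> E K N (\<xi> N) n i w) (\<epsilon> N) (f (Suc n))) / \<alpha> N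
    - 1/2 * kernel_var (K (Suc n)) (f (Suc n)) (\<eta> n)" for N w
  have X: "negligible_rv \<alpha> \<Omega> X" "\<And>N. N \<ge> 1 \<Longrightarrow> X N \<in> bfun (\<Omega> N)"
    unfolding X_def[abs_def] by (rule negligible_cumulant_error[OF f], rule negligible_cumulant_error(2)[OF f])
  let ?Z = "\<lambda>N w. sqrt (\<alpha> N) * (\<Sum>p=0..n. V N p (f p) w)"
  have "(\<lambda>N. log_mgf (\<Omega> N) (\<lambda>w. ?Z N w + \<alpha> N * X N w) / \<alpha> N + 1/2 * ?v) \<longlonglongrightarrow> 1/2 * ?w + 1/2 * ?v"
    by (intro tendsto_add tendsto_const log_mgf_V_sum_perturbed_lim f X Suc.IH)
  moreover have "\<forall>\<^sub>F N in sequentially. log_mgf (\<Omega> N) (\<lambda>w. ?Z N w + \<alpha> N * X N w) / \<alpha> N + 1/2 * ?v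
      = log_mgf (\<Omega> N) (\<lambda>w. sqrt (\<alpha> N) * (\<Sum>p=0..Suc n. V N p (f p) w)) / \<alpha> N"
    using eventually_ge_at_top[of 1]
  proof eventually_elim
    case (elim N)
    let ?C = "\<lambda>w. \<Sum>i=1..N. cumulant (particle_approximation.\<kappa> E K N (\<xi> N) n i w) (\<epsilon> N) (f (Suc n))"
    note aN = alpha_pos[OF elim]
    have Z: "?Z N \<in> bfun (history E N (\<Omega> N) (\<xi> N) n)"
    proof (intro bfun_cmult bfun_sum)
      fix p assume "p \<in> {0..n}"
      then have "p \<le> n"
        by simp
      from particle_approximation.history_mono[OF approx[OF elim] this particle_approximation.V_bfun[OF approx[OF elim] f]]
      show "V N p (f p) \<in> bfun (history E N (\<Omega> N) (\<xi> N) n)" .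
    qed
    have ZX: "(\<lambda>w. ?Z N w + \<alpha> N * X N w) \<in> bfun (\<Omega> N)"
      by (intro bfun_cmult bfun_add particle_approximation.history_bfun[OF approx[OF elim] Z] X(2) elim)
    have "log_mgf (\<Omega> N) (\<lambda>w. sqrt (\<alpha> N) * (\<Sum>p=0..Suc n. V N p (f p) w))
        = log_mgf (\<Omega> N) (\<lambda>w. ?Z N w + sqrt (\<alpha> N) * V N (Suc n) (f (Suc n)) w)"
      by (simp add: distrib_left)
    also have "\<dots> = log_mgf (\<Omega> N) (\<lambda>w. ?Z N w + ?C w)"
      using particle_approximation.log_mgf_V_Suc[OF approx[OF elim] Z f, of "sqrt (\<alpha> N)"] unfolding \<epsilon>_eq .
    \<comment> \<open>\<open>X\<close> is defined so that the cumulant sum equals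
      \<open>\<alpha> N\<close> times \<open>X\<close> plus half the limiting variance.\<close>
    also have "(\<lambda>w. ?Z N w + ?C w) = (\<lambda>w. ?Z N w + \<alpha> N * X N w + \<alpha> N * (1/2 * ?v))"
      using aN by (simp add: X_def field_cov_Suc right_diff_distrib)
    also have "log_mgf (\<Omega> N) \<dots> = log_mgf (\<Omega> N) (\<lambda>w. ?Z N w + \<alpha> N * X N w) + \<alpha> N * (1/2 * ?v)"
      by (rule prob_space.log_mgf_add_const[OF prob_space_\<Omega>[OF elim] ZX])
    finally show ?case
      using aN by (simp add: add_divide_distrib)
  qed
  ultimately show ?case
    by (simp add: Lim_transform_eventually distrib_left)
qed

lemma first_order_bfun:
  assumes "f \<in> bfun (E n)" "p \<le> n"
  shows "fo p n f \<in> bfun (E p)"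
  using assms
proof (induction n arbitrary: f)
  case 0
  then show ?case
    by (simp add: first_order_def)
next
  case (Suc n)
  show ?case
  proof (cases "p = Suc n")
    case True
    then show ?thesis
      using Suc.prems by (simp add: first_order_def)
  next
    case False
    then have p: "p \<le> n"
      using Suc.prems by simp
    then have "fo p (Suc n) f = fo p n (D (Suc n) (\<eta> n) f)"
      by (simp add: first_order_def)
    then show ?thesis
      using Suc.IH[OF D_bfun[OF Suc.prems(1)] p] by simp
  qed
qed

text \<open>By \<open>W_expansion\<close> the linearisation error, at scale
  \<open>sqrt (\<alpha> N)\<close>, is at most \<open>\<epsilon> N\<close> times a controlled
  sequence, hence a negligible perturbation of the sum already treated.\<close>

lemma log_mgf_W_lim:
  assumes f: "f \<in> bfun (E n)"
  shows "(\<lambda>N. log_mgf (\<Omega> N) (\<lambda>w. sqrt (\<alpha> N) * W N n f w) / \<alpha> N)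
    \<longlonglongrightarrow> 1/2 * (\<Sum>p=0..n. cov p (fo p n f))"
proof -
  \<comment> \<open>For \<open>p > n\<close> the iterated operator degenerates to the identity and
    \<open>f\<close> need not belong to \<open>bfun (E p)\<close>; zero completes the
    family.\<close>
  define g where "g p = (if p \<le> n then fo p n f else (\<lambda>_. 0))" for p
  have g: "g p \<in> bfun (E p)" for p
    using first_order_bfun[OF f] by (simp add: g_def)
  obtain S where S: "controlled S" and le: "\<And>N w. N \<ge> 1 \<Longrightarrow> w \<in> space (\<Omega> N) \<Longrightarrow>
      sqrt (real N) * \<bar>W N n f w - (\<Sum>p=0..n. V N p (fo p n f) w)\<bar> \<le> S N w"
    using W_expansion[OF f] by blast
  define X where "X N w = (W N n f w - (\<Sum>p=0..n. V N p (g p) w)) / sqrt (\<alpha> N)" for N w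
  have div: "\<alpha> N / sqrt (\<alpha> N) = sqrt (\<alpha> N)" if "N \<ge> 1" for N
    using alpha_pos[OF that] by (simp add: real_div_sqrt)
  have Xb: "X N \<in> bfun (\<Omega> N)" if "N \<ge> 1" for N
    unfolding X_def by (intro bfun_divide bfun_diff bfun_sum V_bfun_\<Omega> W_bfun_\<Omega> that g f)
  have X: "negligible_rv \<alpha> \<Omega> X"
  proof (rule negligibleI[OF prob_space_\<Omega> _ alpha_ge Xb, where S = S and \<theta> = "\<lambda>t N. t * \<epsilon> N" and b = "\<lambda>_ _. 0"])
    fix t :: real assume t: "t > 0"
    show "(\<lambda>N. t * \<epsilon> N) \<longlonglongrightarrow> 0"
      by (intro tendsto_mult_right_zero \<epsilon>_lim)
    have "t * \<alpha> N * \<bar>X N w\<bar> \<le> t * \<epsilon> N * S N w + \<alpha> N * 0"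
      if N: "N \<ge> 1" and w: "w \<in> space (\<Omega> N)" for N w
    proof -
      let ?x = "\<bar>W N n f w - (\<Sum>p=0..n. V N p (fo p n f) w)\<bar>"
      have "(\<Sum>p=0..n. V N p (g p) w) = (\<Sum>p=0..n. V N p (fo p n f) w)"
        by (intro sum.cong) (auto simp: g_def)
      then have "\<bar>X N w\<bar> = ?x / sqrt (\<alpha> N)"
        using alpha_pos[OF N] by (simp add: X_def abs_divide)
      then have "\<alpha> N * \<bar>X N w\<bar> = \<alpha> N / sqrt (\<alpha> N) * ?x"
        by simp
      also have "\<dots> = sqrt (\<alpha> N) / sqrt (real N) * (sqrt (real N) * ?x)"
        unfolding div[OF N] using N by simp
      also have "\<dots> \<le> \<epsilon> N * S N w"
        unfolding \<epsilon>_eq by (intro mult_left_mono le N w \<epsilon>_nonneg)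
      finally have "t * (\<alpha> N * \<bar>X N w\<bar>) \<le> t * (\<epsilon> N * S N w)"
        using t by (intro mult_left_mono) auto
      then show ?thesis
        by (simp add: mult.assoc)
    qed
    then show "\<forall>\<^sub>F N in sequentially. \<forall>w\<in>space (\<Omega> N). t * \<alpha> N * \<bar>X N w\<bar> \<le> t * \<epsilon> N * S N w + \<alpha> N * 0"
      by (intro eventually_mono[OF eventually_ge_at_top[of 1]]) blast
  qed (use S alpha_pos \<epsilon>_nonneg in \<open>auto simp: controlled_def\<close>)
  have "\<forall>\<^sub>F N in sequentially. log_mgf (\<Omega> N) (\<lambda>w. sqrt (\<alpha> N) * (\<Sum>p=0..n. V N p (g p) w) + \<alpha> N * X N w) / \<alpha> N
      = log_mgf (\<Omega> N) (\<lambda>w. sqrt (\<alpha> N) * W N n f w) / \<alpha> N"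
  proof (intro eventually_mono[OF eventually_ge_at_top[of 1]])
    fix N :: nat assume N: "1 \<le> N"
    have "\<alpha> N * X N w = \<alpha> N / sqrt (\<alpha> N) * (W N n f w - (\<Sum>p=0..n. V N p (g p) w))" for w
      by (simp add: X_def)
    then show "log_mgf (\<Omega> N) (\<lambda>w. sqrt (\<alpha> N) * (\<Sum>p=0..n. V N p (g p) w) + \<alpha> N * X N w) / \<alpha> N
        = log_mgf (\<Omega> N) (\<lambda>w. sqrt (\<alpha> N) * W N n f w) / \<alpha> N"
      unfolding div[OF N] by (simp add: right_diff_distrib)
  qed
  from Lim_transform_eventually[OF log_mgf_V_sum_perturbed_lim[OF g X Xb log_mgf_V_sum_lim] this]
  show ?thesis
    by (simp add: g_def)
qed

end

section \<open>Second moments of the limiting fields\<close>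

text \<open>Integrability must be secured because a Bochner integral defaults to 0 without it. For
  positive variance, writing \<open>x\<close> as \<open>m\<close> plus a centred part reduces the
  claim to centred normal moments; zero variance is a point mass.\<close>

lemma gaussian_rv_square_integrable:
  assumes "prob_space M" and X: "gaussian_rv M X"
  shows "integrable M (\<lambda>w. (X w)\<^sup>2)"
proof -
  interpret prob_space M by fact
  obtain m \<sigma> where meas: "X \<in> borel_measurable M" and \<sigma>: "\<sigma> \<ge> 0"
    and d: "distr M borel X = (if \<sigma> = 0 then return borel m else density lborel (normal_density m \<sigma>))"
    using X by (auto simp: gaussian_rv_def)
  have "integrable (distr M borel X) (\<lambda>x. x\<^sup>2)"
  proof (cases "\<sigma> = 0")
    case True
    interpret R: prob_space "return borel m"
      by (rule prob_space_return) simp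
    have "integrable (return borel m) (\<lambda>x. x\<^sup>2)"
      by (rule R.integrable_const_bound[where B = "m\<^sup>2"]) (simp_all add: AE_return)
    with True show ?thesis
      unfolding d by simp
  next
    case False
    with \<sigma> have \<sigma>: "\<sigma> > 0"
      by simp
    have "integrable lborel (\<lambda>x. normal_density m \<sigma> x * ((x - m)\<^sup>2 + 2 * m * (x - m) ^ 1 + m\<^sup>2))"
      unfolding distrib_left
      using integrable_normal_moment[OF \<sigma>, of m 2] integrable_normal_moment[OF \<sigma>, of m 1] integrable_normal_moment[OF \<sigma>, of m 0]
      by (auto simp: mult.left_commute[of _ "2 * m"])
    also have "(\<lambda>x. normal_density m \<sigma> x * ((x - m)\<^sup>2 + 2 * m * (x - m) ^ 1 + m\<^sup>2)) = (\<lambda>x. normal_density m \<sigma> x * x\<^sup>2)"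
      by (simp add: power2_eq_square algebra_simps)
    finally show ?thesis
      unfolding d using False \<sigma> by (simp add: integrable_density)
  qed
  then show ?thesis
    using meas by (subst (asm) integrable_distr_eq) auto
qed

text \<open>Fields at different times are independent and centred, so the mixed terms of the
  expanded square vanish, and the diagonal is the prescribed covariance.\<close>

lemma limit_fields_sum_square:
  assumes lf: "limit_fields E K \<eta>0 M V" and g: "\<And>p. p \<le> n \<Longrightarrow> g p \<in> bfun (E p)"
  shows "(\<integral>w. (\<Sum>p=0..n. V p (g p) w)\<^sup>2 \<partial>M) = (\<Sum>p=0..n. field_cov \<eta>0 K p (g p) (g p))"
proof -
  interpret prob_space M
    using lf by (simp add: limit_fields_def)
  have gauss: "gaussian_rv M (V p (g p))" and mean: "(\<integral>w. V p (g p) w \<partial>M) = 0" if "p \<le> n" for p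
  proof -
    have cgf: "centered_gaussian_field M (bfun (E p)) (V p)"
      using lf by (simp add: limit_fields_def)
    then have "\<forall>J a. finite J \<and> J \<subseteq> bfun (E p) \<longrightarrow> gaussian_rv M (\<lambda>w. \<Sum>f\<in>J. a f * V p f w)"
      unfolding centered_gaussian_field_def by (rule conjunct1)
    from this[rule_format, of "{g p}" "\<lambda>_. 1"] g[OF that] show "gaussian_rv M (V p (g p))"
      by simp
    show "(\<integral>w. V p (g p) w \<partial>M) = 0"
      using cgf g[OF that] by (simp add: centered_gaussian_field_def)
  qed
  have meas: "V p (g p) \<in> borel_measurable M" if "p \<le> n" for p
    using gauss[OF that] by (simp add: gaussian_rv_def)
  have sq: "integrable M (\<lambda>w. (V p (g p) w)\<^sup>2)" if "p \<le> n" for p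
    by (rule gaussian_rv_square_integrable[OF prob_space_axioms gauss[OF that]])
  have int1: "integrable M (V p (g p))" if "p \<le> n" for p
    using square_integrable_imp_integrable[OF meas[OF that] sq[OF that]] .
  have int: "integrable M (\<lambda>w. V p (g p) w * V q (g q) w)" if "p \<le> n" "q \<le> n" for p q
  proof (rule Bochner_Integration.integrable_bound)
    show "integrable M (\<lambda>w. (V p (g p) w)\<^sup>2 + (V q (g q) w)\<^sup>2)"
      by (intro Bochner_Integration.integrable_add sq that)
    show "AE w in M. norm (V p (g p) w * V q (g q) w) \<le> norm ((V p (g p) w)\<^sup>2 + (V q (g q) w)\<^sup>2)"
      using abs_mult_le_sum_squares by (intro AE_I2) (simp add: order_trans[OF abs_mult_le_sum_squares])
  qed (use meas that in simp)
  have cov: "(\<integral>w. V p (g p) w * V q (g q) w \<partial>M) = (if p = q then field_cov \<eta>0 K p (g p) (g p) else 0)"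
    if "p \<le> n" "q \<le> n" for p q
  proof (cases "p = q")
    case True
    then show ?thesis
      using lf g[OF that(1)] by (simp add: limit_fields_def)
  next
    case False
    have "indep_vars (\<lambda>n. \<Pi>\<^sub>M f\<in>bfun (E n). (borel :: real measure)) (\<lambda>n w. \<lambda>f\<in>bfun (E n). V n f w) UNIV"
      using lf by (simp add: limit_fields_def)
    then have "indep_vars (\<lambda>n. \<Pi>\<^sub>M f\<in>bfun (E n). (borel :: real measure)) (\<lambda>n w. \<lambda>f\<in>bfun (E n). V n f w) {p, q}"
      by (rule indep_vars_subset) simp
    \<comment> \<open>Independence is that of whole fields; evaluation at \<open>g i\<close> is a
      coordinate projection of the product space, hence measurable.\<close>
    then have "indep_vars (\<lambda>_. borel) (\<lambda>i w. (\<lambda>f\<in>bfun (E i). V i f w) (g i)) {p, q}"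
      by (rule indep_vars_compose2[where Y = "\<lambda>i x. x (g i)"]) (auto intro!: measurable_component_singleton g that)
    then have "(\<integral>w. (\<Prod>i\<in>{p, q}. (\<lambda>f\<in>bfun (E i). V i f w) (g i)) \<partial>M)
        = (\<Prod>i\<in>{p, q}. \<integral>w. (\<lambda>f\<in>bfun (E i). V i f w) (g i) \<partial>M)"
      using g int1 that by (intro indep_vars_lebesgue_integral) auto
    then show ?thesis
      using False g mean that by simp
  qed
  have "(\<integral>w. (\<Sum>p=0..n. V p (g p) w)\<^sup>2 \<partial>M) = (\<integral>w. (\<Sum>p=0..n. \<Sum>q=0..n. V p (g p) w * V q (g q) w) \<partial>M)"
    by (simp add: power2_eq_square sum_product)
  also have "\<dots> = (\<Sum>p=0..n. \<Sum>q=0..n. \<integral>w. V p (g p) w * V q (g q) w \<partial>M)"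
    by (subst Bochner_Integration.integral_sum)
      (auto intro!: Bochner_Integration.integrable_sum Bochner_Integration.integral_sum sum.cong int)
  also have "\<dots> = (\<Sum>p=0..n. \<Sum>q=0..n. if p = q then field_cov \<eta>0 K p (g p) (g p) else 0)"
    by (intro sum.cong refl cov) auto
  also have "\<dots> = (\<Sum>p=0..n. field_cov \<eta>0 K p (g p) (g p))"
    by (intro sum.cong refl) (simp add: sum.delta)
  finally show ?thesis .
qed

theorem theorem2p4:
  fixes E :: "nat \<Rightarrow> 'a measure"
    and K :: "nat \<Rightarrow> 'a measure \<Rightarrow> 'a \<Rightarrow> 'a measure"
    and \<eta>0 :: "'a measure"
    and D :: "nat \<Rightarrow> 'a measure \<Rightarrow> ('a \<Rightarrow> real) \<Rightarrow> 'a \<Rightarrow> real"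
    and \<Omega> :: "nat \<Rightarrow> 'w measure"
    and \<xi> :: "nat \<Rightarrow> nat \<Rightarrow> nat \<Rightarrow> 'w \<Rightarrow> 'a"
    and \<Omega>' :: "'v measure"
    and V :: "nat \<Rightarrow> ('a \<Rightarrow> real) \<Rightarrow> 'v \<Rightarrow> real"
    and \<alpha> :: "nat \<Rightarrow> real"
    and n :: nat
    and f :: "nat \<Rightarrow> 'a \<Rightarrow> real"
  assumes init: "\<eta>0 \<in> probs (E 0)"
    and kernels: "\<And>m \<eta>. \<eta> \<in> probs (E m) \<Longrightarrow> K (Suc m) \<eta> \<in> E m \<rightarrow>\<^sub>M prob_algebra (E (Suc m))"
    and meas: "\<And>m N i A. N \<ge> 1 \<Longrightarrow> i \<in> {1..N} \<Longrightarrow> A \<in> sets (E (Suc m)) \<Longrightarrow>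
      (\<lambda>x. measure (K (Suc m) (emp (E m) N x) (x i)) A) \<in> borel_measurable (\<Pi>\<^sub>M j\<in>{1..N}. E m)"
    and H1_K: "\<And>m. condition_K (E m) (E (Suc m)) (K (Suc m))"
    and H1_Upsilon: "\<And>m. class_Upsilon (E m) (E (Suc m)) (transport (K (Suc m))) (D (Suc m))"
    and particles: "\<And>N. N \<ge> 1 \<Longrightarrow> particle_system E K \<eta>0 N (\<Omega> N) (\<xi> N)"
    and fields: "limit_fields E K \<eta>0 \<Omega>' V"
    and alpha_pos: "\<And>N. N \<ge> 1 \<Longrightarrow> \<alpha> N > 0"
    and alpha_mono: "mono_on {1..} \<alpha>"
    and alpha_lim: "(\<lambda>N. \<alpha> N / real N) \<longlonglongrightarrow> 0"
    and f: "\<And>p. f p \<in> bfun (E p)"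
  shows "((\<lambda>N. 1 / \<alpha> N *
            ln (\<integral>\<omega>. exp (sqrt (\<alpha> N) * (\<Sum>p=0..n. VN E K \<eta>0 N (\<xi> N) p (f p) \<omega>)) \<partial>\<Omega> N))
          \<longlonglongrightarrow> 1 / 2 * (\<Sum>p=0..n. \<integral>\<omega>. (V p (f p) \<omega>)\<^sup>2 \<partial>\<Omega>'))
       \<and> ((\<lambda>N. 1 / \<alpha> N *
            ln (\<integral>\<omega>. exp (sqrt (\<alpha> N) * WN E K \<eta>0 N (\<xi> N) n (f n) \<omega>) \<partial>\<Omega> N))
          \<longlonglongrightarrow> 1 / 2 * (\<integral>\<omega>. (W_limit \<eta>0 K D V n (f n) \<omega>)\<^sup>2 \<partial>\<Omega>'))"
proof -
  interpret moderate_deviations E K \<eta>0 D \<Omega> \<xi> \<alpha>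
  proof (intro moderate_deviations.intro particle_approximations.intro moderate_deviations_axioms.intro)
    show "particle_approximation E K \<eta>0 N (\<Omega> N) (\<xi> N)" if "N \<ge> 1" for N
      using that by (intro particle_approximation.intro init kernels meas particles)
  qed (fact H1_K H1_Upsilon alpha_pos alpha_mono alpha_lim)+
  have "(\<integral>\<omega>. (V p (f p) \<omega>)\<^sup>2 \<partial>\<Omega>') = field_cov \<eta>0 K p (f p) (f p)" for p
    using fields f[of p] by (simp add: limit_fields_def power2_eq_square)
  moreover have "(\<integral>\<omega>. (W_limit \<eta>0 K D V n (f n) \<omega>)\<^sup>2 \<partial>\<Omega>')
      = (\<Sum>p=0..n. field_cov \<eta>0 K p (first_order \<eta>0 K D p n (f n)) (first_order \<eta>0 K D p n (f n)))"
    unfolding W_limit_def by (rule limit_fields_sum_square[OF fields first_order_bfun[OF f]])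
  ultimately show ?thesis
    using log_mgf_V_sum_lim[of f n] log_mgf_W_lim[of "f n" n] f by (simp add: log_mgf_def)
qed

end
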